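(* Let $d\ge 1$, let $g\in L^2(\mathbb{R}^d)$ with $\|g\|_{L^2(\mathbb{R}^d)}=1$, let $S\subset\mathbb{R}^{2d}$ be compact, and let $0<\epsilon<1/2$. For $r>0$ let $\eta(\epsilon,rS)$ denote the maximum number of orthonormal functions $F\in L^2(\mathbb{R}^{2d})$ such that $$\left\Vert D_{rS}\mathcal{P}_gD_{rS}F-F\right\Vert^2\le\epsilon$$ (i.e. the maximal cardinality of an orthonormal set in $L^2(\mathbb{R}^{2d})$ all of whose elements satisfy this inequality). Then $$|S|(1+\epsilon)\;\le\;\lim_{r\to\infty}\frac{\eta(\epsilon,rS)}{r^{2d}}\;\le\;\frac{|S|}{1-2\epsilon}.$$
   Context: $|\cdot|$ is Lebesgue measure on $\mathbb{R}^{2d}$, and $\|\cdot\|$ (without subscript) is the norm of the complex Hilbert space $L^2(\mathbb{R}^{2d})$. $rS=\{rz: z\in S\}$ is the dilate of $S$. For measurable $A\subset\mathbb{R}^{2d}$, $D_AF=\chi_AF$ is multiplication by the characteristic function of $A$ on $L^2(\mathbb{R}^{2d})$. The Gabor (short-time Fourier) transform with window $g$ is, for $z=(x,\xi)\in\mathbb{R}^{2d}$ and $f\in L^2(\mathbb{R}^d)$, $\mathcal{V}_gf(x,\xi)=\int_{\mathbb{R}^d}f(t)\overline{g(t-x)}e^{-2\pi i\xi\cdot t}\,dt$. For $\|g\|_{L^2(\mathbb{R}^d)}=1$ it is an isometry from $L^2(\mathbb{R}^d)$ into $L^2(\mathbb{R}^{2d})$; its range $\mathcal{G}_g=\{\mathcal{V}_gf: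 f\in L^2(\mathbb{R}^d)\}$ is called the Gabor space. $\mathcal{P}_g$ is the orthogonal projection of $L^2(\mathbb{R}^{2d})$ onto $\mathcal{G}_g$; explicitly $\mathcal{P}_gF(z)=\int_{\mathbb{R}^{2d}}F(w)\overline{K_g(z,w)}\,dw$ with $K_g(z,w)=\langle\pi_zg,\pi_wg\rangle_{L^2(\mathbb{R}^d)}$, where $\pi_{(x,\xi)}g(t)=e^{2\pi i\xi\cdot t}g(t-x)$. *)

theory Defs
  imports "HOL-Analysis.Analysis" "HOL-Library.Extended_Nat"
begin

text \<open>Elements of $L^2$ are represented by Lebesgue measurable, square integrable functions;
  two representatives that agree almost everywhere stand for the same element.\<close>

definition L2_fun :: "('a::euclidean_space \<Rightarrow> complex) set" where
  "L2_fun = {F. F \<in> borel_measurable lebesgue \<and> integrable lebesgue (\<lambda>z. (cmod (F z))\<^sup>2)}"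

definition L2_ip :: "('a::euclidean_space \<Rightarrow> complex) \<Rightarrow> ('a \<Rightarrow> complex) \<Rightarrow> complex" where
  "L2_ip F G = (\<integral>z. F z * cnj (G z) \<partial>lebesgue)"

definition L2_nrm :: "('a::euclidean_space \<Rightarrow> complex) \<Rightarrow> real" where
  "L2_nrm F = sqrt (\<integral>z. (cmod (F z))\<^sup>2 \<partial>lebesgue)"

text \<open>Two different members of an orthonormal set of functions are never equal almost
  everywhere, since their inner product would then be 1. So the cardinality of such a set is that
  of the corresponding set of $L^2$ classes.\<close>

definition L2_orthonormal :: "('a::euclidean_space \<Rightarrow> complex) set \<Rightarrow> bool" where
  "L2_orthonormal B \<longleftrightarrow>
     B \<subseteq> L2_fun \<and> (\<forall>F\<in>B. \<forall>G\<in>B. L2_ip F G = (if F = G then 1 else 0))"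

definition gabor_transform ::
    "(real^'n \<Rightarrow> complex) \<Rightarrow> (real^'n \<Rightarrow> complex) \<Rightarrow> (real^'n) \<times> (real^'n) \<Rightarrow> complex" where
  "gabor_transform g f = (\<lambda>(x, \<xi>).
     \<integral>t. f t * cnj (g (t - x)) * exp (- 2 * of_real pi * \<i> * of_real (\<xi> \<bullet> t)) \<partial>lebesgue)"

definition gabor_space :: "(real^'n \<Rightarrow> complex) \<Rightarrow> ((real^'n) \<times> (real^'n) \<Rightarrow> complex) set" where
  "gabor_space g = gabor_transform g ` L2_fun"

text \<open>The orthogonal projection onto the Gabor space, for a window of norm 1. The description is
  unique already at the level of functions: if two elements of the Gabor space agree almost
  everywhere, then by the isometry property they are transforms of almost everywhere equal
  functions, and hence equal at every point.\<close>

definition gabor_proj ::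
    "(real^'n \<Rightarrow> complex) \<Rightarrow> ((real^'n) \<times> (real^'n) \<Rightarrow> complex)
      \<Rightarrow> (real^'n) \<times> (real^'n) \<Rightarrow> complex" where
  "gabor_proj g F =
     (THE H. H \<in> gabor_space g \<and> (\<forall>G\<in>gabor_space g. L2_ip (\<lambda>z. F z - H z) G = 0))"

definition restr_op :: "'a set \<Rightarrow> ('a \<Rightarrow> complex) \<Rightarrow> 'a \<Rightarrow> complex" where
  "restr_op A F = (\<lambda>z. indicator A z * F z)"

text \<open>The maximum is taken as a supremum of extended natural numbers, so that it is \<open>\<infinity>\<close>, and not
  an arbitrary value, if there are such orthonormal sets of every finite size; a finite value is
  attained. Infinite orthonormal sets are covered through their finite subsets.\<close>

definition gabor_eta ::
    "(real^'n \<Rightarrow> complex) \<Rightarrow> real \<Rightarrow> ((real^'n) \<times> (real^'n)) set \<Rightarrow> enat" where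
  "gabor_eta g \<epsilon> A =
     (SUP B \<in> {B. finite B \<and> L2_orthonormal B \<and>
        (\<forall>F\<in>B. (L2_nrm (\<lambda>z. restr_op A (gabor_proj g (restr_op A F)) z - F z))\<^sup>2 \<le> \<epsilon>)}.
        enat (card B))"

end

(*
Write D for the restriction to A = rS and P for the Gabor projection, and put T = D P D. For a unit
vector F,
  ||T F - F||^2 = 1 - ||P D F||^2 - ||(1 - D) P D F||^2.
Summing over an orthonormal set and applying Bessel's inequality to the reproducing kernels bounds
its cardinality by (|A| + leak) / (1 - eps), where leak is the integral of |K(z, w)|^2 over z outside
and w inside A. Since |K(z, w)| = |V_g g(z - w)| with V_g g in L^2, the leak is o(r^(2d)).

For the lower bound take N slightly below |A| / (1 - eps) and an N-tuple of orthonormal functions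
that almost maximizes the trace, the sum of ||P D e_i||^2. As |A| / N stays below 1, the form
||P D F||^2 is bounded by theta ||F||^2, theta < 1, on the orthogonal complement of the tuple;
testing this on the kernels restricted to A shows that the tuple captures the whole trace |A| up to
O(leak). Rotations in coordinate planes then equalize the diagonal, so that each member has
||P D f_i||^2 >= 1 - eps. Hence the limit is |S| / (1 - eps), which lies between the two bounds.
*)

theory Submission
  imports Defs "HOL-Probability.Characteristic_Functions"
begin

section \<open>Trace maximization for a form dominated by an inner product\<close>

text \<open>The orthonormal functions need not be eigenfunctions of T. Up to o(r^(2d)), T has |A|
  eigenvalues close to 1 and the others are close to 0, and orthonormal mixtures of both kinds are
  admissible as long as ||P D F||^2 stays at 1 - \<epsilon>; this is why the limit exceeds |S|. The
  choice of N is squeezed from two sides: N > |A| makes the mean of the diagonal, and with it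
  \<theta>, smaller than 1, while N (1 - \<epsilon>) must stay far enough below |A| to leave room
  for the trace lost to the leak. T is never diagonalized; only the form ||P D F||^2 and its
  variational behaviour are used. The supremum of the trace is merely approached, so every
  optimality condition carries an error \<kappa>, chosen after A and N, which becomes sqrt \<kappa>
  in the off-diagonal entries. Functions that agree almost everywhere are not identified, so
  positivity is assumed and not definiteness; the same axioms then fit both the inner product and
  the form. The analytic input is the isometry of the transform, which rests on a Plancherel theorem
  obtained by Gaussian damping.\<close>

locale semi_inner =
  fixes X :: "('a \<Rightarrow> complex) set" and ip :: "('a \<Rightarrow> complex) \<Rightarrow> ('a \<Rightarrow> complex) \<Rightarrow> complex"
  assumes zero_mem: "(\<lambda>z. 0) \<in> X"
    and comb_mem: "F \<in> X \<Longrightarrow> G \<in> X \<Longrightarrow> (\<lambda>z. c * F z + d * G z) \<in> X"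
    and ip_comb: "F \<in> X \<Longrightarrow> G \<in> X \<Longrightarrow> H \<in> X \<Longrightarrow>
      ip (\<lambda>z. c * F z + d * G z) H = c * ip F H + d * ip G H"
    and ip_cnj: "F \<in> X \<Longrightarrow> G \<in> X \<Longrightarrow> ip G F = cnj (ip F G)"
    and ip_nonneg: "F \<in> X \<Longrightarrow> 0 \<le> Re (ip F F)"
begin

abbreviation qf :: "('a \<Rightarrow> complex) \<Rightarrow> real" where
  "qf F \<equiv> Re (ip F F)"

text \<open>A tuple and not a set, so that single members can be exchanged by function
  update.\<close>

definition orthonormal_family :: "nat \<Rightarrow> (nat \<Rightarrow> 'a \<Rightarrow> complex) \<Rightarrow> bool" where
  "orthonormal_family N e \<longleftrightarrow> (\<forall>i<N. e i \<in> X) \<and> (\<forall>i<N. \<forall>j<N. ip (e i) (e j) = (if i = j then 1 else 0))"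

lemma ip_comb_right:
  assumes "F \<in> X" "G \<in> X" "H \<in> X"
  shows "ip H (\<lambda>z. c * F z + d * G z) = cnj c * ip H F + cnj d * ip H G"
proof -
  have "ip H (\<lambda>z. c * F z + d * G z) = cnj (c * ip F H + d * ip G H)"
    using assms by (subst ip_cnj[of "\<lambda>z. c * F z + d * G z"]) (auto simp: comb_mem ip_comb)
  then show ?thesis
    using ip_cnj[of F H] ip_cnj[of G H] assms by simp
qed

lemma ip_self: "F \<in> X \<Longrightarrow> ip F F = of_real (qf F)"
  using ip_cnj[of F F] by (simp add: complex_eq_iff)

lemma scale_mem: "F \<in> X \<Longrightarrow> (\<lambda>z. c * F z) \<in> X"
  using comb_mem[of F F c 0] by simp

lemma ip_scale: "F \<in> X \<Longrightarrow> H \<in> X \<Longrightarrow> ip (\<lambda>z. c * F z) H = c * ip F H"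
  using ip_comb[of F F H c 0] by simp

lemma ip_scale_right: "F \<in> X \<Longrightarrow> H \<in> X \<Longrightarrow> ip H (\<lambda>z. c * F z) = cnj c * ip H F"
  using ip_comb_right[of F F H c 0] by simp

lemma qf_scale: "F \<in> X \<Longrightarrow> qf (\<lambda>z. c * F z) = (cmod c)\<^sup>2 * qf F"
proof -
  assume F: "F \<in> X"
  have "ip (\<lambda>z. c * F z) (\<lambda>z. c * F z) = (c * cnj c) * ip F F"
    using F by (simp add: ip_scale ip_scale_right scale_mem)
  then show ?thesis
    by (simp add: complex_norm_square[symmetric] del: of_real_power)
qed

lemma diff_mem: "F \<in> X \<Longrightarrow> G \<in> X \<Longrightarrow> (\<lambda>z. F z - G z) \<in> X"
  using comb_mem[of F G 1 "-1"] by simp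

lemma ip_diff: "F \<in> X \<Longrightarrow> G \<in> X \<Longrightarrow> H \<in> X \<Longrightarrow> ip (\<lambda>z. F z - G z) H = ip F H - ip G H"
  using ip_comb[of F G H 1 "-1"] by simp

lemma qf_comb:
  assumes F: "F \<in> X" and G: "G \<in> X"
  shows "qf (\<lambda>z. c * F z + d * G z) = (cmod c)\<^sup>2 * qf F + 2 * Re (c * cnj d * ip F G) + (cmod d)\<^sup>2 * qf G"
proof -
  have 1: "ip (\<lambda>z. c * F z + d * G z) (\<lambda>z. c * F z + d * G z) =
     (c * cnj c) * ip F F + (d * cnj d) * ip G G + (c * cnj d * ip F G + cnj (c * cnj d * ip F G))"
    using F G ip_cnj[OF F G] by (simp add: ip_comb ip_comb_right comb_mem algebra_simps)
  have 2: "Re (w + cnj w) = 2 * Re w" for w by simp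
  have 3: "Re ((c * cnj c) * ip H H) = (cmod c)\<^sup>2 * qf H" if "H \<in> X" for c H
    by (simp add: complex_norm_square[symmetric] del: of_real_power)
  show ?thesis
    unfolding 1 by (simp only: plus_complex.sel 3[OF F] 3[OF G]) (simp add: algebra_simps)
qed

lemma qf_add: "F \<in> X \<Longrightarrow> G \<in> X \<Longrightarrow> qf (\<lambda>z. F z + G z) = qf F + 2 * Re (ip F G) + qf G"
  using qf_comb[of F G 1 1] by simp

lemma qf_diff: "F \<in> X \<Longrightarrow> G \<in> X \<Longrightarrow> qf (\<lambda>z. F z - G z) = qf F - 2 * Re (ip F G) + qf G"
  using qf_comb[of F G 1 "-1"] by simp

text \<open>Nonnegativity of \<open>qf\<close> at F - t w G for all real t, where w =
  \<open>ip F G\<close>. Without definiteness the case \<open>qf G = 0\<close> stands apart: there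
  the quadratic in t degenerates to a linear function.\<close>

lemma Cauchy_Schwarz:
  assumes F: "F \<in> X" and G: "G \<in> X"
  shows "(cmod (ip F G))\<^sup>2 \<le> qf F * qf G"
proof -
  define w where "w = ip F G"
  have main: "0 \<le> qf F - 2 * t * (cmod w)\<^sup>2 + t\<^sup>2 * (cmod w)\<^sup>2 * qf G" for t :: real
  proof -
    have "0 \<le> qf (\<lambda>z. 1 * F z + (- of_real t * w) * G z)"
      by (intro ip_nonneg comb_mem F G)
    also have "\<dots> = qf F + 2 * Re (cnj (- of_real t * w) * w) + (cmod (- of_real t * w))\<^sup>2 * qf G"
      by (subst qf_comb[OF F G]) (simp add: w_def)
    also have "cnj (- of_real t * w) * w = of_real (- t * (cmod w)\<^sup>2)"
      by (simp add: complex_norm_square mult.commute mult.left_commute del: of_real_power)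
    finally show ?thesis
      by (simp add: norm_mult power_mult_distrib)
  qed
  show ?thesis
  proof (cases "qf G = 0")
    case True
    have "cmod w = 0"
    proof (rule ccontr)
      assume "cmod w \<noteq> 0"
      then show False
        \<comment> \<open>For this t the bound \<open>main\<close> reads 0 \<le> -1.\<close>
        using main[of "(qf F + 1) / (2 * (cmod w)\<^sup>2)"] True by (simp add: field_simps)
    qed
    then show ?thesis using True by (simp add: w_def)
  next
    case False
    then have pos: "0 < qf G" using ip_nonneg[OF G] by simp
    have "0 \<le> qf F - 2 * (1 / qf G) * (cmod w)\<^sup>2 + (1 / qf G)\<^sup>2 * (cmod w)\<^sup>2 * qf G"
      by (rule main)
    also have "\<dots> = qf F - (cmod w)\<^sup>2 / qf G"
      using pos by (simp add: field_simps power2_eq_square)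
    finally show ?thesis using pos by (simp add: field_simps w_def)
  qed
qed

lemma sum_mem:
  assumes "finite I" "\<And>i. i \<in> I \<Longrightarrow> e i \<in> X"
  shows "(\<lambda>z. \<Sum>i\<in>I. c i * e i z) \<in> X"
  using assms
proof (induction I rule: finite_induct)
  case (insert x I)
  then show ?case using comb_mem[of "e x" "\<lambda>z. \<Sum>i\<in>I. c i * e i z" "c x" 1] by simp
qed (simp add: zero_mem)

lemma ip_sum:
  assumes "finite I" "\<And>i. i \<in> I \<Longrightarrow> e i \<in> X" "H \<in> X"
  shows "ip (\<lambda>z. \<Sum>i\<in>I. c i * e i z) H = (\<Sum>i\<in>I. c i * ip (e i) H)"
  using assms
proof (induction I rule: finite_induct)
  case empty
  then show ?case using ip_scale[of H H 0] by simp
next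
  case (insert x I)
  then show ?case
    using ip_comb[of "e x" "\<lambda>z. \<Sum>i\<in>I. c i * e i z" H "c x" 1] sum_mem[of I e c] by simp
qed

text \<open>Subtracting the orthogonal projection on the span leaves a residual orthogonal to the
  family, whose size follows from Pythagoras.\<close>

lemma Bessel_decomposition:
  assumes I: "finite I" and e: "\<And>i. i \<in> I \<Longrightarrow> e i \<in> X"
    and on: "\<And>i j. i \<in> I \<Longrightarrow> j \<in> I \<Longrightarrow> ip (e i) (e j) = (if i = j then 1 else 0)"
    and F: "F \<in> X"
  defines "v \<equiv> (\<lambda>z. F z - (\<Sum>i\<in>I. ip F (e i) * e i z))"
  shows "v \<in> X" "\<And>i. i \<in> I \<Longrightarrow> ip v (e i) = 0" "qf v = qf F - (\<Sum>i\<in>I. (cmod (ip F (e i)))\<^sup>2)"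
proof -
  define u where "u = (\<lambda>z. \<Sum>i\<in>I. ip F (e i) * e i z)"
  have u: "u \<in> X" unfolding u_def by (intro sum_mem I e)
  have v_eq: "v = (\<lambda>z. F z - u z)" by (simp add: v_def u_def)
  show v: "v \<in> X" unfolding v_eq by (intro diff_mem F u)
  have ue: "ip u (e i) = ip F (e i)" if "i \<in> I" for i
  proof -
    have "ip u (e i) = (\<Sum>j\<in>I. ip F (e j) * ip (e j) (e i))"
      unfolding u_def by (intro ip_sum I e that)
    also have "\<dots> = (\<Sum>j\<in>I. if j = i then ip F (e j) else 0)"
      by (intro sum.cong) (auto simp: on that)
    also have "\<dots> = ip F (e i)" using that I by simp
    finally show ?thesis .
  qed
  show ve: "ip v (e i) = 0" if "i \<in> I" for i
    unfolding v_eq using that by (simp add: ip_diff F u e ue)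
  have uF: "ip u F = of_real (\<Sum>i\<in>I. (cmod (ip F (e i)))\<^sup>2)"
  proof -
    have "ip u F = (\<Sum>j\<in>I. ip F (e j) * ip (e j) F)"
      unfolding u_def by (intro ip_sum I e F)
    also have "\<dots> = (\<Sum>j\<in>I. of_real ((cmod (ip F (e j)))\<^sup>2))"
      by (intro sum.cong refl) (simp add: ip_cnj[OF F e] complex_norm_square del: of_real_power)
    finally show ?thesis by simp
  qed
  have uu: "ip u u = ip u F"
  proof -
    have "ip u u = (\<Sum>j\<in>I. ip F (e j) * ip (e j) u)"
      by (subst (1) u_def) (intro ip_sum I e u)
    also have "\<dots> = (\<Sum>j\<in>I. ip F (e j) * ip (e j) F)"
      by (intro sum.cong refl) (simp add: ip_cnj[OF F e] ip_cnj[OF u e] ue)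
    also have "\<dots> = ip u F"
      unfolding u_def by (intro ip_sum[symmetric] I e F)
    finally show ?thesis .
  qed
  have "qf v = qf F - 2 * Re (ip F u) + qf u"
    unfolding v_eq by (rule qf_diff[OF F u])
  then show "qf v = qf F - (\<Sum>i\<in>I. (cmod (ip F (e i)))\<^sup>2)"
    using uF uu ip_cnj[OF u F] by simp
qed

lemma Bessel:
  assumes "finite I" "\<And>i. i \<in> I \<Longrightarrow> e i \<in> X"
    and "\<And>i j. i \<in> I \<Longrightarrow> j \<in> I \<Longrightarrow> ip (e i) (e j) = (if i = j then 1 else 0)"
    and "F \<in> X"
  shows "(\<Sum>i\<in>I. (cmod (ip F (e i)))\<^sup>2) \<le> qf F"
  using ip_nonneg[OF Bessel_decomposition(1)[OF assms]] Bessel_decomposition(3)[OF assms] by simp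

lemma orthonormal_family_update:
  assumes e: "orthonormal_family N e" and u: "u \<in> X" "ip u u = 1"
    and ue: "\<And>i. i < N \<Longrightarrow> i \<noteq> j \<Longrightarrow> ip u (e i) = 0"
  shows "orthonormal_family N (e(j := u))"
proof -
  have "ip (e i) u = 0" if "i < N" "i \<noteq> j" for i
    using ip_cnj[of u "e i"] u ue[OF that] e that by (simp add: orthonormal_family_def)
  then show ?thesis
    using assms by (auto simp: orthonormal_family_def)
qed

text \<open>The three equations say that the rows (c1, c2) and (d1, d2) form a unitary matrix acting
  on the plane of \<open>e i\<close> and \<open>e j\<close>; vectors orthogonal to that plane are
  not affected.\<close>

lemma orthonormal_family_unitary:
  assumes e: "orthonormal_family N e" and i: "i < N" and j: "j < N" and ij: "i \<noteq> j"
    and c: "c1 * cnj c1 + c2 * cnj c2 = 1" and d: "d1 * cnj d1 + d2 * cnj d2 = 1"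
    and cd: "c1 * cnj d1 + c2 * cnj d2 = 0"
  shows "orthonormal_family N (e(i := (\<lambda>z. c1 * e i z + c2 * e j z), j := (\<lambda>z. d1 * e i z + d2 * e j z)))"
proof -
  have mem: "\<And>k. k < N \<Longrightarrow> e k \<in> X" and on: "\<And>k l. k < N \<Longrightarrow> l < N \<Longrightarrow> ip (e k) (e l) = (if k = l then 1 else 0)"
    using e by (auto simp: orthonormal_family_def)
  have dc: "d1 * cnj c1 + d2 * cnj c2 = 0"
    using arg_cong[OF cd, of cnj] by (simp add: mult.commute)
  have 1: "ip (\<lambda>z. a1 * e i z + a2 * e j z) (\<lambda>z. b1 * e i z + b2 * e j z) = a1 * cnj b1 + a2 * cnj b2"
    for a1 a2 b1 b2
    using i j ij by (simp add: ip_comb ip_comb_right comb_mem mem on)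
  have 2: "ip (e k) (\<lambda>z. a1 * e i z + a2 * e j z) = 0" "ip (\<lambda>z. a1 * e i z + a2 * e j z) (e k) = 0"
    if "k < N" "k \<noteq> i" "k \<noteq> j" for k a1 a2
    using that i j by (simp_all add: ip_comb ip_comb_right comb_mem mem on)
  show ?thesis
    unfolding orthonormal_family_def using i j ij
    by (auto simp: on comb_mem mem 1 2 c d cd dc)
qed

end

text \<open>The form is itself a \<open>semi_inner\<close> on the same space, so everything above,
  Cauchy-Schwarz in particular, holds for it under the prefix \<open>form\<close>.\<close>

locale dominated_form = semi_inner X ip + form: semi_inner X a
  for X :: "('a \<Rightarrow> complex) set" and ip a +
  assumes form_le: "F \<in> X \<Longrightarrow> Re (a F F) \<le> Re (ip F F)"
begin

text \<open>Induction on the number of indices whose diagonal entry differs from c. If some entry is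
  below c, the mean forces another above c; a rotation in their plane sets the first to c and keeps
  the sum of the two. The second index had been counted already, so the number drops.\<close>

lemma equalize_diagonal:
  assumes "orthonormal_family N e" "real N * c \<le> (\<Sum>i<N. form.qf (e i))"
  shows "\<exists>f. orthonormal_family N f \<and> (\<forall>i<N. c \<le> form.qf (f i))"
  using assms
proof (induction "card {i. i < N \<and> form.qf (e i) \<noteq> c}" arbitrary: e rule: less_induct)
  case less
  note e = less.prems(1)
  show ?case
  proof (cases "\<forall>i<N. c \<le> form.qf (e i)")
    case True
    then show ?thesis using e by blast
  next
    case False
    then obtain i where i: "i < N" "form.qf (e i) < c" by (auto simp: not_le)
    have "\<exists>j<N. c < form.qf (e j)"
    proof (rule ccontr)
      assume "\<not> (\<exists>j<N. c < form.qf (e j))"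
      then have "(\<Sum>i<N. form.qf (e i)) < (\<Sum>i<N. c)"
        using i by (intro sum_strict_mono_ex1) (auto simp: not_less, meson not_less)
      then show False using less.prems(2) by simp
    qed
    then obtain j where j: "j < N" "c < form.qf (e j)" by blast
    have ij: "i \<noteq> j" using i j by auto
    have mem: "e i \<in> X" "e j \<in> X" using e i j by (auto simp: orthonormal_family_def)
    define h where "h \<theta> = form.qf (\<lambda>z. of_real (cos \<theta>) * e i z + of_real (sin \<theta>) * e j z)" for \<theta>
    have h: "h \<theta> = (cos \<theta>)\<^sup>2 * form.qf (e i) + 2 * (cos \<theta> * sin \<theta> * Re (a (e i) (e j)))
        + (sin \<theta>)\<^sup>2 * form.qf (e j)" for \<theta>
      unfolding h_def by (subst form.qf_comb[OF mem]) (simp add: algebra_simps)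
    \<comment> \<open>The rotated vector is \<open>e i\<close> at angle 0 and \<open>e j\<close> at
      angle pi / 2, so its form value passes through c.\<close>
    have "\<exists>\<theta>. 0 \<le> \<theta> \<and> \<theta> \<le> pi / 2 \<and> h \<theta> = c"
    proof (rule IVT')
      show "h 0 \<le> c" "c \<le> h (pi / 2)" using i j by (simp_all add: h)
      show "continuous_on {0..pi / 2} h"
        unfolding h by (intro continuous_intros)
    qed simp
    then obtain \<theta> where \<theta>: "h \<theta> = c" by blast
    define f where "f = (\<lambda>z. of_real (cos \<theta>) * e i z + of_real (sin \<theta>) * e j z)"
    define g where "g = (\<lambda>z. of_real (- sin \<theta>) * e i z + of_real (cos \<theta>) * e j z)"
    define e' where "e' = e(i := f, j := g)"
    have f: "form.qf f = c" using \<theta> by (simp add: h_def f_def)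
    have "form.qf g = (sin \<theta>)\<^sup>2 * form.qf (e i) - 2 * (cos \<theta> * sin \<theta> * Re (a (e i) (e j)))
        + (cos \<theta>)\<^sup>2 * form.qf (e j)"
      unfolding g_def by (subst form.qf_comb[OF mem]) (simp add: algebra_simps)
    moreover have "form.qf f = (cos \<theta>)\<^sup>2 * form.qf (e i) + 2 * (cos \<theta> * sin \<theta> * Re (a (e i) (e j)))
        + (sin \<theta>)\<^sup>2 * form.qf (e j)"
      using h[of \<theta>] by (simp only: h_def f_def)
    \<comment> \<open>The cross terms cancel: a rotation preserves the trace of the two by two
      block.\<close>
    ultimately have "form.qf f + form.qf g = ((sin \<theta>)\<^sup>2 + (cos \<theta>)\<^sup>2) * (form.qf (e i) + form.qf (e j))"
      by algebra
    then have fg: "form.qf f + form.qf g = form.qf (e i) + form.qf (e j)" by simp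
    have e': "orthonormal_family N e'"
      unfolding e'_def f_def g_def
      by (rule orthonormal_family_unitary)
        (use e i j ij in \<open>auto simp: complex_eq_iff power2_eq_square[symmetric] mult.commute\<close>)
    have split: "(\<Sum>k<N. q k) = q i + q j + (\<Sum>k\<in>{..<N} - {i, j}. q k)" for q :: "nat \<Rightarrow> real"
    proof -
      have "(\<Sum>k<N. q k) = (\<Sum>k\<in>insert i (insert j ({..<N} - {i, j})). q k)"
        using i j by (intro sum.cong) auto
      then show ?thesis using ij by simp
    qed
    have "(\<Sum>k<N. form.qf (e' k)) = (\<Sum>k<N. form.qf (e k))"
      unfolding split using fg ij by (simp add: e'_def)
    then have 1: "real N * c \<le> (\<Sum>i<N. form.qf (e' i))" using less.prems(2) by simp
    have "{k. k < N \<and> form.qf (e' k) \<noteq> c} \<subset> {k. k < N \<and> form.qf (e k) \<noteq> c}"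
    proof
      show "{k. k < N \<and> form.qf (e' k) \<noteq> c} \<subseteq> {k. k < N \<and> form.qf (e k) \<noteq> c}"
        using i j f by (auto simp: e'_def split: if_splits)
      show "{k. k < N \<and> form.qf (e' k) \<noteq> c} \<noteq> {k. k < N \<and> form.qf (e k) \<noteq> c}"
      proof -
        have "i \<notin> {k. k < N \<and> form.qf (e' k) \<noteq> c}" using f ij by (simp add: e'_def)
        moreover have "i \<in> {k. k < N \<and> form.qf (e k) \<noteq> c}" using i by simp
        ultimately show ?thesis by metis
      qed
    qed
    then have "card {k. k < N \<and> form.qf (e' k) \<noteq> c} < card {k. k < N \<and> form.qf (e k) \<noteq> c}"
      by (intro psubset_card_mono) auto
    from less.hyps[OF this e' 1] show ?thesis .
  qed
qed

text \<open>An orthonormal family that almost maximizes the trace of the form nearly spans an invariant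
  subspace, and on the complement the form is almost bounded by the mean of its diagonal. This
  replaces the spectral theorem for the localization operator.\<close>

context
  fixes N :: nat and e and \<kappa> :: real
  assumes e: "orthonormal_family N e" and \<kappa>: "0 < \<kappa>" "\<kappa> \<le> 1"
    and near: "\<And>f. orthonormal_family N f \<Longrightarrow> (\<Sum>i<N. form.qf (f i)) \<le> (\<Sum>i<N. form.qf (e i)) + \<kappa>"
begin

lemma e_mem: "i < N \<Longrightarrow> e i \<in> X"
  using e by (simp add: orthonormal_family_def)

lemma e_qf: "i < N \<Longrightarrow> qf (e i) = 1"
  using e by (simp add: orthonormal_family_def)

text \<open>Putting u in the place of \<open>e j\<close> changes the trace by the difference of one
  diagonal entry, and near-maximality limits the gain to \<kappa>.\<close>

lemma near_replace:
  assumes u: "u \<in> X" "qf u = 1" and j: "j < N" and ue: "\<And>i. i < N \<Longrightarrow> i \<noteq> j \<Longrightarrow> ip u (e i) = 0"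
  shows "form.qf u \<le> form.qf (e j) + \<kappa>"
proof -
  have "ip u u = of_real (qf u)" by (rule ip_self[OF u(1)])
  then have uu: "ip u u = 1" by (simp only: u(2) of_real_1)
  have "orthonormal_family N (e(j := u))"
    by (rule orthonormal_family_update[OF e u(1) uu ue])
  from near[OF this] have le: "(\<Sum>i<N. form.qf ((e(j := u)) i)) \<le> (\<Sum>i<N. form.qf (e i)) + \<kappa>" .
  have split: "(\<Sum>i<N. q i) = q j + (\<Sum>i\<in>{..<N} - {j}. q i)" for q :: "nat \<Rightarrow> real"
    by (rule sum.remove) (use j in auto)
  have "(\<Sum>i\<in>{..<N} - {j}. form.qf ((e(j := u)) i)) = (\<Sum>i\<in>{..<N} - {j}. form.qf (e i))"
    by (rule sum.cong) auto
  then show ?thesis using le unfolding split by (simp only: fun_upd_same)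
qed

text \<open>After normalization v may take the place of each \<open>e j\<close> in turn; summing the
  N inequalities compares it with the mean of the diagonal.\<close>

lemma near_complement:
  assumes v: "v \<in> X" and ve: "\<And>i. i < N \<Longrightarrow> ip v (e i) = 0"
  shows "real N * form.qf v \<le> ((\<Sum>i<N. form.qf (e i)) + real N * \<kappa>) * qf v"
proof (cases "qf v = 0")
  case True
  then show ?thesis using form_le[OF v] by (simp add: mult_nonneg_nonpos)
next
  case False
  then have pos: "0 < qf v" using ip_nonneg[OF v] by simp
  define u where "u = (\<lambda>z. of_real (1 / sqrt (qf v)) * v z)"
  have u: "u \<in> X" unfolding u_def by (intro scale_mem v)
  have qu: "qf u = 1" unfolding u_def qf_scale[OF v] norm_of_real using pos by (simp add: power_divide)
  have au: "form.qf u = form.qf v / qf v"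
    unfolding u_def form.qf_scale[OF v] norm_of_real using pos by (simp add: power_divide)
  have "form.qf u \<le> form.qf (e j) + \<kappa>" if "j < N" for j
    by (rule near_replace[OF u qu that]) (simp add: u_def ip_scale[OF v e_mem] ve del: of_real_divide)
  then have "(\<Sum>j<N. form.qf u) \<le> (\<Sum>j<N. form.qf (e j) + \<kappa>)"
    by (intro sum_mono) auto
  then show ?thesis unfolding au using pos by (simp add: sum.distrib field_simps)
qed

text \<open>First-order optimality. For a unit vector v, tilting \<open>e j\<close> towards v by s
  changes the trace by about 2 s times the off-diagonal entry, up to terms of order s^2. The gain is
  at most \<kappa>, so s = sqrt \<kappa> balances the errors and leaves an entry of order sqrt
  \<kappa>.\<close>

lemma near_invariant:
  assumes v: "v \<in> X" and ve: "\<And>i. i < N \<Longrightarrow> ip v (e i) = 0" and j: "j < N"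
  shows "cmod (a (e j) v) \<le> 2 * sqrt \<kappa> * sqrt (qf v)"
proof (cases "qf v = 0")
  case True
  have "(cmod (a (e j) v))\<^sup>2 \<le> form.qf (e j) * form.qf v"
    by (rule form.Cauchy_Schwarz[OF e_mem[OF j] v])
  moreover have "form.qf v = 0"
    using form_le[OF v] form.ip_nonneg[OF v] True by simp
  ultimately show ?thesis by (simp add: True)
next
  case False
  then have pos: "0 < qf v" using ip_nonneg[OF v] by simp
  define w where "w = a (e j) v"
  \<comment> \<open>The phase of w is moved into u, which makes \<open>a (e j) u\<close> real and
    nonnegative.\<close>
  define ph where "ph = (if w = 0 then 1 else w / of_real (cmod w))"
  have ph: "cmod ph = 1" "cnj ph * w = of_real (cmod w)"
    using complex_norm_square[of w]
    by (auto simp: ph_def norm_divide divide_simps power2_eq_square mult.commute)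
  define u where "u = (\<lambda>z. (ph / of_real (sqrt (qf v))) * v z)"
  have u: "u \<in> X" unfolding u_def by (intro scale_mem v)
  have qu: "qf u = 1" unfolding u_def qf_scale[OF v] using pos ph by (simp add: norm_divide power_divide)
  define b where "b = cmod w / sqrt (qf v)"
  have au: "a (e j) u = of_real b"
  proof -
    have "a (e j) u = cnj (ph / of_real (sqrt (qf v))) * w"
      unfolding u_def w_def by (rule form.ip_scale_right[OF v e_mem[OF j]])
    also have "\<dots> = (cnj ph * w) / of_real (sqrt (qf v))" by simp
    finally show ?thesis by (simp only: ph(2) b_def of_real_divide)
  qed
  have ue: "ip u (e i) = 0" if "i < N" for i
    unfolding u_def using that by (simp only: ip_scale v e_mem ve mult_zero_right)
  define s where "s = sqrt \<kappa>"
  have s: "0 < s" "s\<^sup>2 = \<kappa>" using \<kappa> by (auto simp: s_def)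
  \<comment> \<open>Normalizes \<open>e j\<close> + s u, since s^2 = \<kappa>.\<close>
  define c where "c = 1 / sqrt (1 + \<kappa>)"
  have c2: "c\<^sup>2 = 1 / (1 + \<kappa>)" using \<kappa> by (simp add: c_def power_divide)
  define f where "f = (\<lambda>z. of_real c * e j z + of_real (c * s) * u z)"
  have f: "f \<in> X" unfolding f_def by (intro comb_mem e_mem j u)
  have eu: "ip (e j) u = 0" using ip_cnj[OF u e_mem[OF j]] ue[OF j] by simp
  have "qf f = c\<^sup>2 + c\<^sup>2 * s\<^sup>2"
    unfolding f_def qf_comb[OF e_mem[OF j] u] by (simp add: eu e_qf[OF j] qu power_mult_distrib norm_mult)
  also have "\<dots> = 1" using \<kappa> unfolding c2 s by (simp add: field_simps)
  finally have qf1: "qf f = 1" .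
  have fe: "ip f (e i) = 0" if "i < N" "i \<noteq> j" for i
    unfolding f_def using that j e by (simp add: ip_comb e_mem u ue orthonormal_family_def)
  have le: "form.qf f \<le> form.qf (e j) + \<kappa>"
    by (rule near_replace[OF f qf1 j fe])
  have "form.qf f = c\<^sup>2 * (form.qf (e j) + 2 * s * b + \<kappa> * form.qf u)"
    unfolding f_def form.qf_comb[OF e_mem[OF j] u]
    by (simp add: au norm_mult power_mult_distrib s algebra_simps) (simp add: power2_eq_square)
  with le have "form.qf (e j) + 2 * s * b + \<kappa> * form.qf u \<le> (1 + \<kappa>) * (form.qf (e j) + \<kappa>)"
    using \<kappa> by (simp add: c2 field_simps)
  then have "2 * s * b \<le> \<kappa> * form.qf (e j) + (1 + \<kappa>) * \<kappa> - \<kappa> * form.qf u"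
    by (simp add: algebra_simps)
  \<comment> \<open>Diagonal values are at most 1, and \<kappa> \<le> 1 turns (1 + \<kappa>)
    \<kappa> into at most 2 \<kappa>.\<close>
  also have "\<dots> \<le> \<kappa> * 1 + 2 * \<kappa> - 0"
    using form_le[OF e_mem[OF j]] e_qf[OF j] \<kappa> form.ip_nonneg[OF u]
    by (intro add_mono diff_mono mult_left_mono mult_right_mono mult_nonneg_nonneg) auto
  also have "\<dots> = 3 * s * s" using s by (simp add: power2_eq_square)
  finally have "2 * b \<le> 3 * s" using s(1) by (simp add: mult.commute mult.left_commute)
  then have "b \<le> 2 * s" using s by simp
  then show ?thesis using pos by (simp add: b_def w_def s_def field_simps)
qed

text \<open>Splits x into its projection u on the span of the family and the rest v. The form is at
  most \<open>qf u\<close> on u and at most \<theta> \<open>qf v\<close> on v, and the cross term is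
  small. So if the form almost exhausts \<open>qf x\<close>, little of x lies outside the
  span.\<close>

lemma near_eigenspace:
  assumes x: "x \<in> X" "qf x \<le> 1" and \<theta>: "(\<Sum>i<N. form.qf (e i)) + real N * \<kappa> \<le> real N * \<theta>" and N: "0 < N"
  shows "(1 - \<theta>) * (qf x - (\<Sum>i<N. (cmod (ip x (e i)))\<^sup>2)) \<le> qf x - form.qf x + 4 * real N * sqrt \<kappa>"
proof -
  have on: "ip (e i) (e j) = (if i = j then 1 else 0)" if "i \<in> {..<N}" "j \<in> {..<N}" for i j
    using that e by (simp add: orthonormal_family_def)
  have em: "e i \<in> X" if "i \<in> {..<N}" for i using that e_mem by simp
  define u where "u = (\<lambda>z. \<Sum>i<N. ip x (e i) * e i z)"
  define v where "v = (\<lambda>z. x z - (\<Sum>i<N. ip x (e i) * e i z))"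
  have v: "v \<in> X" unfolding v_def by (rule Bessel_decomposition(1)) (use em on x in auto)
  have ve: "ip v (e i) = 0" if "i < N" for i unfolding v_def by (rule Bessel_decomposition(2)[of "{..<N}"]) (use em on x that in auto)
  have qv: "qf v = qf x - (\<Sum>i<N. (cmod (ip x (e i)))\<^sup>2)" unfolding v_def by (rule Bessel_decomposition(3)) (use em on x in auto)
  have qv1: "qf v \<le> 1" using qv x(2) sum_nonneg[of "{..<N}" "\<lambda>i. (cmod (ip x (e i)))\<^sup>2"] by auto
  have qv0: "0 \<le> qf v" by (rule ip_nonneg[OF v])
  have u: "u \<in> X" unfolding u_def by (intro sum_mem em finite_lessThan)
  have xuv: "x = (\<lambda>z. u z + v z)" by (simp add: u_def v_def)
  have uv: "ip u v = 0"
  proof -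
    have "ip u v = (\<Sum>i<N. ip x (e i) * ip (e i) v)"
      unfolding u_def by (intro ip_sum em v finite_lessThan)
    also have "\<dots> = 0" using ip_cnj[OF v e_mem] ve by simp
    finally show ?thesis .
  qed
  have q: "qf x = qf u + qf v" using qf_add[OF u v] unfolding xuv[symmetric] by (simp add: uv)
  have ax: "form.qf x = form.qf u + 2 * Re (a u v) + form.qf v" 
    using form.qf_add[OF u v] unfolding xuv[symmetric] .
  \<comment> \<open>N coefficients of modulus at most 1, each against an entry of modulus at most 2
    sqrt \<kappa>.\<close>
  have "cmod (a u v) \<le> 2 * real N * sqrt \<kappa>"
  proof -
    have "a u v = (\<Sum>i<N. ip x (e i) * a (e i) v)"
      unfolding u_def by (intro form.ip_sum em v finite_lessThan)
    then have "cmod (a u v) \<le> (\<Sum>i<N. cmod (ip x (e i)) * cmod (a (e i) v))"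
      by (simp add: sum_norm_le norm_mult)
    also have "\<dots> \<le> (\<Sum>i<N. 1 * (2 * sqrt \<kappa> * sqrt 1))"
    proof (intro sum_mono mult_mono)
      fix i assume i: "i \<in> {..<N}"
      have "(cmod (ip x (e i)))\<^sup>2 \<le> qf x * qf (e i)"
        by (intro Cauchy_Schwarz x em i)
      also have "\<dots> \<le> 1" using x(2) i e_qf by simp
      finally show "cmod (ip x (e i)) \<le> 1" by (simp add: power_le_one_iff abs_square_le_1)
      have "cmod (a (e i) v) \<le> 2 * sqrt \<kappa> * sqrt (qf v)"
        using i by (intro near_invariant v ve) auto
      also have "\<dots> \<le> 2 * sqrt \<kappa> * sqrt 1"
        using qv1 \<kappa> by (intro mult_left_mono) auto
      finally show "cmod (a (e i) v) \<le> 2 * sqrt \<kappa> * sqrt 1" .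
    qed (use \<kappa> in auto)
    finally show ?thesis by (simp add: mult_ac)
  qed
  then have 1: "2 * Re (a u v) \<le> 4 * real N * sqrt \<kappa>"
    using complex_Re_le_cmod[of "a u v"] by simp
  have "real N * form.qf v \<le> ((\<Sum>i<N. form.qf (e i)) + real N * \<kappa>) * qf v"
    by (rule near_complement[OF v ve])
  also have "\<dots> \<le> (real N * \<theta>) * qf v" using \<theta> qv0 by (rule mult_right_mono)
  finally have "form.qf v \<le> \<theta> * qf v" using N by simp
  then have "(1 - \<theta>) * qf v \<le> qf v - form.qf v" by (simp add: algebra_simps)
  also have "\<dots> = qf x - form.qf x - (qf u - form.qf u) + 2 * Re (a u v)"
    unfolding ax using q by simp
  also have "\<dots> \<le> qf x - form.qf x + 4 * real N * sqrt \<kappa>"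
    using form_le[OF u] 1 by simp
  finally show ?thesis by (simp only: qv)
qed

end
end

section \<open>Translation continuity\<close>

lemma lborel_integral_affine:
  fixes f :: "'a::euclidean_space \<Rightarrow> 'b::{banach, second_countable_topology}"
  assumes f[measurable]: "f \<in> borel_measurable borel" and c: "c \<noteq> 0"
  shows "(\<integral>x. f x \<partial>lborel) = (\<bar>c\<bar> ^ DIM('a)) *\<^sub>R (\<integral>x. f (t + c *\<^sub>R x) \<partial>lborel)"
  by (subst lborel_affine[OF c, of t]) (simp add: integral_density integral_distr)

lemma lborel_nn_integral_affine:
  fixes f :: "'a::euclidean_space \<Rightarrow> ennreal"
  assumes f[measurable]: "f \<in> borel_measurable borel" and c: "c \<noteq> 0"
  shows "(\<integral>\<^sup>+x. f x \<partial>lborel) = ennreal (\<bar>c\<bar> ^ DIM('a)) * (\<integral>\<^sup>+x. f (t + c *\<^sub>R x) \<partial>lborel)"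
  by (subst lborel_affine[OF c, of t]) (simp add: nn_integral_density nn_integral_distr nn_integral_cmult)

lemma lborel_nn_integral_translate:
  fixes f :: "'a::euclidean_space \<Rightarrow> ennreal"
  assumes f[measurable]: "f \<in> borel_measurable borel"
  shows "(\<integral>\<^sup>+x. f (x + t) \<partial>lborel) = (\<integral>\<^sup>+x. f x \<partial>lborel)"
  using lborel_nn_integral_affine[OF f, of 1 t] by (simp add: add.commute)

lemma lborel_integral_translate:
  fixes f :: "'a::euclidean_space \<Rightarrow> 'b::{banach, second_countable_topology}"
  assumes f[measurable]: "f \<in> borel_measurable borel"
  shows "(\<integral>x. f (x + t) \<partial>lborel) = (\<integral>x. f x \<partial>lborel)"
  using lborel_integral_affine[OF f, of 1 t] by (simp add: add.commute)

lemma lborel_integrable_affine: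
  fixes f :: "'a::euclidean_space \<Rightarrow> 'b::{banach, second_countable_topology}"
  assumes f: "integrable lborel f" and c: "c \<noteq> 0"
  shows "integrable lborel (\<lambda>x. f (t + c *\<^sub>R x))"
proof (rule integrableI_bounded)
  have [measurable]: "f \<in> borel_measurable borel" using f by (auto dest: borel_measurable_integrable)
  show "(\<lambda>x. f (t + c *\<^sub>R x)) \<in> borel_measurable lborel" by measurable
  have "ennreal (\<bar>c\<bar> ^ DIM('a)) * (\<integral>\<^sup>+x. norm (f (t + c *\<^sub>R x)) \<partial>lborel) < \<infinity>"
    using f c lborel_nn_integral_affine[of "\<lambda>x. ennreal (norm (f x))" c t]
    by (simp add: integrable_iff_bounded)
  then show "(\<integral>\<^sup>+x. norm (f (t + c *\<^sub>R x)) \<partial>lborel) < \<infinity>"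
    using c by (auto simp: ennreal_mult_less_top)
qed

lemma lborel_integrable_translate:
  fixes f :: "'a::euclidean_space \<Rightarrow> 'b::{banach, second_countable_topology}"
  assumes f: "integrable lborel f"
  shows "integrable lborel (\<lambda>x. f (x + t))"
  using lborel_integrable_affine[OF f, of 1 t] by (simp add: add.commute)

text \<open>Integrability on the product is phrased as finiteness of an iterated integral of the
  norm, the form in which the estimates below deliver it.\<close>

lemma lborel_Fubini:
  fixes f :: "'a::euclidean_space \<Rightarrow> 'b::euclidean_space \<Rightarrow> 'c::{banach, second_countable_topology}"
  assumes f[measurable]: "(\<lambda>(x, y). f x y) \<in> borel_measurable (borel \<Otimes>\<^sub>M borel)"
    and fin: "(\<integral>\<^sup>+x. \<integral>\<^sup>+y. norm (f x y) \<partial>lborel \<partial>lborel) < \<infinity>"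
  shows "integrable lborel (\<lambda>p. f (fst p) (snd p))"
    and "(\<integral>x. \<integral>y. f x y \<partial>lborel \<partial>lborel) = (\<integral>y. \<integral>x. f x y \<partial>lborel \<partial>lborel)"
    and "(\<integral>p. f (fst p) (snd p) \<partial>lborel) = (\<integral>x. \<integral>y. f x y \<partial>lborel \<partial>lborel)"
proof -
  have int: "integrable (lborel \<Otimes>\<^sub>M lborel) (\<lambda>(x, y). f x y)"
  proof (rule integrableI_bounded)
    have "(\<integral>\<^sup>+p. norm (case p of (x, y) \<Rightarrow> f x y) \<partial>(lborel \<Otimes>\<^sub>M lborel)) = (\<integral>\<^sup>+x. \<integral>\<^sup>+y. norm (f x y) \<partial>lborel \<partial>lborel)"
      by (subst lborel.nn_integral_fst[symmetric]) auto
    then show "(\<integral>\<^sup>+p. norm (case p of (x, y) \<Rightarrow> f x y) \<partial>(lborel \<Otimes>\<^sub>M lborel)) < \<infinity>" using fin by simp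
  qed simp
  then show "integrable lborel (\<lambda>p. f (fst p) (snd p))"
    unfolding lborel_prod by (simp add: case_prod_unfold)
  show "(\<integral>x. \<integral>y. f x y \<partial>lborel \<partial>lborel) = (\<integral>y. \<integral>x. f x y \<partial>lborel \<partial>lborel)"
    using lborel_pair.Fubini_integral[OF int] by simp
  show "(\<integral>p. f (fst p) (snd p) \<partial>lborel) = (\<integral>x. \<integral>y. f x y \<partial>lborel \<partial>lborel)"
    using lborel_pair.integral_fst'[OF int] unfolding lborel_prod by (simp add: case_prod_unfold)
qed

text \<open>Regularity gives a compact K and an open U with K \<subseteq> E \<subseteq> U and U - K
  small. For shifts shorter than the distance from K to the complement of U, a point at which the
  two indicators differ lies in U - K, itself or after the shift.\<close>

lemma tendsto_L1_translation_set:
  fixes E :: "'a::euclidean_space set"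
  assumes E[measurable]: "E \<in> sets borel" and fin: "emeasure lborel E < \<infinity>" and \<eta>: "0 < \<eta>"
  shows "\<forall>\<^sub>F u in nhds 0. (\<integral>\<^sup>+x. ennreal \<bar>indicator E (x + u) - indicator E x\<bar> \<partial>lborel) \<le> ennreal \<eta>"
proof -
  obtain U where U: "open U" "E \<subseteq> U" and U2: "emeasure lborel (U - E) < ennreal (\<eta> / 4)"
  proof -
    have "E \<in> sets lebesgue" using E by simp
    from sets_lebesgue_outer_open[OF this, of "\<eta> / 4"] \<eta> obtain T where T: "open T" "E \<subseteq> T" "emeasure lebesgue (T - E) < ennreal (\<eta> / 4)"
      by (metis divide_pos_pos zero_less_numeral)
    moreover have "emeasure lebesgue (T - E) = emeasure lborel (T - E)"
      using T(1) E by simp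
    ultimately show ?thesis using that by simp
  qed
  obtain K where K: "compact K" "K \<subseteq> E" and K2: "emeasure lborel (E - K) < ennreal (\<eta> / 4)"
  proof -
    \<comment> \<open>Lebesgue measure restricted to E is finite, as inner regularity
      requires.\<close>
    define M where "M = density lborel (indicator E)"
    have M: "emeasure M A = emeasure lborel (E \<inter> A)" if "A \<in> sets borel" for A
      unfolding M_def using that by (subst emeasure_density) (auto simp: indicator_inter_arith[symmetric])
    have "emeasure M E = (SUP K \<in> {K. K \<subseteq> E \<and> compact K}. emeasure M K)"
      by (rule inner_regular) (use fin M[of UNIV] in \<open>auto simp: M_def\<close>)
    then have sup: "emeasure lborel E = (SUP K \<in> {K. K \<subseteq> E \<and> compact K}. emeasure M K)"
      by (simp add: M)
    show ?thesis
    proof (cases "emeasure lborel E = 0")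
      case True
      then show ?thesis using that[of "{}"] \<eta> by simp
    next
      case False
      then have "emeasure lborel E - ennreal (\<eta> / 4) < emeasure lborel E"
        using fin \<eta> by (intro ennreal_between) (auto simp: zero_less_iff_neq_zero)
      then obtain K where K: "K \<subseteq> E" "compact K" "emeasure lborel E - ennreal (\<eta> / 4) < emeasure M K"
        using sup by (auto simp: less_SUP_iff)
      have [measurable]: "K \<in> sets borel" using K(2) by (simp add: borel_compact)
      have "emeasure M K = emeasure lborel K" using K(1) by (simp add: M Int_absorb1)
      then have 1: "emeasure lborel E - ennreal (\<eta> / 4) < emeasure lborel K" using K by simp
      have Kfin: "emeasure lborel K < \<infinity>" using fin K(1) E
        by (metis emeasure_mono infinity_ennreal_def order_le_less_trans sets_lborel)
      have "emeasure lborel (E - K) = emeasure lborel E - emeasure lborel K"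
        using K Kfin by (intro emeasure_Diff) auto
      also have "\<dots> < ennreal (\<eta> / 4)"
      proof -
        have "r - s < t" if "ennreal (r - t) < ennreal s" for r s t :: real
          using that ennreal_leI[of s "r - t"] by (fastforce simp: not_le[symmetric])
        then show ?thesis
          using 1 fin Kfin \<eta>
          by (cases "emeasure lborel E"; cases "emeasure lborel K")
            (auto simp: ennreal_minus intro!: ennreal_lessI)
      qed
      finally show ?thesis using that K by blast
    qed
  qed
  have Kb[measurable]: "K \<in> sets borel" "U \<in> sets borel" using K(1) U(1) by (simp_all add: borel_compact)
  have UK: "emeasure lborel (U - K) \<le> ennreal (\<eta> / 2)"
  proof -
    have "emeasure lborel (U - K) \<le> emeasure lborel (U - E) + emeasure lborel (E - K)"
      using K U by (intro order_trans[OF _ emeasure_subadditive] emeasure_mono) auto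
    also have "\<dots> \<le> ennreal (\<eta> / 4) + ennreal (\<eta> / 4)"
      using U2 K2 by (intro add_mono) auto
    finally show ?thesis using \<eta> by (simp flip: ennreal_plus)
  qed
  obtain d where d: "0 < d" "(\<Union>x\<in>K. ball x d) \<subseteq> U"
    using compact_subset_open_imp_ball_epsilon_subset[OF K(1) U(1)] K(2) U(2) by blast
  have "\<forall>\<^sub>F u in nhds 0. u \<in> ball (0::'a) d"
    using d by (intro eventually_nhds_in_open) auto
  then show ?thesis
  proof eventually_elim
    case (elim u)
    have near: "y \<in> U" if "x \<in> K" "dist x y < d" for x y
      using d(2) that by (force simp: mem_ball)
    have "\<bar>indicator E (x + u) - indicator E x\<bar> \<le> (indicator (U - K) (x + u) + indicator (U - K) x :: real)" for x
      using near[of "x + u" x] near[of x "x + u"] elim K U by (auto simp: indicator_def dist_norm)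
    then have "(\<integral>\<^sup>+x. ennreal \<bar>indicator E (x + u) - indicator E x\<bar> \<partial>lborel)
        \<le> (\<integral>\<^sup>+x. (indicator (U - K) (x + u) + indicator (U - K) x) \<partial>lborel)"
      by (intro nn_integral_mono) (metis ennreal_indicator ennreal_leI ennreal_plus indicator_pos_le)
    also have "\<dots> = emeasure lborel (U - K) + emeasure lborel (U - K)"
      by (subst nn_integral_add) (simp_all add: lborel_nn_integral_translate[of "indicator (U - K)"])
    also have "\<dots> \<le> ennreal (\<eta> / 2) + ennreal (\<eta> / 2)"
      using UK by (intro add_mono) auto
    finally show ?case using \<eta> by (simp flip: ennreal_plus)
  qed
qed

text \<open>In the limit step f is compared with \<open>s i\<close> before and after the shift; both
  errors have the same integral by translation invariance.\<close>

lemma tendsto_L1_translation: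
  fixes f :: "'a::euclidean_space \<Rightarrow> real"
  assumes "integrable lborel f"
  shows "((\<lambda>u. \<integral>x. \<bar>f (x + u) - f x\<bar> \<partial>lborel) \<longlongrightarrow> 0) (nhds 0)"
  using assms
proof (induction f rule: integrable_induct)
  case (base A c)
  have [measurable]: "A \<in> sets borel" using base by simp
  show ?case
  proof (rule tendstoI)
    fix \<eta> :: real assume \<eta>: "0 < \<eta>"
    \<comment> \<open>The factor absorbs the height c of the step function; adding 1 covers c =
      0.\<close>
    define \<eta>' where "\<eta>' = \<eta> / (2 * (\<bar>c\<bar> + 1))"
    have "\<bar>c\<bar> / (2 * (\<bar>c\<bar> + 1)) < 1" by (simp add: divide_less_eq)
    then have "\<eta> * (\<bar>c\<bar> / (2 * (\<bar>c\<bar> + 1))) < \<eta> * 1" using \<eta> by (rule mult_strict_left_mono)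
    then have \<eta>': "0 < \<eta>'" "\<eta>' * \<bar>c\<bar> < \<eta>" using \<eta> by (simp_all add: \<eta>'_def)
    have "\<forall>\<^sub>F u in nhds 0. (\<integral>\<^sup>+x. ennreal \<bar>indicator A (x + u) - indicator A x\<bar> \<partial>lborel) \<le> ennreal \<eta>'"
      using base \<eta>' by (intro tendsto_L1_translation_set) auto
    then show "\<forall>\<^sub>F u in nhds 0. dist (\<integral>x. \<bar>indicator A (x + u) *\<^sub>R c - indicator A x *\<^sub>R c\<bar> \<partial>lborel) 0 < \<eta>"
    proof eventually_elim
      case (elim u)
      have "(\<integral>x. \<bar>indicator A (x + u) - indicator A x\<bar> \<partial>lborel) \<le> (\<eta>' :: real)"
        using elim \<eta>' by (intro integral_real_bounded) auto
      then have "\<bar>c\<bar> * (\<integral>x. \<bar>indicator A (x + u) - indicator A x\<bar> \<partial>lborel) \<le> \<eta>' * \<bar>c\<bar>"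
        by (subst mult.commute) (rule mult_right_mono, auto)
      also have "\<bar>c\<bar> * (\<integral>x. \<bar>indicator A (x + u) - indicator A x :: real\<bar> \<partial>lborel) =
          (\<integral>x. \<bar>indicator A (x + u) *\<^sub>R c - indicator A x *\<^sub>R c\<bar> \<partial>lborel)"
        by (subst integral_mult_right_zero[symmetric]) (simp add: abs_mult[symmetric] algebra_simps)
      finally show ?case using \<eta>' by (simp add: dist_real_def)
    qed
  qed
next
  case (add f g)
  have m[measurable]: "f \<in> borel_measurable borel" "g \<in> borel_measurable borel"
    using add by (auto dest: borel_measurable_integrable)
  have "((\<lambda>u. (\<integral>x. \<bar>f (x + u) - f x\<bar> \<partial>lborel) + (\<integral>x. \<bar>g (x + u) - g x\<bar> \<partial>lborel)) \<longlongrightarrow> 0) (nhds 0)"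
    using tendsto_add[OF add(3,4)] by simp
  moreover have "(\<integral>x. \<bar>f (x + u) + g (x + u) - (f x + g x)\<bar> \<partial>lborel) \<le>
      (\<integral>x. \<bar>f (x + u) - f x\<bar> \<partial>lborel) + (\<integral>x. \<bar>g (x + u) - g x\<bar> \<partial>lborel)" for u
    using add(1,2) by (subst Bochner_Integration.integral_add[symmetric])
      (auto intro!: integral_mono lborel_integrable_translate integrable_abs Bochner_Integration.integrable_diff)
  ultimately show ?case
    by (rule_tac tendsto_sandwich[of "\<lambda>_. 0"]) (auto intro!: always_eventually)
next
  case (lim f s)
  have m[measurable]: "f \<in> borel_measurable borel" "\<And>i. s i \<in> borel_measurable borel"
    using lim by (auto dest: borel_measurable_integrable)
  have conv: "(\<lambda>i. \<integral>x. \<bar>s i x - f x\<bar> \<partial>lborel) \<longlonglongrightarrow> (\<integral>x. 0 \<partial>(lborel :: 'a measure))"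
  \<comment> \<open>The approximants satisfy |s i| \<le> 2 |f|, whence the majorant 3 |f|.\<close>
  proof (rule integral_dominated_convergence[where w="\<lambda>x. 3 * \<bar>f x\<bar>"])
    show "AE x in lborel. (\<lambda>i. \<bar>s i x - f x\<bar>) \<longlonglongrightarrow> 0"
    proof (rule AE_I2)
      fix x :: 'a
      have "(\<lambda>i. s i x) \<longlonglongrightarrow> f x" using lim(2) by simp
      then show "(\<lambda>i. \<bar>s i x - f x\<bar>) \<longlonglongrightarrow> 0" by (simp add: LIM_zero tendsto_rabs_zero)
    qed
    show "AE x in lborel. norm \<bar>s i x - f x\<bar> \<le> 3 * \<bar>f x\<bar>" for i
    proof (rule AE_I2)
      fix x :: 'a
      have "\<bar>s i x\<bar> \<le> 2 * \<bar>f x\<bar>" using lim(3)[of x i] by simp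
      then show "norm \<bar>s i x - f x\<bar> \<le> 3 * \<bar>f x\<bar>" by simp
    qed
  qed (use lim in auto)
  show ?case
  proof (rule tendstoI)
    fix \<eta> :: real assume \<eta>: "0 < \<eta>"
    have "\<forall>\<^sub>F i in sequentially. (\<integral>x. \<bar>s i x - f x\<bar> \<partial>lborel) < \<eta> / 3"
      using order_tendstoD(2)[OF conv, of "\<eta> / 3"] \<eta> by simp
    then obtain i where i: "(\<integral>x. \<bar>s i x - f x\<bar> \<partial>lborel) < \<eta> / 3"
      by (meson eventually_happens trivial_limit_sequentially)
    have "\<forall>\<^sub>F u in nhds 0. (\<integral>x. \<bar>s i (x + u) - s i x\<bar> \<partial>lborel) < \<eta> / 3"
      using order_tendstoD(2)[OF lim(5)[of i], of "\<eta> / 3"] \<eta> by simp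
    then show "\<forall>\<^sub>F u in nhds 0. dist (\<integral>x. \<bar>f (x + u) - f x\<bar> \<partial>lborel) 0 < \<eta>"
    proof eventually_elim
      case (elim u)
      have int: "integrable lborel (\<lambda>x. \<bar>s i x - f x\<bar>)" "integrable lborel (\<lambda>x. \<bar>f (x + u) - f x\<bar>)"
        "integrable lborel (\<lambda>x. \<bar>s i (x + u) - s i x\<bar>)"
        using lim(1,4) by (auto intro!: lborel_integrable_translate integrable_abs Bochner_Integration.integrable_diff)
      have int2: "integrable lborel (\<lambda>x. \<bar>s i (x + u) - f (x + u)\<bar>)"
        using lborel_integrable_translate[OF int(1)] .
      have "(\<integral>x. \<bar>f (x + u) - f x\<bar> \<partial>lborel) \<le>
          (\<integral>x. \<bar>s i (x + u) - f (x + u)\<bar> + (\<bar>s i (x + u) - s i x\<bar> + \<bar>s i x - f x\<bar>) \<partial>lborel)"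
        by (intro integral_mono Bochner_Integration.integrable_add int int2) auto
      also have "\<dots> = (\<integral>x. \<bar>s i (x + u) - f (x + u)\<bar> \<partial>lborel) + ((\<integral>x. \<bar>s i (x + u) - s i x\<bar> \<partial>lborel)
          + (\<integral>x. \<bar>s i x - f x\<bar> \<partial>lborel))"
        by (simp add: int int2)
      also have "(\<integral>x. \<bar>s i (x + u) - f (x + u)\<bar> \<partial>lborel) = (\<integral>x. \<bar>s i x - f x\<bar> \<partial>lborel)"
        by (rule lborel_integral_translate[of "\<lambda>x. \<bar>s i x - f x\<bar>"]) measurable
      finally show ?case using i elim by (simp add: dist_real_def)
    qed
  qed
qed

section \<open>Square integrable Borel functions\<close>

text \<open>Borel representatives are stable under shifts and give jointly measurable functions on
  products, which the Fubini arguments ask for. Lebesgue measurable elements are reduced to them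
  later.\<close>

definition borel_L2 :: "('a::euclidean_space \<Rightarrow> complex) set" where
  "borel_L2 = {F \<in> borel_measurable borel. integrable lborel (\<lambda>z. (cmod (F z))\<^sup>2)}"

definition bip :: "('a::euclidean_space \<Rightarrow> complex) \<Rightarrow> ('a \<Rightarrow> complex) \<Rightarrow> complex" where
  "bip F G = (\<integral>z. F z * cnj (G z) \<partial>lborel)"

lemma borel_L2_measurable [measurable_dest]: "F \<in> borel_L2 \<Longrightarrow> F \<in> borel_measurable borel"
  by (simp add: borel_L2_def)

lemma borel_L2_integrable: "F \<in> borel_L2 \<Longrightarrow> integrable lborel (\<lambda>z. (cmod (F z))\<^sup>2)"
  by (simp add: borel_L2_def)

lemma borel_L2_I:
  assumes "F \<in> borel_measurable borel" "(\<integral>\<^sup>+z. ennreal ((cmod (F z))\<^sup>2) \<partial>lborel) < \<infinity>"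
  shows "F \<in> borel_L2"
  using assms by (auto simp: borel_L2_def integrable_iff_bounded)

lemma borel_measurable_cnj [measurable (raw)]:
  "f \<in> borel_measurable M \<Longrightarrow> (\<lambda>x. cnj (f x)) \<in> borel_measurable M"
  by (rule borel_measurable_continuous_on[of cnj]) (intro continuous_intros)

lemma mult_le_sum_power2:
  fixes x y :: real
  assumes "0 \<le> x" "0 \<le> y"
  shows "x * y \<le> x\<^sup>2 + y\<^sup>2"
  using sum_squares_bound[of x y] mult_nonneg_nonneg[OF assms] by linarith

lemma borel_L2_integrable_mult:
  assumes F: "F \<in> borel_L2" and G: "G \<in> borel_L2"
  shows "integrable lborel (\<lambda>z. F z * cnj (G z))"
proof (rule Bochner_Integration.integrable_bound)
  show "integrable lborel (\<lambda>z. (cmod (F z))\<^sup>2 + (cmod (G z))\<^sup>2)"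
    using F G by (intro Bochner_Integration.integrable_add borel_L2_integrable)
  show "(\<lambda>z. F z * cnj (G z)) \<in> borel_measurable lborel"
    using F G by measurable
  show "AE z in lborel. norm (F z * cnj (G z)) \<le> norm ((cmod (F z))\<^sup>2 + (cmod (G z))\<^sup>2)"
    by (intro AE_I2) (simp add: norm_mult mult_le_sum_power2)
qed

lemma bip_self: "bip F F = of_real (\<integral>z. (cmod (F z))\<^sup>2 \<partial>lborel)"
  unfolding bip_def by (simp add: complex_norm_square[symmetric] del: of_real_power)

interpretation L2: semi_inner "borel_L2 :: ('a::euclidean_space \<Rightarrow> complex) set" bip
proof
  show "(\<lambda>z. 0) \<in> borel_L2" by (simp add: borel_L2_def)
next
  fix F G :: "'a \<Rightarrow> complex" and c d :: complex
  assume F: "F \<in> borel_L2" and G: "G \<in> borel_L2"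
  have [measurable]: "F \<in> borel_measurable borel" "G \<in> borel_measurable borel" using F G by measurable
  show "(\<lambda>z. c * F z + d * G z) \<in> borel_L2"
    unfolding borel_L2_def
  proof safe
    show "(\<lambda>z. c * F z + d * G z) \<in> borel_measurable borel" by measurable
    show "integrable lborel (\<lambda>z. (cmod (c * F z + d * G z))\<^sup>2)"
    proof (rule Bochner_Integration.integrable_bound)
      show "integrable lborel (\<lambda>z. 2 * (cmod c)\<^sup>2 * (cmod (F z))\<^sup>2 + 2 * (cmod d)\<^sup>2 * (cmod (G z))\<^sup>2)"
        using F G by (intro Bochner_Integration.integrable_add integrable_mult_right borel_L2_integrable)
      have "(cmod (x + y))\<^sup>2 \<le> 2 * (cmod x)\<^sup>2 + 2 * (cmod y)\<^sup>2" for x y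
      proof -
        have "(cmod (x + y))\<^sup>2 \<le> (cmod x + cmod y)\<^sup>2"
          by (intro power_mono norm_triangle_ineq) auto
        also have "\<dots> \<le> 2 * (cmod x)\<^sup>2 + 2 * (cmod y)\<^sup>2"
          using sum_squares_bound[of "cmod x" "cmod y"] by (simp add: power2_sum)
        finally show ?thesis .
      qed
      from this[of "c * F z" "d * G z" for z]
      show "AE z in lborel. norm ((cmod (c * F z + d * G z))\<^sup>2)
          \<le> norm (2 * (cmod c)\<^sup>2 * (cmod (F z))\<^sup>2 + 2 * (cmod d)\<^sup>2 * (cmod (G z))\<^sup>2)"
        by (intro AE_I2) (simp add: norm_mult power_mult_distrib mult.assoc)
    qed measurable
  qed
  show "bip G F = cnj (bip F G)"
    unfolding bip_def by (simp add: mult.commute flip: Bochner_Integration.integral_cnj)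
  show "0 \<le> Re (bip F F)" unfolding bip_self by simp
next
  fix F G H :: "'a \<Rightarrow> complex" and c d :: complex
  assume H: "F \<in> borel_L2" "G \<in> borel_L2" "H \<in> borel_L2"
  show "bip (\<lambda>z. c * F z + d * G z) H = c * bip F H + d * bip G H"
    using borel_L2_integrable_mult[OF H(1,3)] borel_L2_integrable_mult[OF H(2,3)]
    unfolding bip_def by (simp add: algebra_simps)
qed

lemma qf_eq: "L2.qf F = (\<integral>z. (cmod (F z))\<^sup>2 \<partial>lborel)"
  by (simp add: bip_self)

lemma nn_integral_borel_L2:
  "F \<in> borel_L2 \<Longrightarrow> (\<integral>\<^sup>+z. ennreal ((cmod (F z))\<^sup>2) \<partial>lborel) = ennreal (L2.qf F)"
  unfolding qf_eq by (intro nn_integral_eq_integral borel_L2_integrable) auto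

lemma nn_integral_mult_borel_L2:
  assumes F: "F \<in> borel_L2" and G: "G \<in> borel_L2"
  shows "(\<integral>\<^sup>+z. ennreal (cmod (F z)) * ennreal (cmod (G z)) \<partial>lborel) \<le> ennreal (L2.qf F + L2.qf G)"
proof -
  have int: "integrable lborel (\<lambda>z. (cmod (F z))\<^sup>2 + (cmod (G z))\<^sup>2)"
    by (intro Bochner_Integration.integrable_add borel_L2_integrable F G)
  have "(\<integral>\<^sup>+z. ennreal (cmod (F z)) * ennreal (cmod (G z)) \<partial>lborel) \<le>
      (\<integral>\<^sup>+z. ennreal ((cmod (F z))\<^sup>2 + (cmod (G z))\<^sup>2) \<partial>lborel)"
    by (intro nn_integral_mono)
      (simp add: ennreal_mult[symmetric] ennreal_leI mult_le_sum_power2 del: ennreal_plus)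
  also have "\<dots> = ennreal (L2.qf F + L2.qf G)"
    unfolding qf_eq using int F G by (subst nn_integral_eq_integral) (auto simp: borel_L2_integrable)
  finally show ?thesis .
qed

lemma borel_L2_translate: "F \<in> borel_L2 \<Longrightarrow> (\<lambda>z. F (z + t)) \<in> borel_L2"
  using lborel_integrable_translate[of "\<lambda>z. (cmod (F z))\<^sup>2" t] by (auto simp: borel_L2_def)

lemma qf_translate: "F \<in> borel_L2 \<Longrightarrow> L2.qf (\<lambda>z. F (z + t)) = L2.qf F"
  using lborel_integral_translate[of "\<lambda>z. (cmod (F z))\<^sup>2" t] by (auto simp: borel_L2_def qf_eq)

lemma borel_L2_unimodular:
  assumes "F \<in> borel_L2" "m \<in> borel_measurable borel" "\<And>z. cmod (m z) = 1"
  shows "(\<lambda>z. m z * F z) \<in> borel_L2" "L2.qf (\<lambda>z. m z * F z) = L2.qf F"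
  using assms by (auto simp: borel_L2_def qf_eq norm_mult)

lemma borel_L2_indicator:
  assumes F: "F \<in> borel_L2" and A[measurable]: "A \<in> sets borel"
  shows "(\<lambda>z. indicator A z * F z) \<in> borel_L2"
proof -
  have [measurable]: "F \<in> borel_measurable borel" using F by measurable
  have "integrable lborel (\<lambda>z. indicator A z *\<^sub>R (cmod (F z))\<^sup>2)"
    using borel_L2_integrable[OF F] A by (intro integrable_mult_indicator) auto
  moreover have "indicator A z *\<^sub>R (cmod (F z))\<^sup>2 = (cmod (indicator A z * F z))\<^sup>2" for z
    by (simp add: indicator_def)
  ultimately show ?thesis by (simp add: borel_L2_def)
qed

text \<open>For nonnegative reals (x - y)^2 \<le> |x^2 - y^2|, which reduces the claim to the L^1
  statement for the square of p.\<close>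

lemma tendsto_L2_translation_nonneg:
  fixes p :: "'a::euclidean_space \<Rightarrow> real"
  assumes p[measurable]: "p \<in> borel_measurable borel" and p0: "\<And>x. 0 \<le> p x"
    and int: "integrable lborel (\<lambda>x. (p x)\<^sup>2)"
  shows "((\<lambda>u. \<integral>x. (p (x + u) - p x)\<^sup>2 \<partial>lborel) \<longlongrightarrow> 0) (nhds 0)"
proof (rule tendsto_sandwich[of "\<lambda>_. 0"])
  show "((\<lambda>u. \<integral>x. \<bar>(p (x + u))\<^sup>2 - (p x)\<^sup>2\<bar> \<partial>lborel) \<longlongrightarrow> 0) (nhds 0)"
    using tendsto_L1_translation[OF int] .
  have le: "(x - y)\<^sup>2 \<le> \<bar>x\<^sup>2 - y\<^sup>2\<bar>" if "0 \<le> x" "0 \<le> y" for x y :: real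
  proof -
    have "(x - y)\<^sup>2 = \<bar>x - y\<bar> * \<bar>x - y\<bar>" by (simp add: power2_eq_square)
    also have "\<dots> \<le> \<bar>x - y\<bar> * (x + y)" using that by (intro mult_left_mono) auto
    also have "\<dots> = \<bar>(x - y) * (x + y)\<bar>" using that by (simp add: abs_mult)
    finally show ?thesis by (simp add: power2_eq_square algebra_simps)
  qed
  have int': "integrable lborel (\<lambda>x. \<bar>(p (x + u))\<^sup>2 - (p x)\<^sup>2\<bar>)" for u
    by (intro integrable_abs Bochner_Integration.integrable_diff int lborel_integrable_translate[OF int])
  show "\<forall>\<^sub>F u in nhds 0. (\<integral>x. (p (x + u) - p x)\<^sup>2 \<partial>lborel) \<le> (\<integral>x. \<bar>(p (x + u))\<^sup>2 - (p x)\<^sup>2\<bar> \<partial>lborel)"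
    using le[OF p0 p0] by (intro always_eventually allI integral_mono' int') auto
qed (auto intro!: always_eventually)

text \<open>The nonnegative case applies to the positive and negative parts of the real and the
  imaginary part; P enumerates these four.\<close>

lemma tendsto_L2_translation:
  fixes h :: "'a::euclidean_space \<Rightarrow> complex"
  assumes h: "h \<in> borel_L2"
  shows "((\<lambda>u. L2.qf (\<lambda>x. h (x + u) - h x)) \<longlongrightarrow> 0) (nhds 0)"
proof -
  have m[measurable]: "h \<in> borel_measurable borel" using h by measurable
  define P where "P i x = max 0 ([Re (h x), - Re (h x), Im (h x), - Im (h x)] ! i)" for i x
  have P: "P i \<in> borel_measurable borel" "\<And>x. 0 \<le> P i x" "integrable lborel (\<lambda>x. (P i x)\<^sup>2)" if "i < 4" for i
  proof -
    from that have i: "i = 0 \<or> i = 1 \<or> i = 2 \<or> i = 3" by auto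
    then show [measurable]: "P i \<in> borel_measurable borel"
      unfolding P_def[abs_def] by (auto simp: numeral_eq_Suc)
    show "0 \<le> P i x" for x by (simp add: P_def)
    have "\<bar>P i x\<bar> \<le> cmod (h x)" for x
      using i abs_Re_le_cmod[of "h x"] abs_Im_le_cmod[of "h x"] by (auto simp: P_def numeral_eq_Suc)
    then have "(P i x)\<^sup>2 \<le> (cmod (h x))\<^sup>2" for x
      by (metis abs_le_square_iff abs_norm_cancel)
    then show "integrable lborel (\<lambda>x. (P i x)\<^sup>2)"
      by (intro Bochner_Integration.integrable_bound[OF borel_L2_integrable[OF h]]) auto
  qed
  have int: "integrable lborel (\<lambda>x. (P i (x + u) - P i x)\<^sup>2)" if "i < 4" for i u
  proof (rule Bochner_Integration.integrable_bound)
    show "integrable lborel (\<lambda>x. (P i (x + u))\<^sup>2 + (P i x)\<^sup>2)"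
      using lborel_integrable_translate[OF P(3)[OF that]] P(3)[OF that] by simp
    show "(\<lambda>x. (P i (x + u) - P i x)\<^sup>2) \<in> borel_measurable lborel" using P(1)[OF that] by measurable
    show "AE x in lborel. norm ((P i (x + u) - P i x)\<^sup>2) \<le> norm ((P i (x + u))\<^sup>2 + (P i x)\<^sup>2)"
    proof (rule AE_I2)
      fix x
      have "(P i (x + u) - P i x)\<^sup>2 \<le> (P i (x + u))\<^sup>2 + (P i x)\<^sup>2"
        using mult_nonneg_nonneg[OF P(2)[OF that] P(2)[OF that], of "x + u" x] by (simp add: power2_diff mult.commute)
      then show "norm ((P i (x + u) - P i x)\<^sup>2) \<le> norm ((P i (x + u))\<^sup>2 + (P i x)\<^sup>2)" by simp
    qed
  qed
  show ?thesis
  proof (rule tendsto_sandwich[of "\<lambda>_. 0"])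
    have "((\<lambda>u. 2 * (\<Sum>i<4. \<integral>x. (P i (x + u) - P i x)\<^sup>2 \<partial>lborel)) \<longlongrightarrow> 2 * (\<Sum>i<(4::nat). 0)) (nhds 0)"
      by (intro tendsto_intros tendsto_L2_translation_nonneg P) auto
    then show "((\<lambda>u. 2 * (\<Sum>i<4. \<integral>x. (P i (x + u) - P i x)\<^sup>2 \<partial>lborel)) \<longlongrightarrow> 0) (nhds 0)" by simp
    have le: "(cmod (h (x + u) - h x))\<^sup>2 \<le> 2 * (\<Sum>i<4. (P i (x + u) - P i x)\<^sup>2)" for x u
    proof -
      have *: "(a - b)\<^sup>2 \<le> 2 * ((max 0 a - max 0 b)\<^sup>2 + (max 0 (- a) - max 0 (- b))\<^sup>2)" for a b :: real
      proof -
        \<comment> \<open>The increments of the positive and of the negative part, so that a - b = p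
          - q.\<close>
        define p q where "p = max 0 a - max 0 b" and "q = max 0 (- a) - max 0 (- b)"
        have "a - b = p - q" by (simp add: p_def q_def max_def)
        then have "(a - b)\<^sup>2 \<le> 2 * (p\<^sup>2 + q\<^sup>2)"
          using zero_le_power2[of "p + q"] by (simp add: power2_diff power2_sum)
        then show ?thesis by (simp only: p_def q_def)
      qed
      have "(cmod (h (x + u) - h x))\<^sup>2 = (Re (h (x + u)) - Re (h x))\<^sup>2 + (Im (h (x + u)) - Im (h x))\<^sup>2"
        by (simp add: cmod_power2)
      also have "\<dots> \<le> 2 * (\<Sum>i<4. (P i (x + u) - P i x)\<^sup>2)"
        using *[of "Re (h (x + u))" "Re (h x)"] *[of "Im (h (x + u))" "Im (h x)"]
        by (simp add: P_def numeral_eq_Suc)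
      finally show ?thesis .
    qed
    show "\<forall>\<^sub>F u in nhds 0. L2.qf (\<lambda>x. h (x + u) - h x) \<le> 2 * (\<Sum>i<4. \<integral>x. (P i (x + u) - P i x)\<^sup>2 \<partial>lborel)"
    proof (intro always_eventually allI)
      fix u
      have "L2.qf (\<lambda>x. h (x + u) - h x) \<le> (\<integral>x. 2 * (\<Sum>i<4. (P i (x + u) - P i x)\<^sup>2) \<partial>lborel)"
        unfolding qf_eq by (intro integral_mono' le integrable_mult_right Bochner_Integration.integrable_sum int) (auto intro!: sum_nonneg)
      also have "\<dots> = 2 * (\<Sum>i<4. \<integral>x. (P i (x + u) - P i x)\<^sup>2 \<partial>lborel)"
        by (simp add: int)
      finally show "L2.qf (\<lambda>x. h (x + u) - h x) \<le> 2 * (\<Sum>i<4. \<integral>x. (P i (x + u) - P i x)\<^sup>2 \<partial>lborel)" .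
    qed
    show "\<forall>\<^sub>F u in nhds 0. 0 \<le> L2.qf (\<lambda>x. h (x + u) - h x)"
      unfolding qf_eq by simp
  qed simp
qed

text \<open>Cauchy-Schwarz and the continuity of shifts in L^2. In Plancherel's theorem this is the
  pointwise limit that the Gaussian averages need.\<close>

lemma autocorrelation_tendsto:
  fixes h :: "'a::euclidean_space \<Rightarrow> complex"
  assumes h: "h \<in> borel_L2"
  shows "((\<lambda>u. bip (\<lambda>x. h (x + u)) h) \<longlongrightarrow> bip h h) (nhds 0)"
proof (rule LIM_zero_cancel, rule tendsto_norm_zero_cancel, rule tendsto_sandwich[of "\<lambda>_. 0"])
  have "((\<lambda>u. sqrt (L2.qf (\<lambda>x. h (x + u) - h x) * L2.qf h)) \<longlongrightarrow> sqrt (0 * L2.qf h)) (nhds 0)"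
    by (intro tendsto_intros tendsto_L2_translation h)
  then show "((\<lambda>u. sqrt (L2.qf (\<lambda>x. h (x + u) - h x) * L2.qf h)) \<longlongrightarrow> 0) (nhds 0)" by simp
  show "\<forall>\<^sub>F u in nhds 0. cmod (bip (\<lambda>x. h (x + u)) h - bip h h) \<le> sqrt (L2.qf (\<lambda>x. h (x + u) - h x) * L2.qf h)"
    using L2.Cauchy_Schwarz[OF L2.diff_mem[OF borel_L2_translate[OF h] h] h]
    by (intro always_eventually allI real_le_rsqrt) (simp add: L2.ip_diff borel_L2_translate h)
qed (auto intro!: always_eventually)

section \<open>The Plancherel theorem\<close>

definition chr :: "real \<Rightarrow> complex" where
  "chr s = exp (2 * of_real pi * \<i> * of_real s)"

lemma norm_chr [simp]: "cmod (chr s) = 1"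
proof -
  have "chr s = exp (\<i> * of_real (2 * pi * s))" by (simp add: chr_def algebra_simps)
  then show ?thesis by (simp only: norm_exp_i_times)
qed

lemma chr_add: "chr (s + t) = chr s * chr t"
  by (simp add: chr_def distrib_left exp_add)

lemma chr_0 [simp]: "chr 0 = 1"
  by (simp add: chr_def)

lemma cnj_chr: "cnj (chr s) = chr (- s)"
  by (simp add: chr_def exp_cnj)

lemma chr_measurable [measurable]: "chr \<in> borel_measurable borel"
  unfolding chr_def[abs_def] by (intro borel_measurable_continuous_onI continuous_intros)

lemma chr_sum: "finite I \<Longrightarrow> chr (\<Sum>i\<in>I. f i) = (\<Prod>i\<in>I. chr (f i))"
  by (induction I rule: finite_induct) (simp_all add: chr_add)

definition gauss :: "'a::euclidean_space \<Rightarrow> real" where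
  "gauss x = exp (- pi * (norm x)\<^sup>2)"

lemma gauss_measurable [measurable]: "gauss \<in> borel_measurable borel"
  unfolding gauss_def[abs_def] by measurable

lemma gauss_nonneg [simp]: "0 \<le> gauss x" and gauss_le_1: "gauss x \<le> 1" and gauss_0 [simp]: "gauss 0 = 1"
  by (simp_all add: gauss_def)

text \<open>With this normalization the Gaussian is its own Fourier transform. Up to a change of
  scale this is the characteristic function of the standard normal distribution.\<close>

lemma gauss_real_Fourier:
  "integrable lborel (\<lambda>x::real. of_real (gauss x) * chr (- (s * x)))"
  "(\<integral>x. of_real (gauss x) * chr (- (s * x)) \<partial>lborel) = of_real (gauss (s::real))"
proof -
  \<comment> \<open>As c^2 = 2 pi, c times the normal density at c x is exp (- pi x^2), and the
    frequency t = - c s turns t (c x) into - 2 pi s x.\<close>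
  define c where "c = sqrt (2 * pi)"
  have c: "c \<noteq> 0" "c * c = 2 * pi" "0 < c" by (auto simp: c_def)
  define t where "t = - c * s"
  have int: "integrable lborel (\<lambda>x. std_normal_density x *\<^sub>R iexp (t * x))"
  proof (rule Bochner_Integration.integrable_bound)
    show "integrable lborel std_normal_density" using integrable_normal_density[of 1 0] by simp
  qed (auto simp: norm_mult)
  have eq: "c *\<^sub>R (std_normal_density (c * x) *\<^sub>R iexp (t * (c * x))) = of_real (gauss x) * chr (- (s * x))" for x
  proof -
    have "c * std_normal_density (c * x) = gauss x"
      using c by (simp add: std_normal_density_def gauss_def c_def[symmetric] power_mult_distrib)
        (simp add: power2_eq_square c(2))
    moreover have "iexp (t * (c * x)) = chr (- (s * x))"
    proof -
      have "t * (c * x) = - (2 * pi * (s * x))"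
        using c(2) by (simp add: t_def algebra_simps)
      then show ?thesis by (simp add: chr_def algebra_simps)
    qed
    ultimately show ?thesis
      by (metis (no_types) scaleR_scaleR scaleR_conv_of_real)
  qed
  have "integrable lborel (\<lambda>x. c *\<^sub>R (std_normal_density (c * x) *\<^sub>R iexp (t * (c * x))))"
    by (intro integrable_scaleR_right) (use lborel_integrable_affine[OF int c(1), of 0] in simp)
  then show "integrable lborel (\<lambda>x::real. of_real (gauss x) * chr (- (s * x)))"
    unfolding eq .
  have "(\<integral>x. of_real (gauss x) * chr (- (s * x)) \<partial>lborel) =
      c *\<^sub>R (\<integral>x. std_normal_density (c * x) *\<^sub>R iexp (t * (c * x)) \<partial>lborel)"
    unfolding eq[symmetric] by (rule integral_scaleR_right)
  also have "\<dots> = (\<integral>x. std_normal_density x *\<^sub>R iexp (t * x) \<partial>lborel)"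
    using lborel_integral_affine[of "\<lambda>x. std_normal_density x *\<^sub>R iexp (t * x)" c 0] c by simp
  also have "\<dots> = char std_normal_distribution t"
    unfolding char_def by (subst integral_density) (auto simp: mult.commute)
  also have "\<dots> = of_real (exp (- (t\<^sup>2) / 2))"
    by (simp add: char_std_normal_distribution)
  also have "exp (- (t\<^sup>2) / 2) = gauss s"
    using c by (simp add: t_def gauss_def power_mult_distrib power2_eq_square[of c])
  finally show "(\<integral>x. of_real (gauss x) * chr (- (s * x)) \<partial>lborel) = of_real (gauss s)" .
qed

lemma gauss_prod: "gauss (x::'a::euclidean_space) = (\<Prod>b\<in>Basis. gauss (x \<bullet> b))"
proof -
  have "(norm x)\<^sup>2 = (\<Sum>b\<in>Basis. (x \<bullet> b)\<^sup>2)"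
    unfolding power2_norm_eq_inner by (subst euclidean_inner) (simp add: power2_eq_square)
  then show ?thesis by (simp add: gauss_def exp_sum[symmetric] sum_distrib_left sum_negf)
qed

text \<open>Lebesgue measure is the image of a product of one-dimensional measures under the map
  from coordinates to vectors, so integrals of product functions factor.\<close>

lemma lborel_integral_prod_Basis:
  fixes f :: "'a::euclidean_space \<Rightarrow> real \<Rightarrow> complex"
  assumes int: "\<And>b. b \<in> Basis \<Longrightarrow> integrable lborel (f b)"
  shows "integrable lborel (\<lambda>x::'a. \<Prod>b\<in>Basis. f b (x \<bullet> b))"
    and "(\<integral>x. (\<Prod>b\<in>Basis. f b (x \<bullet> b)) \<partial>(lborel :: 'a measure)) = (\<Prod>b\<in>Basis. \<integral>x. f b x \<partial>lborel)"
proof -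
  have m[measurable]: "\<And>b. b \<in> Basis \<Longrightarrow> f b \<in> borel_measurable borel"
    using int by (auto dest: borel_measurable_integrable)
  interpret product_sigma_finite "\<lambda>_::'a. lborel :: real measure" ..
  have mm: "(\<lambda>x::'a. \<Prod>b\<in>Basis. f b (x \<bullet> b)) \<in> borel_measurable borel" by measurable
  have T: "(\<lambda>g. \<Sum>b\<in>Basis. g b *\<^sub>R b) \<in> (\<Pi>\<^sub>M b\<in>(Basis::'a set). (lborel :: real measure)) \<rightarrow>\<^sub>M (borel :: 'a measure)"
    by measurable
  have comp: "(\<Prod>b\<in>Basis. f b ((\<Sum>b\<in>Basis. g b *\<^sub>R b) \<bullet> b)) = (\<Prod>b\<in>Basis. f b (g b))" for g
    by (intro prod.cong) (simp_all add: inner_sum_left inner_Basis if_distrib cong: if_cong)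
  have "(\<integral>x. (\<Prod>b\<in>Basis. f b (x \<bullet> b)) \<partial>(lborel :: 'a measure))
      = (\<integral>g. (\<Prod>b\<in>Basis. f b (g b)) \<partial>(\<Pi>\<^sub>M b\<in>(Basis::'a set). lborel))"
    by (subst lborel_eq, subst integral_distr[OF T mm]) (simp only: comp)
  also have "\<dots> = (\<Prod>b\<in>Basis. \<integral>x. f b x \<partial>lborel)"
    by (rule product_integral_prod) (auto intro: int)
  finally show "(\<integral>x. (\<Prod>b\<in>Basis. f b (x \<bullet> b)) \<partial>(lborel :: 'a measure)) = (\<Prod>b\<in>Basis. \<integral>x. f b x \<partial>lborel)" .
  show "integrable lborel (\<lambda>x::'a. \<Prod>b\<in>Basis. f b (x \<bullet> b))"
    by (subst lborel_eq, subst integrable_distr_eq[OF T mm], simp only: comp)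
      (rule product_integrable_prod, auto intro: int)
qed

lemma gauss_Fourier:
  fixes \<xi> :: "'a::euclidean_space"
  shows "integrable lborel (\<lambda>x::'a. of_real (gauss x) * chr (- (\<xi> \<bullet> x)))"
    "(\<integral>x. of_real (gauss x) * chr (- (\<xi> \<bullet> x)) \<partial>lborel) = of_real (gauss \<xi>)"
proof -
  have eq: "of_real (gauss x) * chr (- (\<xi> \<bullet> x)) = (\<Prod>b\<in>Basis. of_real (gauss (x \<bullet> b)) * chr (- ((\<xi> \<bullet> b) * (x \<bullet> b))))"
    for x :: 'a
    by (simp add: gauss_prod[of x] euclidean_inner[of \<xi> x] prod.distrib chr_sum[symmetric] sum_negf)
  show "integrable lborel (\<lambda>x::'a. of_real (gauss x) * chr (- (\<xi> \<bullet> x)))"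
    unfolding eq
    by (rule lborel_integral_prod_Basis[of "\<lambda>b x. of_real (gauss x) * chr (- ((\<xi> \<bullet> b) * x))"]) (rule gauss_real_Fourier)
  have "(\<integral>x. of_real (gauss x) * chr (- (\<xi> \<bullet> x)) \<partial>lborel) =
     (\<Prod>b\<in>Basis. \<integral>x. of_real (gauss x) * chr (- ((\<xi> \<bullet> b) * x)) \<partial>lborel)"
    unfolding eq
    by (rule lborel_integral_prod_Basis[of "\<lambda>b x. of_real (gauss x) * chr (- ((\<xi> \<bullet> b) * x))"]) (rule gauss_real_Fourier)
  also have "\<dots> = of_real (gauss \<xi>)"
    by (simp add: gauss_real_Fourier gauss_prod[of \<xi>])
  finally show "(\<integral>x. of_real (gauss x) * chr (- (\<xi> \<bullet> x)) \<partial>lborel) = of_real (gauss \<xi>)" .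
qed

lemma integrable_gauss: "integrable lborel (gauss :: 'a::euclidean_space \<Rightarrow> real)"
  and integral_gauss: "(\<integral>x. gauss x \<partial>(lborel :: 'a::euclidean_space measure)) = 1"
proof -
  have 1: "integrable lborel (\<lambda>x::'a. complex_of_real (gauss x))"
    using gauss_Fourier(1)[of 0] by simp
  then show "integrable lborel (gauss :: 'a \<Rightarrow> real)"
    using complex_of_real_integrable_eq by blast
  have "complex_of_real (\<integral>x. gauss x \<partial>(lborel :: 'a measure)) = 1"
    using gauss_Fourier(2)[of 0] by simp
  then show "(\<integral>x. gauss x \<partial>(lborel :: 'a measure)) = 1" by simp
qed

text \<open>For a measurable h that is not integrable every value is the default 0 of the integral,
  so the energy statements below assume integrability.\<close>

definition fourier :: "('a::euclidean_space \<Rightarrow> complex) \<Rightarrow> 'a \<Rightarrow> complex" where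
  "fourier h \<xi> = (\<integral>t. h t * chr (- (\<xi> \<bullet> t)) \<partial>lborel)"

lemma fourier_measurable [measurable]:
  assumes [measurable]: "h \<in> borel_measurable borel"
  shows "fourier h \<in> borel_measurable borel"
  unfolding fourier_def[abs_def] by measurable

lemma gauss_scaled_Fourier:
  fixes u :: "'a::euclidean_space"
  assumes \<delta>: "0 < \<delta>"
  shows "(\<integral>\<xi>. of_real (gauss (\<delta> *\<^sub>R \<xi>)) * chr (- (\<xi> \<bullet> (\<delta> *\<^sub>R u))) \<partial>lborel) * of_real (\<delta> ^ DIM('a)) = of_real (gauss u)"
proof -
  have "of_real (gauss u) = (\<integral>x. of_real (gauss x) * chr (- (u \<bullet> x)) \<partial>lborel)"
    by (simp add: gauss_Fourier)
  also have "\<dots> = \<bar>\<delta>\<bar> ^ DIM('a) *\<^sub>R (\<integral>\<xi>. of_real (gauss (0 + \<delta> *\<^sub>R \<xi>)) * chr (- (u \<bullet> (0 + \<delta> *\<^sub>R \<xi>))) \<partial>lborel)"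
    by (rule lborel_integral_affine) (use \<delta> in auto)
  finally show ?thesis using \<delta> by (simp add: inner_commute scaleR_conv_of_real mult.commute)
qed

text \<open>The squared modulus expands into a double integral of h t cnj (h s) against a character.
  The Gaussian weight makes everything absolutely convergent, so the frequency can be integrated
  first; this leaves a Gaussian in (t - s) / \<delta>, and t = s + \<delta> v produces the
  autocorrelation.\<close>

lemma fourier_energy_damped:
  fixes h :: "'a::euclidean_space \<Rightarrow> complex"
  assumes h: "integrable lborel h" and h2: "h \<in> borel_L2" and \<delta>: "0 < \<delta>"
  shows "of_real (\<integral>\<xi>. gauss (\<delta> *\<^sub>R \<xi>) * (cmod (fourier h \<xi>))\<^sup>2 \<partial>lborel) =
    (\<integral>v. of_real (gauss v) * bip (\<lambda>x. h (x + \<delta> *\<^sub>R v)) h \<partial>lborel)"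
proof -
  have m[measurable]: "h \<in> borel_measurable borel" using h2 by measurable
  have hn: "(\<integral>\<^sup>+x. ennreal (cmod (h x)) \<partial>lborel) < \<infinity>"
    using h by (simp add: integrable_iff_bounded)
  have gn: "(\<integral>\<^sup>+\<xi>. ennreal (gauss (\<delta> *\<^sub>R \<xi> :: 'a)) \<partial>lborel) < \<infinity>"
  proof -
    have "integrable lborel (\<lambda>\<xi>::'a. gauss (\<delta> *\<^sub>R \<xi>))"
      using lborel_integrable_affine[OF integrable_gauss, of \<delta> 0] \<delta> by simp
    then show ?thesis by (simp add: integrable_iff_bounded)
  qed
  have gn1: "(\<integral>\<^sup>+v. ennreal (gauss (v :: 'a)) \<partial>lborel) < \<infinity>"
    using integrable_gauss[where 'a='a] by (simp add: integrable_iff_bounded)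
  define H where "H p = h (fst p) * cnj (h (snd p))" for p :: "'a \<times> 'a"
  have Hm[measurable]: "H \<in> borel_measurable (borel \<Otimes>\<^sub>M borel)" unfolding H_def[abs_def] by measurable
  have Hm'[measurable]: "H \<in> borel_measurable borel" using Hm by (simp add: borel_prod)
  have nn2: "(\<integral>\<^sup>+x. \<integral>\<^sup>+y. ennreal (cmod (h x)) * ennreal (cmod (h y)) \<partial>lborel \<partial>lborel) < \<infinity>"
    using hn by (simp add: nn_integral_cmult nn_integral_multc ennreal_mult_less_top)
  have "integrable lborel (\<lambda>p. h (fst p) * cnj (h (snd p)))"
    by (rule lborel_Fubini(1)) (use nn2 in \<open>simp_all add: norm_mult ennreal_mult\<close>)
  then have Hn: "(\<integral>\<^sup>+p. ennreal (cmod (H p)) \<partial>lborel) < \<infinity>"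
    by (simp add: integrable_iff_bounded H_def)
  have sq: "of_real ((cmod (fourier h \<xi>))\<^sup>2) = (\<integral>p. H p * chr (- (\<xi> \<bullet> (fst p - snd p))) \<partial>lborel)" for \<xi>
  proof -
    have "of_real ((cmod (fourier h \<xi>))\<^sup>2) = (\<integral>t. h t * chr (- (\<xi> \<bullet> t)) \<partial>lborel) * cnj (\<integral>s. h s * chr (- (\<xi> \<bullet> s)) \<partial>lborel)"
      by (simp add: complex_norm_square fourier_def del: of_real_power)
    also have "\<dots> = (\<integral>t. \<integral>s. (h t * chr (- (\<xi> \<bullet> t))) * cnj (h s * chr (- (\<xi> \<bullet> s))) \<partial>lborel \<partial>lborel)"
      by (simp flip: Bochner_Integration.integral_cnj)
    also have "\<dots> = (\<integral>t. \<integral>s. (h t * cnj (h s)) * chr (- (\<xi> \<bullet> (t - s))) \<partial>lborel \<partial>lborel)"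
      by (simp add: cnj_chr mult_ac inner_diff_right diff_conv_add_uminus[of _ "_ \<bullet> _"] minus_add_distrib chr_add del: add_uminus_conv_diff)
    also have "\<dots> = (\<integral>p. (h (fst p) * cnj (h (snd p))) * chr (- (\<xi> \<bullet> (fst p - snd p))) \<partial>lborel)"
      by (rule lborel_Fubini(3)[symmetric]) (use nn2 in \<open>simp_all add: norm_mult ennreal_mult\<close>)
    finally show ?thesis by (simp add: H_def)
  qed
  have m2: "(\<lambda>(t, s). h t * cnj (h s) * of_real (gauss ((t - s) /\<^sub>R \<delta>) / \<delta> ^ DIM('a))) \<in> borel_measurable (borel \<Otimes>\<^sub>M borel)"
    by measurable
  have "(\<integral>\<^sup>+t. \<integral>\<^sup>+s. ennreal (norm (h t * cnj (h s) * of_real (gauss ((t - s) /\<^sub>R \<delta>) / \<delta> ^ DIM('a)))) \<partial>lborel \<partial>lborel)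
     \<le> (\<integral>\<^sup>+t. \<integral>\<^sup>+s. ennreal (1 / \<delta> ^ DIM('a)) * (ennreal (cmod (h t)) * ennreal (cmod (h s))) \<partial>lborel \<partial>lborel)"
    using \<delta> by (intro nn_integral_mono)
      (auto simp: norm_mult norm_divide norm_power ennreal_mult[symmetric] divide_simps gauss_le_1 mult_left_le intro!: ennreal_leI)
  also have "\<dots> < \<infinity>"
    using hn by (simp add: nn_integral_cmult nn_integral_multc ennreal_mult_less_top)
  finally have fin: "(\<integral>\<^sup>+t. \<integral>\<^sup>+s. ennreal (norm (h t * cnj (h s) * of_real (gauss ((t - s) /\<^sub>R \<delta>) / \<delta> ^ DIM('a)))) \<partial>lborel \<partial>lborel) < \<infinity>" .
  have "complex_of_real (\<integral>\<xi>. gauss (\<delta> *\<^sub>R \<xi>) * (cmod (fourier h \<xi>))\<^sup>2 \<partial>lborel) =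
     (\<integral>\<xi>. of_real (gauss (\<delta> *\<^sub>R \<xi>)) * of_real ((cmod (fourier h \<xi>))\<^sup>2) \<partial>lborel)"
    by (subst integral_complex_of_real[symmetric]) simp
  also have "\<dots> = (\<integral>\<xi>. \<integral>p. of_real (gauss (\<delta> *\<^sub>R \<xi>)) * (H p * chr (- (\<xi> \<bullet> (fst p - snd p)))) \<partial>lborel \<partial>lborel)"
    unfolding sq by simp
  also have "\<dots> = (\<integral>p. \<integral>\<xi>. of_real (gauss (\<delta> *\<^sub>R \<xi>)) * (H p * chr (- (\<xi> \<bullet> (fst p - snd p)))) \<partial>lborel \<partial>lborel)"
  proof (rule lborel_Fubini(2))
    show "(\<lambda>(\<xi>, p). of_real (gauss (\<delta> *\<^sub>R \<xi>)) * (H p * chr (- (\<xi> \<bullet> (fst p - snd p))))) \<in> borel_measurable (borel \<Otimes>\<^sub>M borel)"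
      unfolding borel_prod[symmetric] by measurable
    show "(\<integral>\<^sup>+\<xi>. \<integral>\<^sup>+p. ennreal (norm (of_real (gauss (\<delta> *\<^sub>R \<xi>)) * (H p * chr (- (\<xi> \<bullet> (fst p - snd p)))))) \<partial>lborel \<partial>lborel) < \<infinity>"
      using gn Hn by (simp add: norm_mult ennreal_mult nn_integral_cmult nn_integral_multc ennreal_mult_less_top)
  qed
  also have "\<dots> = (\<integral>p. H p * (\<integral>\<xi>. of_real (gauss (\<delta> *\<^sub>R \<xi>)) * chr (- (\<xi> \<bullet> (fst p - snd p))) \<partial>lborel) \<partial>lborel)"
    by (simp add: mult.left_commute[of _ "H _"])
  also have "\<dots> = (\<integral>p. H p * of_real (gauss ((fst p - snd p) /\<^sub>R \<delta>) / \<delta> ^ DIM('a)) \<partial>lborel)"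
  proof -
    have "(\<integral>\<xi>. of_real (gauss (\<delta> *\<^sub>R \<xi>)) * chr (- (\<xi> \<bullet> w)) \<partial>lborel) = of_real (gauss (w /\<^sub>R \<delta>) / \<delta> ^ DIM('a))"
      for w :: 'a
      using gauss_scaled_Fourier[OF \<delta>, of "w /\<^sub>R \<delta>"] \<delta> by (simp add: field_simps)
    then show ?thesis by simp
  qed
  also have "\<dots> = (\<integral>p. h (fst p) * cnj (h (snd p)) * of_real (gauss ((fst p - snd p) /\<^sub>R \<delta>) / \<delta> ^ DIM('a)) \<partial>lborel)"
    by (simp add: H_def)
  also have "\<dots> = (\<integral>t. \<integral>s. h t * cnj (h s) * of_real (gauss ((t - s) /\<^sub>R \<delta>) / \<delta> ^ DIM('a)) \<partial>lborel \<partial>lborel)"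
    by (rule lborel_Fubini(3)[OF m2 fin])
  also have "\<dots> = (\<integral>s. \<integral>t. h t * cnj (h s) * of_real (gauss ((t - s) /\<^sub>R \<delta>) / \<delta> ^ DIM('a)) \<partial>lborel \<partial>lborel)"
    by (rule lborel_Fubini(2)[OF m2 fin])
  also have "\<dots> = (\<integral>s. \<integral>v. h (s + \<delta> *\<^sub>R v) * cnj (h s) * of_real (gauss v) \<partial>lborel \<partial>lborel)"
  proof (rule Bochner_Integration.integral_cong[OF refl])
    fix s
    have "(\<integral>t. h t * cnj (h s) * of_real (gauss ((t - s) /\<^sub>R \<delta>) / \<delta> ^ DIM('a)) \<partial>lborel) =
      (\<bar>\<delta>\<bar> ^ DIM('a)) *\<^sub>R (\<integral>v. h (s + \<delta> *\<^sub>R v) * cnj (h s) * of_real (gauss ((s + \<delta> *\<^sub>R v - s) /\<^sub>R \<delta>) / \<delta> ^ DIM('a)) \<partial>lborel)"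
      by (rule lborel_integral_affine) (use \<delta> in auto)
    also have "\<dots> = (\<integral>v. h (s + \<delta> *\<^sub>R v) * cnj (h s) * of_real (gauss v) \<partial>lborel)"
      using \<delta> by (subst integral_scaleR_right[symmetric]) (simp add: scaleR_conv_of_real)
    finally show "(\<integral>t. h t * cnj (h s) * of_real (gauss ((t - s) /\<^sub>R \<delta>) / \<delta> ^ DIM('a)) \<partial>lborel) =
      (\<integral>v. h (s + \<delta> *\<^sub>R v) * cnj (h s) * of_real (gauss v) \<partial>lborel)" .
  qed
  also have "\<dots> = (\<integral>v. \<integral>s. h (s + \<delta> *\<^sub>R v) * cnj (h s) * of_real (gauss v) \<partial>lborel \<partial>lborel)"
  proof (rule lborel_Fubini(2)[symmetric])
    show "(\<lambda>(v, s). h (s + \<delta> *\<^sub>R v) * cnj (h s) * of_real (gauss v)) \<in> borel_measurable (borel \<Otimes>\<^sub>M borel)"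
      by measurable
    \<comment> \<open>Square integrability of h bounds the inner integral uniformly in v.\<close>
    have "(\<integral>\<^sup>+s. ennreal (cmod (h (s + \<delta> *\<^sub>R v))) * ennreal (cmod (h s)) \<partial>lborel) \<le> ennreal (2 * L2.qf h)" for v
      using nn_integral_mult_borel_L2[OF borel_L2_translate[OF h2] h2] by (simp add: qf_translate h2)
    then have "(\<integral>\<^sup>+v. \<integral>\<^sup>+s. ennreal (norm (h (s + \<delta> *\<^sub>R v) * cnj (h s) * of_real (gauss v))) \<partial>lborel \<partial>lborel) \<le>
      (\<integral>\<^sup>+v. ennreal (2 * L2.qf h) * ennreal (gauss v) \<partial>(lborel :: 'a measure))"
      by (intro nn_integral_mono) (simp add: norm_mult ennreal_mult nn_integral_multc mult_right_mono)
    also have "\<dots> < \<infinity>" using gn1 by (simp add: nn_integral_cmult ennreal_mult_less_top)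
    finally show "(\<integral>\<^sup>+v. \<integral>\<^sup>+s. ennreal (norm (h (s + \<delta> *\<^sub>R v) * cnj (h s) * of_real (gauss v))) \<partial>lborel \<partial>lborel) < \<infinity>" .
  qed
  also have "\<dots> = (\<integral>v. of_real (gauss v) * bip (\<lambda>x. h (x + \<delta> *\<^sub>R v)) h \<partial>lborel)"
    by (simp add: bip_def mult.commute)
  finally show ?thesis .
qed

text \<open>Lets \<delta> tend to 0 in the damped identity. The left side converges monotonically,
  so that finiteness of the energy is a conclusion; the right side converges by continuity of the
  autocorrelation, dominated by a multiple of the Gaussian.\<close>

lemma Plancherel:
  fixes h :: "'a::euclidean_space \<Rightarrow> complex"
  assumes h: "integrable lborel h" and h2: "h \<in> borel_L2"
  shows "(\<integral>\<^sup>+\<xi>. ennreal ((cmod (fourier h \<xi>))\<^sup>2) \<partial>lborel) = ennreal (L2.qf h)"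
proof -
  have m[measurable]: "h \<in> borel_measurable borel" using h2 by measurable
  define \<delta> where "\<delta> k = inverse (real (Suc k))" for k
  have \<delta>: "0 < \<delta> k" for k by (simp add: \<delta>_def)
  have \<delta>0: "\<delta> \<longlonglongrightarrow> 0" unfolding \<delta>_def by (rule LIMSEQ_inverse_real_of_nat)
  have bound: "cmod (fourier h \<xi>) \<le> (\<integral>t. cmod (h t) \<partial>lborel)" for \<xi>
    unfolding fourier_def by (rule order_trans[OF integral_norm_bound]) (simp add: norm_mult)
  have int: "integrable lborel (\<lambda>\<xi>. gauss (\<delta> k *\<^sub>R \<xi>) * (cmod (fourier h \<xi>))\<^sup>2)" for k
  proof (rule Bochner_Integration.integrable_bound)
    show "integrable lborel (\<lambda>\<xi>::'a. (\<integral>t. cmod (h t) \<partial>lborel)\<^sup>2 * gauss (\<delta> k *\<^sub>R \<xi>))"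
      using lborel_integrable_affine[OF integrable_gauss, of "\<delta> k" 0] \<delta>[of k] by (intro integrable_mult_right) auto
    have "(cmod (fourier h \<xi>))\<^sup>2 \<le> (\<integral>t. cmod (h t) \<partial>lborel)\<^sup>2" for \<xi>
      by (intro power_mono bound) simp
    then show "AE \<xi> in lborel. norm (gauss (\<delta> k *\<^sub>R \<xi>) * (cmod (fourier h \<xi>))\<^sup>2) \<le>
        norm ((\<integral>t. cmod (h t) \<partial>lborel)\<^sup>2 * gauss (\<delta> k *\<^sub>R \<xi>))"
      by (intro AE_I2) (simp add: abs_mult mult.commute mult_left_mono)
  qed measurable
  define J where "J k = (\<integral>\<xi>. gauss (\<delta> k *\<^sub>R \<xi>) * (cmod (fourier h \<xi>))\<^sup>2 \<partial>lborel)" for k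
  have lim1: "(\<lambda>k. ennreal (J k)) \<longlonglongrightarrow> (\<integral>\<^sup>+\<xi>. ennreal ((cmod (fourier h \<xi>))\<^sup>2) \<partial>lborel)"
  proof -
    have "(\<lambda>k. \<integral>\<^sup>+\<xi>. ennreal (gauss (\<delta> k *\<^sub>R \<xi>) * (cmod (fourier h \<xi>))\<^sup>2) \<partial>lborel)
        \<longlonglongrightarrow> (\<integral>\<^sup>+\<xi>. ennreal ((cmod (fourier h \<xi>))\<^sup>2) \<partial>lborel)"
    proof (rule nn_integral_LIMSEQ)
      have "gauss (\<delta> i *\<^sub>R \<xi>) \<le> gauss (\<delta> (Suc i) *\<^sub>R \<xi>)" for i and \<xi> :: 'a
      proof -
        have "(\<delta> (Suc i))\<^sup>2 \<le> (\<delta> i)\<^sup>2"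
          by (intro power_mono) (auto simp: \<delta>_def field_simps)
        then have "(\<delta> (Suc i))\<^sup>2 * (norm \<xi>)\<^sup>2 \<le> (\<delta> i)\<^sup>2 * (norm \<xi>)\<^sup>2"
          by (intro mult_right_mono) auto
        then show ?thesis by (simp add: gauss_def power_mult_distrib)
      qed
      then show "incseq (\<lambda>k \<xi>. ennreal (gauss (\<delta> k *\<^sub>R \<xi>) * (cmod (fourier h \<xi>))\<^sup>2))"
        by (intro incseq_SucI le_funI ennreal_leI mult_right_mono) auto
      show "(\<lambda>k. ennreal (gauss (\<delta> k *\<^sub>R \<xi>) * (cmod (fourier h \<xi>))\<^sup>2)) \<longlonglongrightarrow> ennreal ((cmod (fourier h \<xi>))\<^sup>2)" for \<xi>
      proof -
        have "(\<lambda>k. gauss (\<delta> k *\<^sub>R \<xi>) * (cmod (fourier h \<xi>))\<^sup>2) \<longlonglongrightarrow> exp (- pi * (norm (0 *\<^sub>R \<xi>))\<^sup>2) * (cmod (fourier h \<xi>))\<^sup>2"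
          unfolding gauss_def by (intro tendsto_intros \<delta>0)
        then show ?thesis by (intro tendsto_ennrealI) simp
      qed
    qed measurable
    then show ?thesis
      unfolding J_def using int by (subst (asm) nn_integral_eq_integral) auto
  qed
  have "(\<lambda>k. complex_of_real (J k)) \<longlonglongrightarrow> (\<integral>v. of_real (gauss v) * bip h h \<partial>(lborel :: 'a measure))"
    unfolding J_def fourier_energy_damped[OF h h2 \<delta>]
  proof (rule integral_dominated_convergence)
    show "integrable lborel (\<lambda>v::'a. gauss v * L2.qf h)"
      by (intro integrable_mult_left integrable_gauss)
    show "AE v in lborel. (\<lambda>k. of_real (gauss v) * bip (\<lambda>x. h (x + \<delta> k *\<^sub>R v)) h) \<longlonglongrightarrow> of_real (gauss v) * bip h h"
    proof (rule AE_I2)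
      fix v :: 'a
      have "(\<lambda>k. \<delta> k *\<^sub>R v) \<longlonglongrightarrow> 0 *\<^sub>R v" by (intro tendsto_intros \<delta>0)
      then have "filterlim (\<lambda>k. \<delta> k *\<^sub>R v) (nhds 0) sequentially" by simp
      from filterlim_compose[OF autocorrelation_tendsto[OF h2] this]
      show "(\<lambda>k. of_real (gauss v) * bip (\<lambda>x. h (x + \<delta> k *\<^sub>R v)) h) \<longlonglongrightarrow> of_real (gauss v) * bip h h"
        by (intro tendsto_intros)
    qed
    show "AE v in lborel. norm (of_real (gauss v) * bip (\<lambda>x. h (x + \<delta> k *\<^sub>R v)) h) \<le> gauss v * L2.qf h" for k
    proof (rule AE_I2)
      fix v :: 'a
      have "(cmod (bip (\<lambda>x. h (x + \<delta> k *\<^sub>R v)) h))\<^sup>2 \<le> L2.qf (\<lambda>x. h (x + \<delta> k *\<^sub>R v)) * L2.qf h"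
        by (rule L2.Cauchy_Schwarz[OF borel_L2_translate[OF h2] h2])
      also have "\<dots> = (L2.qf h)\<^sup>2" by (simp add: qf_translate h2 power2_eq_square)
      finally have "cmod (bip (\<lambda>x. h (x + \<delta> k *\<^sub>R v)) h) \<le> L2.qf h"
        by (rule power2_le_imp_le) (rule L2.ip_nonneg[OF h2])
      then show "norm (of_real (gauss v) * bip (\<lambda>x. h (x + \<delta> k *\<^sub>R v)) h) \<le> gauss v * L2.qf h"
        by (simp add: norm_mult mult_left_mono)
    qed
    show "(\<lambda>v. of_real (gauss v) * bip (\<lambda>x. h (x + \<delta> k *\<^sub>R v)) h) \<in> borel_measurable lborel" for k
      unfolding bip_def by measurable
  qed simp
  also have "(\<integral>v. of_real (gauss v) * bip h h \<partial>(lborel :: 'a measure)) = bip h h"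
    using integral_gauss[where 'a='a] by simp
  also have "bip h h = of_real (L2.qf h)" by (rule L2.ip_self[OF h2])
  finally have "J \<longlonglongrightarrow> L2.qf h" by (simp add: tendsto_of_real_iff)
  then have "(\<lambda>k. ennreal (J k)) \<longlonglongrightarrow> ennreal (L2.qf h)" by (rule tendsto_ennrealI)
  with lim1 show ?thesis by (rule LIMSEQ_unique)
qed

section \<open>The short-time Fourier transform and the localized projection\<close>

lemma fst_borel_measurable [measurable]: "fst \<in> borel_measurable (borel :: ('a::euclidean_space \<times> 'b::euclidean_space) measure)"
  and snd_borel_measurable [measurable]: "snd \<in> borel_measurable (borel :: ('a::euclidean_space \<times> 'b::euclidean_space) measure)"
  by (auto intro!: borel_measurable_continuous_onI continuous_intros)

definition tf_shift :: "(real^'n) \<times> (real^'n) \<Rightarrow> (real^'n \<Rightarrow> complex) \<Rightarrow> real^'n \<Rightarrow> complex" where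
  "tf_shift z g t = chr (snd z \<bullet> t) * g (t - fst z)"

text \<open>Here \<open>tf_shift z g\<close> is \<pi>_z g. Writing the transform as an inner product
  gives linearity and Cauchy-Schwarz at once.\<close>

definition stft :: "(real^'n \<Rightarrow> complex) \<Rightarrow> (real^'n \<Rightarrow> complex) \<Rightarrow> (real^'n) \<times> (real^'n) \<Rightarrow> complex" where
  "stft g f z = bip f (tf_shift z g)"

lemma tf_shift_measurable [measurable]:
  assumes [measurable]: "g \<in> borel_measurable borel"
    and [measurable]: "a \<in> M \<rightarrow>\<^sub>M borel" "b \<in> M \<rightarrow>\<^sub>M borel"
  shows "(\<lambda>p. tf_shift (a p) g (b p)) \<in> borel_measurable M"
  unfolding tf_shift_def by measurable

lemma tf_shift_borel_L2:
  assumes g: "g \<in> borel_L2"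
  shows "tf_shift z g \<in> borel_L2" "L2.qf (tf_shift z g) = L2.qf g"
proof -
  have "(\<lambda>t. g (t + - fst z)) \<in> borel_L2" by (rule borel_L2_translate[OF g])
  then have "(\<lambda>t. g (t - fst z)) \<in> borel_L2" by simp
  note u = borel_L2_unimodular[OF this, of "\<lambda>t. chr (snd z \<bullet> t)"]
  have "tf_shift z g = (\<lambda>t. chr (snd z \<bullet> t) * g (t - fst z))" by (simp add: tf_shift_def[abs_def])
  then show "tf_shift z g \<in> borel_L2" "L2.qf (tf_shift z g) = L2.qf g"
    using u qf_translate[OF g, of "- fst z"] by simp_all
qed

lemma stft_measurable [measurable]:
  assumes [measurable]: "g \<in> borel_measurable borel" "f \<in> borel_measurable borel"
  shows "stft g f \<in> borel_measurable borel"
  unfolding stft_def[abs_def] bip_def by measurable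

lemma gabor_transform_eq_stft:
  fixes f g :: "real^'n \<Rightarrow> complex"
  assumes [measurable]: "g \<in> borel_measurable borel" "f \<in> borel_measurable borel"
  shows "gabor_transform g f = stft g f"
proof
  fix z :: "(real^'n) \<times> (real^'n)"
  have eq: "f t * cnj (g (t - fst z)) * exp (- 2 * of_real pi * \<i> * of_real (snd z \<bullet> t)) = f t * cnj (tf_shift z g t)" for t
    by (simp add: tf_shift_def cnj_chr) (simp add: chr_def)
  show "gabor_transform g f z = stft g f z"
    unfolding gabor_transform_def stft_def bip_def case_prod_unfold eq
    by (rule integral_completion) measurable
qed

text \<open>For fixed x the transform as a function of \<xi> is the Fourier transform of f t cnj (g
  (t - x)), so Plancherel applies on each slice and Tonelli then separates f from g.\<close>

lemma nn_integral_stft: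
  assumes g: "g \<in> borel_L2" and f: "f \<in> borel_L2"
  shows "(\<integral>\<^sup>+z. ennreal ((cmod (stft g f z))\<^sup>2) \<partial>lborel) = ennreal (L2.qf f * L2.qf g)"
proof -
  have m[measurable]: "g \<in> borel_measurable borel" "f \<in> borel_measurable borel" using f g by measurable
  have mp[measurable]: "(\<lambda>z. ennreal ((cmod (stft g f z))\<^sup>2)) \<in> borel_measurable (lborel \<Otimes>\<^sub>M lborel)"
    unfolding lborel_prod by measurable
  define h where "h x t = f t * cnj (g (t - x))" for x t
  have hm[measurable]: "h x \<in> borel_measurable borel" for x unfolding h_def[abs_def] by measurable
  have fourier: "stft g f (x, \<xi>) = fourier (h x) \<xi>" for x \<xi>
    unfolding stft_def bip_def fourier_def h_def
    by (intro Bochner_Integration.integral_cong) (simp_all add: tf_shift_def cnj_chr mult_ac)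
  have gx: "(\<lambda>t. g (t - x)) \<in> borel_L2" for x
    using borel_L2_translate[OF g, of "- x"] by simp
  have hint: "integrable lborel (h x)" for x
    unfolding h_def by (rule borel_L2_integrable_mult[OF f gx])
  have eq: "ennreal ((cmod (h x t))\<^sup>2) = ennreal ((cmod (f t))\<^sup>2) * ennreal ((cmod (g (t - x)))\<^sup>2)" for x t
    by (simp add: h_def norm_mult power_mult_distrib ennreal_mult)
  have total: "(\<integral>\<^sup>+x. \<integral>\<^sup>+t. ennreal ((cmod (h x t))\<^sup>2) \<partial>lborel \<partial>lborel) = ennreal (L2.qf f * L2.qf g)"
  proof -
    have "(\<integral>\<^sup>+x. \<integral>\<^sup>+t. ennreal ((cmod (h x t))\<^sup>2) \<partial>lborel \<partial>lborel) =
        (\<integral>\<^sup>+t. \<integral>\<^sup>+x. ennreal ((cmod (f t))\<^sup>2) * ennreal ((cmod (g (t - x)))\<^sup>2) \<partial>lborel \<partial>lborel)"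
      unfolding eq by (rule lborel_pair.Fubini') measurable
    also have "\<dots> = (\<integral>\<^sup>+t. ennreal ((cmod (f t))\<^sup>2) * ennreal (L2.qf g) \<partial>lborel)"
    proof (rule nn_integral_cong)
      fix t
      \<comment> \<open>The reflection of x to t - x is affine with factor -1 and preserves the
        measure.\<close>
      have "(\<integral>\<^sup>+x. ennreal ((cmod (g (t - x)))\<^sup>2) \<partial>lborel) = (\<integral>\<^sup>+x. ennreal ((cmod (g x))\<^sup>2) \<partial>lborel)"
        using lborel_nn_integral_affine[of "\<lambda>x. ennreal ((cmod (g x))\<^sup>2)" "-1" t] by simp
      then show "(\<integral>\<^sup>+x. ennreal ((cmod (f t))\<^sup>2) * ennreal ((cmod (g (t - x)))\<^sup>2) \<partial>lborel) = ennreal ((cmod (f t))\<^sup>2) * ennreal (L2.qf g)"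
        by (simp add: nn_integral_cmult nn_integral_borel_L2 g)
    qed
    also have "\<dots> = ennreal (L2.qf f) * ennreal (L2.qf g)"
      by (simp add: nn_integral_multc nn_integral_borel_L2 f)
    finally show ?thesis by (simp add: ennreal_mult L2.ip_nonneg f g)
  qed
  \<comment> \<open>Each slice \<open>h x\<close> is integrable, but as a product of two L^2
    functions it is guaranteed to be square integrable only for almost every x.\<close>
  have "AE x in lborel. (\<integral>\<^sup>+t. ennreal ((cmod (h x t))\<^sup>2) \<partial>lborel) \<noteq> \<infinity>"
  proof (rule nn_integral_noteq_infinite)
    show "(\<lambda>x. \<integral>\<^sup>+t. ennreal ((cmod (h x t))\<^sup>2) \<partial>lborel) \<in> borel_measurable lborel"
      unfolding h_def by measurable
  qed (simp add: total)
  then have ae: "AE x in lborel. (\<integral>\<^sup>+\<xi>. ennreal ((cmod (stft g f (x, \<xi>)))\<^sup>2) \<partial>lborel) = (\<integral>\<^sup>+t. ennreal ((cmod (h x t))\<^sup>2) \<partial>lborel)"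
  proof eventually_elim
    case (elim x)
    then have hx: "h x \<in> borel_L2" by (intro borel_L2_I) (auto simp: top.not_eq_extremum)
    show ?case unfolding fourier Plancherel[OF hint hx] nn_integral_borel_L2[OF hx] ..
  qed
  have "(\<integral>\<^sup>+z. ennreal ((cmod (stft g f z))\<^sup>2) \<partial>lborel) = (\<integral>\<^sup>+x. \<integral>\<^sup>+\<xi>. ennreal ((cmod (stft g f (x, \<xi>)))\<^sup>2) \<partial>lborel \<partial>lborel)"
    unfolding lborel_prod[symmetric] by (rule lborel.nn_integral_fst[symmetric]) measurable
  also have "\<dots> = (\<integral>\<^sup>+x. \<integral>\<^sup>+t. ennreal ((cmod (h x t))\<^sup>2) \<partial>lborel \<partial>lborel)"
    by (rule nn_integral_cong_AE[OF ae])
  finally show ?thesis unfolding total .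
qed

lemma stft_borel_L2:
  assumes "g \<in> borel_L2" "f \<in> borel_L2"
  shows "stft g f \<in> borel_L2" "L2.qf (stft g f) = L2.qf f * L2.qf g"
proof -
  have m[measurable]: "g \<in> borel_measurable borel" "f \<in> borel_measurable borel" using assms by measurable
  show "stft g f \<in> borel_L2"
    by (rule borel_L2_I) (use nn_integral_stft[OF assms] in auto)
  then show "L2.qf (stft g f) = L2.qf f * L2.qf g"
    using nn_integral_borel_L2[of "stft g f"] nn_integral_stft[OF assms] assms
    by (simp add: L2.ip_nonneg)
qed

section \<open>The isometry for a normalized window\<close>

locale gabor_window =
  fixes g :: "real^'n \<Rightarrow> complex"
  assumes g: "g \<in> borel_L2" and g1: "L2.qf g = 1"
begin

lemma g_measurable [measurable]: "g \<in> borel_measurable borel"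
  using g by measurable

abbreviation "V \<equiv> stft g"

lemma V_mem: "f \<in> borel_L2 \<Longrightarrow> V f \<in> borel_L2"
  using stft_borel_L2[OF g] by simp

lemma V_comb:
  "f \<in> borel_L2 \<Longrightarrow> h \<in> borel_L2 \<Longrightarrow> V (\<lambda>t. c * f t + d * h t) = (\<lambda>z. c * V f z + d * V h z)"
  unfolding stft_def by (intro ext L2.ip_comb tf_shift_borel_L2 g)

lemma qf_V: "f \<in> borel_L2 \<Longrightarrow> L2.qf (V f) = L2.qf f"
  using stft_borel_L2[OF g] g1 by simp

text \<open>Polarization: the norm identity for f + h gives the real part of the inner product, and
  the same with - \<i> f in place of f gives the imaginary part.\<close>

lemma bip_V:
  assumes f: "f \<in> borel_L2" and h: "h \<in> borel_L2"
  shows "bip (V f) (V h) = bip f h"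
proof -
  have Re: "Re (bip (V f) (V h)) = Re (bip f h)" if f: "f \<in> borel_L2" for f
  proof -
    have "L2.qf (V (\<lambda>t. 1 * f t + 1 * h t)) = L2.qf (\<lambda>t. 1 * f t + 1 * h t)"
      by (intro qf_V L2.comb_mem f h)
    then have "L2.qf (\<lambda>z. V f z + V h z) = L2.qf (\<lambda>t. f t + h t)"
      unfolding V_comb[OF f h] by simp
    then show ?thesis
      by (simp add: L2.qf_add V_mem qf_V f h)
  qed
  have "Re (bip (V (\<lambda>t. - \<i> * f t)) (V h)) = Re (bip (\<lambda>t. - \<i> * f t) h)"
    by (intro Re L2.scale_mem f)
  moreover have "V (\<lambda>t. - \<i> * f t) = (\<lambda>z. - \<i> * V f z)"
    using V_comb[OF f f, of "- \<i>" 0] by simp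
  moreover have "bip (\<lambda>z. - \<i> * V f z) (V h) = - \<i> * bip (V f) (V h)" "bip (\<lambda>t. - \<i> * f t) h = - \<i> * bip f h"
    by (intro L2.ip_scale V_mem f h)+
  ultimately have "Im (bip (V f) (V h)) = Im (bip f h)" by simp
  with Re[OF f] show ?thesis by (simp add: complex_eq_iff)
qed

end

section \<open>The localized projection on a region\<close>

locale gabor_region = gabor_window g for g :: "real^'n \<Rightarrow> complex" +
  fixes A :: "((real^'n) \<times> (real^'n)) set"
  assumes A [measurable]: "A \<in> sets borel" and A_finite: "emeasure lborel A < \<infinity>"
begin

definition cut :: "((real^'n) \<times> (real^'n) \<Rightarrow> complex) \<Rightarrow> (real^'n) \<times> (real^'n) \<Rightarrow> complex" where
  "cut F w = indicator A w * F w"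

text \<open>The adjoint of V applied to D_A F, as a pointwise integral; where the integral does not
  converge, the value is the default 0.\<close>

definition synthesis :: "((real^'n) \<times> (real^'n) \<Rightarrow> complex) \<Rightarrow> real^'n \<Rightarrow> complex" where
  "synthesis F t = (\<integral>w. cut F w * tf_shift w g t \<partial>lborel)"

text \<open>As a function of w this is the reproducing kernel K_g(z, w) cut off to A.\<close>

definition ker :: "(real^'n) \<times> (real^'n) \<Rightarrow> (real^'n) \<times> (real^'n) \<Rightarrow> complex" where
  "ker z = cut (V (tf_shift z g))"

text \<open>In terms of the Gabor projection $P$, \<open>proj F\<close> is $P D_A F$, and not $P F$.\<close>

definition proj :: "((real^'n) \<times> (real^'n) \<Rightarrow> complex) \<Rightarrow> (real^'n) \<times> (real^'n) \<Rightarrow> complex" where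
  "proj F z = bip F (ker z)"

lemma cut_mem: "F \<in> borel_L2 \<Longrightarrow> cut F \<in> borel_L2"
  unfolding cut_def[abs_def] by (rule borel_L2_indicator) auto

lemma bip_cut: "bip (cut F) G = bip F (cut G)"
  unfolding bip_def cut_def by (intro Bochner_Integration.integral_cong) (auto simp: indicator_def)

lemma cut_measurable [measurable]: "F \<in> borel_measurable borel \<Longrightarrow> cut F \<in> borel_measurable borel"
  unfolding cut_def[abs_def] by measurable

lemma ker_mem: "ker z \<in> borel_L2"
  unfolding ker_def by (intro cut_mem V_mem tf_shift_borel_L2 g)

lemma A_finite': "emeasure lborel A = ennreal (measure lborel A)"
  using A_finite by (intro emeasure_eq_ennreal_measure) auto

text \<open>On a set of finite measure square integrability implies integrability, through |F| \<le>
  |F|^2 + 1.\<close>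

lemma nn_integral_cut:
  assumes F: "F \<in> borel_L2"
  shows "(\<integral>\<^sup>+w. ennreal (cmod (cut F w)) \<partial>lborel) < \<infinity>"
proof -
  have [measurable]: "F \<in> borel_measurable borel" using F by measurable
  have "(\<integral>\<^sup>+w. ennreal (cmod (cut F w)) \<partial>lborel) \<le> (\<integral>\<^sup>+w. ennreal ((cmod (F w))\<^sup>2) + indicator A w \<partial>lborel)"
  proof (rule nn_integral_mono)
    fix w
    have "cmod (F w) \<le> (cmod (F w))\<^sup>2 + 1"
      using zero_le_power2[of "cmod (F w) - 1"] norm_ge_zero[of "F w"] by (simp add: power2_diff del: norm_ge_zero)
    then have "ennreal (cmod (F w)) \<le> ennreal ((cmod (F w))\<^sup>2 + 1)" by (rule ennreal_leI)
    then show "ennreal (cmod (cut F w)) \<le> ennreal ((cmod (F w))\<^sup>2) + indicator A w"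
      by (simp add: cut_def indicator_def)
  qed
  also have "\<dots> = ennreal (L2.qf F) + emeasure lborel A"
    by (subst nn_integral_add) (simp_all add: nn_integral_borel_L2 F)
  also have "\<dots> < \<infinity>" using A_finite by simp
  finally show ?thesis .
qed

text \<open>Cauchy-Schwarz in w bounds the squared value at t by ||F||^2 times the integral of
  |\<pi>_w g(t)|^2 over w in A. Integrated over t this is |A| ||F||^2, because every \<pi>_w g has
  norm 1.\<close>

lemma synthesis_mem:
  assumes F: "F \<in> borel_L2"
  shows "synthesis F \<in> borel_L2"
proof (rule borel_L2_I)
  have [measurable]: "F \<in> borel_measurable borel" using F by measurable
  show "synthesis F \<in> borel_measurable borel"
    unfolding synthesis_def[abs_def] by measurable
  have pt: "ennreal ((cmod (synthesis F t))\<^sup>2) \<le> ennreal (L2.qf F) * (\<integral>\<^sup>+w. indicator A w * ennreal ((cmod (tf_shift w g t))\<^sup>2) \<partial>lborel)" for t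
  proof -
    have "ennreal (cmod (synthesis F t)) \<le> (\<integral>\<^sup>+w. ennreal (cmod (F w)) * (indicator A w * ennreal (cmod (tf_shift w g t))) \<partial>lborel)"
    proof (cases "integrable lborel (\<lambda>w. cut F w * tf_shift w g t)")
      case True
      have "ennreal (cmod (synthesis F t)) \<le> (\<integral>\<^sup>+w. ennreal (norm (cut F w * tf_shift w g t)) \<partial>lborel)"
        unfolding synthesis_def by (rule integral_norm_bound_ennreal[OF True])
      also have "\<dots> = (\<integral>\<^sup>+w. ennreal (cmod (F w)) * (indicator A w * ennreal (cmod (tf_shift w g t))) \<partial>lborel)"
        by (intro nn_integral_cong) (auto simp: cut_def norm_mult ennreal_mult indicator_def)
      finally show ?thesis .
    next
      \<comment> \<open>The value is then the default 0 and the bound is trivial.\<close>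
      case False
      then have "synthesis F t = 0" unfolding synthesis_def by (rule not_integrable_integral_eq)
      then show ?thesis by simp
    qed
    then have "(ennreal (cmod (synthesis F t)))\<^sup>2 \<le> (\<integral>\<^sup>+w. ennreal (cmod (F w)) * (indicator A w * ennreal (cmod (tf_shift w g t))) \<partial>lborel)\<^sup>2"
      by (intro power_mono) auto
    also have "\<dots> \<le> (\<integral>\<^sup>+w. (ennreal (cmod (F w)))\<^sup>2 \<partial>lborel) * (\<integral>\<^sup>+w. (indicator A w * ennreal (cmod (tf_shift w g t)))\<^sup>2 \<partial>lborel)"
      by (rule Cauchy_Schwarz_nn_integral) measurable
    also have "(\<integral>\<^sup>+w. (ennreal (cmod (F w)))\<^sup>2 \<partial>lborel) = ennreal (L2.qf F)"
      by (simp add: nn_integral_borel_L2[OF F, symmetric] ennreal_power)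
    also have "(\<integral>\<^sup>+w. (indicator A w * ennreal (cmod (tf_shift w g t)))\<^sup>2 \<partial>lborel) = (\<integral>\<^sup>+w. indicator A w * ennreal ((cmod (tf_shift w g t))\<^sup>2) \<partial>lborel)"
      by (intro nn_integral_cong) (auto simp: indicator_def ennreal_power)
    finally show ?thesis by (simp add: ennreal_power)
  qed
  have "(\<integral>\<^sup>+t. ennreal ((cmod (synthesis F t))\<^sup>2) \<partial>lborel) \<le>
     (\<integral>\<^sup>+t. ennreal (L2.qf F) * (\<integral>\<^sup>+w. indicator A w * ennreal ((cmod (tf_shift w g t))\<^sup>2) \<partial>lborel) \<partial>lborel)"
    by (intro nn_integral_mono pt)
  also have "\<dots> = ennreal (L2.qf F) * (\<integral>\<^sup>+t. \<integral>\<^sup>+w. indicator A w * ennreal ((cmod (tf_shift w g t))\<^sup>2) \<partial>lborel \<partial>lborel)"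
    by (rule nn_integral_cmult) measurable
  also have "(\<integral>\<^sup>+t. \<integral>\<^sup>+w. indicator A w * ennreal ((cmod (tf_shift w g t))\<^sup>2) \<partial>lborel \<partial>lborel) =
     (\<integral>\<^sup>+w. \<integral>\<^sup>+t. indicator A w * ennreal ((cmod (tf_shift w g t))\<^sup>2) \<partial>lborel \<partial>lborel)"
    by (rule lborel_pair.Fubini') measurable
  also have "\<dots> = (\<integral>\<^sup>+w. indicator A w \<partial>lborel)"
    using tf_shift_borel_L2[OF g] g1
    by (intro nn_integral_cong) (simp add: nn_integral_cmult nn_integral_borel_L2)
  also have "\<dots> = emeasure lborel A" by simp
  also have "ennreal (L2.qf F) * emeasure lborel A < \<infinity>"
    using A_finite by (simp add: ennreal_mult_less_top)
  finally show "(\<integral>\<^sup>+t. ennreal ((cmod (synthesis F t))\<^sup>2) \<partial>lborel) < \<infinity>" .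
qed

text \<open>Fubini applies because \<open>cut F\<close> is integrable and the integral of |\<pi>_w
  g| |h| is bounded uniformly in w.\<close>

lemma bip_synthesis:
  assumes F: "F \<in> borel_L2" and h: "h \<in> borel_L2"
  shows "bip (synthesis F) h = bip (cut F) (V h)"
proof -
  have m[measurable]: "F \<in> borel_measurable borel" "h \<in> borel_measurable borel" using F h by measurable
  have "bip (synthesis F) h = (\<integral>t. \<integral>w. cut F w * tf_shift w g t * cnj (h t) \<partial>lborel \<partial>lborel)"
    by (simp add: bip_def synthesis_def)
  also have "\<dots> = (\<integral>w. \<integral>t. cut F w * tf_shift w g t * cnj (h t) \<partial>lborel \<partial>lborel)"
  proof (rule lborel_Fubini(2)[symmetric])
    show "(\<lambda>(w, t). cut F w * tf_shift w g t * cnj (h t)) \<in> borel_measurable (borel \<Otimes>\<^sub>M borel)"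
      by measurable
    have "(\<integral>\<^sup>+t. ennreal (cmod (tf_shift w g t)) * ennreal (cmod (h t)) \<partial>lborel) \<le> ennreal (1 + L2.qf h)" for w
      using nn_integral_mult_borel_L2[OF tf_shift_borel_L2(1)[OF g] h, of w] by (simp only: tf_shift_borel_L2(2)[OF g] g1)
    then have "(\<integral>\<^sup>+w. \<integral>\<^sup>+t. ennreal (norm (cut F w * tf_shift w g t * cnj (h t))) \<partial>lborel \<partial>lborel) \<le>
      (\<integral>\<^sup>+w. ennreal (cmod (cut F w)) * ennreal (1 + L2.qf h) \<partial>lborel)"
      by (intro nn_integral_mono) (simp add: norm_mult ennreal_mult nn_integral_cmult mult.assoc mult_left_mono del: ennreal_plus)
    also have "\<dots> < \<infinity>" using nn_integral_cut[OF F] by (simp add: nn_integral_multc ennreal_mult_less_top)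
    finally show "(\<integral>\<^sup>+w. \<integral>\<^sup>+t. ennreal (norm (cut F w * tf_shift w g t * cnj (h t))) \<partial>lborel \<partial>lborel) < \<infinity>" .
  qed
  also have "\<dots> = (\<integral>w. cut F w * (\<integral>t. tf_shift w g t * cnj (h t) \<partial>lborel) \<partial>lborel)"
    by (simp add: mult.assoc)
  also have "\<dots> = bip (cut F) (V h)"
  proof -
    have "(\<integral>t. tf_shift w g t * cnj (h t) \<partial>lborel) = cnj (V h w)" for w
      using L2.ip_cnj[OF h tf_shift_borel_L2(1)[OF g], of w] by (simp add: stft_def bip_def)
    then show ?thesis by (simp add: bip_def[of "cut F"])
  qed
  finally show ?thesis .
qed

text \<open>Links the kernel formula with V and its adjoint, which places \<open>proj F\<close> in
  the range of V.\<close>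

lemma proj_eq: "F \<in> borel_L2 \<Longrightarrow> proj F = V (synthesis F)"
  unfolding proj_def[abs_def] ker_def stft_def[of g "synthesis F"]
  by (simp add: bip_synthesis tf_shift_borel_L2 g bip_cut fun_eq_iff stft_def[of g "synthesis F"])

lemma proj_mem: "F \<in> borel_L2 \<Longrightarrow> proj F \<in> borel_L2"
  by (simp add: proj_eq V_mem synthesis_mem)

text \<open>The characterizing property of the projection: D_A F - \<open>proj F\<close> is
  orthogonal to the range of V.\<close>

lemma bip_proj_V: "F \<in> borel_L2 \<Longrightarrow> h \<in> borel_L2 \<Longrightarrow> bip (proj F) (V h) = bip (cut F) (V h)"
  by (simp add: proj_eq bip_V synthesis_mem bip_synthesis)

lemma bip_proj_proj: "F \<in> borel_L2 \<Longrightarrow> G \<in> borel_L2 \<Longrightarrow> bip (proj F) (proj G) = bip (cut F) (proj G)"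
  using bip_proj_V[of F "synthesis G"] by (simp add: proj_eq[of G] synthesis_mem)

lemma proj_comb: "F \<in> borel_L2 \<Longrightarrow> G \<in> borel_L2 \<Longrightarrow> proj (\<lambda>z. c * F z + d * G z) = (\<lambda>z. c * proj F z + d * proj G z)"
  unfolding proj_def by (intro ext L2.ip_comb ker_mem)

lemma qf_cut_le: "F \<in> borel_L2 \<Longrightarrow> L2.qf (cut F) \<le> L2.qf F"
  unfolding qf_eq by (intro integral_mono borel_L2_integrable cut_mem) (auto simp: cut_def indicator_def)

text \<open>Since ||P D F||^2 = <D F, P D F>, Cauchy-Schwarz allows one factor ||P D F|| to be
  cancelled.\<close>

lemma qf_proj_le:
  assumes F: "F \<in> borel_L2"
  shows "L2.qf (proj F) \<le> L2.qf F"
proof -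
  have nn: "0 \<le> L2.qf (proj F)" by (intro L2.ip_nonneg proj_mem F)
  have "bip (proj F) (proj F) = of_real (L2.qf (proj F))" by (intro L2.ip_self proj_mem F)
  then have "(cmod (bip (proj F) (proj F)))\<^sup>2 = (L2.qf (proj F))\<^sup>2"
    by (metis norm_of_real power2_abs)
  moreover have "(cmod (bip (cut F) (proj F)))\<^sup>2 \<le> L2.qf (cut F) * L2.qf (proj F)"
    by (intro L2.Cauchy_Schwarz cut_mem proj_mem F)
  moreover have "bip (proj F) (proj F) = bip (cut F) (proj F)" by (intro bip_proj_proj F)
  ultimately have "L2.qf (proj F) * L2.qf (proj F) \<le> L2.qf (cut F) * L2.qf (proj F)"
    by (simp add: power2_eq_square)
  then have "L2.qf (proj F) \<le> L2.qf (cut F)"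
    using nn L2.ip_nonneg[OF cut_mem[OF F]] by (cases "L2.qf (proj F) = 0") auto
  with qf_cut_le[OF F] show ?thesis by simp
qed

text \<open>This is the form <T F, G> with T = D P D. Written through P D it inherits symmetry and
  positivity from the inner product.\<close>

sublocale D: dominated_form "borel_L2 :: ((real^'n) \<times> (real^'n) \<Rightarrow> complex) set" bip "\<lambda>F G. bip (proj F) (proj G)"
proof
  show "(\<lambda>z. 0) \<in> (borel_L2 :: ((real^'n) \<times> (real^'n) \<Rightarrow> complex) set)" by (rule L2.zero_mem)
next
  fix F G :: "(real^'n) \<times> (real^'n) \<Rightarrow> complex" and c d
  assume F: "F \<in> borel_L2" and G: "G \<in> borel_L2"
  show "(\<lambda>z. c * F z + d * G z) \<in> borel_L2" by (rule L2.comb_mem[OF F G])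
  show "bip (proj G) (proj F) = cnj (bip (proj F) (proj G))"
    by (rule L2.ip_cnj[OF proj_mem[OF F] proj_mem[OF G]])
next
  fix F G H :: "(real^'n) \<times> (real^'n) \<Rightarrow> complex" and c d
  assume "F \<in> borel_L2" "G \<in> borel_L2" "H \<in> borel_L2"
  then show "bip (proj (\<lambda>z. c * F z + d * G z)) (proj H) = c * bip (proj F) (proj H) + d * bip (proj G) (proj H)"
    by (simp add: proj_comb L2.ip_comb proj_mem)
next
  fix F :: "(real^'n) \<times> (real^'n) \<Rightarrow> complex"
  assume F: "F \<in> borel_L2"
  show "0 \<le> Re (bip (proj F) (proj F))" by (intro L2.ip_nonneg proj_mem F)
  show "Re (bip (proj F) (proj F)) \<le> Re (bip F F)" by (rule qf_proj_le[OF F])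
qed

end

section \<open>Counting orthonormal families with small defect\<close>

text \<open>Indicators of disjoint unit cubes along the diagonal. Existence keeps the set of traces
  nonempty whose supremum is taken later.\<close>

lemma orthonormal_family_exists:
  "\<exists>e. L2.orthonormal_family N (e :: nat \<Rightarrow> 'a::euclidean_space \<Rightarrow> complex)"
proof -
  define Q :: "nat \<Rightarrow> 'a set" where "Q i = box (real i *\<^sub>R One) (real (Suc i) *\<^sub>R One)" for i
  have meas: "emeasure lborel (Q i) = 1" for i
    unfolding Q_def by (subst emeasure_lborel_box) (auto simp: algebra_simps)
  have [measurable]: "Q i \<in> sets borel" for i by (simp add: Q_def)
  have disj: "Q i \<inter> Q j = {}" if "i \<noteq> j" for i j
  proof (rule ccontr)
    assume "Q i \<inter> Q j \<noteq> {}"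
    then obtain x where x: "x \<in> Q i" "x \<in> Q j" by auto
    define b :: 'a where "b = (SOME i. i \<in> Basis)"
    have b: "b \<in> Basis" unfolding b_def by (rule SOME_Basis)
    have "real i < x \<bullet> b" "x \<bullet> b < real (Suc i)" "real j < x \<bullet> b" "x \<bullet> b < real (Suc j)"
      using x b by (auto simp: Q_def box_def)
    then have "real i < real (Suc j)" "real j < real (Suc i)" by linarith+
    then show False using that by simp
  qed
  define e :: "nat \<Rightarrow> 'a \<Rightarrow> complex" where "e i = indicator (Q i)" for i
  have [measurable]: "e i \<in> borel_measurable borel" for i unfolding e_def by measurable
  have mem: "e i \<in> borel_L2" for i
  proof (rule borel_L2_I)
    have "(\<integral>\<^sup>+z. ennreal ((cmod (e i z))\<^sup>2) \<partial>lborel) = (\<integral>\<^sup>+z. indicator (Q i) z \<partial>lborel)"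
      by (intro nn_integral_cong) (simp add: e_def indicator_def)
    then show "(\<integral>\<^sup>+z. ennreal ((cmod (e i z))\<^sup>2) \<partial>lborel) < \<infinity>" by (simp add: meas)
  qed measurable
  have "bip (e i) (e j) = (if i = j then 1 else 0)" for i j
  proof (cases "i = j")
    case True
    have "bip (e i) (e i) = of_real (\<integral>z. indicator (Q i) z \<partial>lborel)"
      unfolding bip_self by (intro arg_cong[of _ _ of_real] Bochner_Integration.integral_cong) (auto simp: e_def indicator_def)
    then show ?thesis using True meas[of i] by (simp add: measure_def)
  next
    case False
    have zero: "e i z * cnj (e j z) = 0" for z using disj[OF False] by (auto simp: e_def indicator_def)
    have "bip (e i) (e j) = 0" unfolding bip_def zero by simp
    then show ?thesis using False by simp
  qed
  then have "L2.orthonormal_family N e" unfolding L2.orthonormal_family_def using mem by simp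
  then show ?thesis by (rule exI[of _ e])
qed

section \<open>Trace density, the bound for the count, and the construction of families\<close>

context gabor_region
begin

text \<open>The integral of |K_g(z, w)|^2 over w in A, which is the diagonal at z of the integral
  kernel of P D P.\<close>

definition mass :: "(real^'n) \<times> (real^'n) \<Rightarrow> real" where
  "mass z = L2.qf (ker z)"

definition leak :: real where
  "leak = (\<integral>z. indicator (- A) z * mass z \<partial>lborel)"

lemma mass_nonneg: "0 \<le> mass z"
  unfolding mass_def by (intro L2.ip_nonneg ker_mem)

lemma mass_le_1: "mass z \<le> 1"
  unfolding mass_def ker_def
  using qf_cut_le[OF V_mem[OF tf_shift_borel_L2(1)[OF g]], of z] tf_shift_borel_L2[OF g, of z] g1 by (simp add: qf_V)

lemma V_shift_measurable:
  "(\<lambda>p. V (tf_shift (fst p) g) (snd p)) \<in> borel_measurable (borel \<Otimes>\<^sub>M borel)"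
  unfolding stft_def bip_def by measurable

lemma V_shift_measurable' [measurable (raw)]:
  assumes [measurable]: "a \<in> M \<rightarrow>\<^sub>M borel" "b \<in> M \<rightarrow>\<^sub>M borel"
  shows "(\<lambda>p. V (tf_shift (a p) g) (b p)) \<in> borel_measurable M"
  using measurable_compose[of "\<lambda>p. (a p, b p)" M _ _ _, OF _ V_shift_measurable] by simp

text \<open>Hermitian symmetry of the kernel moves z into the argument of the transform, where the
  isometry can integrate it out.\<close>

lemma mass_eq: "ennreal (mass z) = (\<integral>\<^sup>+w. indicator A w * ennreal ((cmod (V (tf_shift w g) z))\<^sup>2) \<partial>lborel)"
proof -
  have "ennreal (mass z) = (\<integral>\<^sup>+w. ennreal ((cmod (ker z w))\<^sup>2) \<partial>lborel)"
    unfolding mass_def by (rule nn_integral_borel_L2[OF ker_mem, symmetric])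
  also have "\<dots> = (\<integral>\<^sup>+w. indicator A w * ennreal ((cmod (V (tf_shift w g) z))\<^sup>2) \<partial>lborel)"
  proof (rule nn_integral_cong)
    fix w
    have "cmod (V (tf_shift z g) w) = cmod (V (tf_shift w g) z)"
      unfolding stft_def by (subst L2.ip_cnj[OF tf_shift_borel_L2(1)[OF g] tf_shift_borel_L2(1)[OF g]]) simp
    then show "ennreal ((cmod (ker z w))\<^sup>2) = indicator A w * ennreal ((cmod (V (tf_shift w g) z))\<^sup>2)"
      by (simp add: ker_def cut_def indicator_def)
  qed
  finally show ?thesis .
qed

lemma mass_measurable [measurable]: "mass \<in> borel_measurable borel"
proof -
  have "(\<lambda>z. enn2real (\<integral>\<^sup>+w. indicator A w * ennreal ((cmod (V (tf_shift w g) z))\<^sup>2) \<partial>lborel)) \<in> borel_measurable borel"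
    by measurable
  then show ?thesis unfolding mass_eq[symmetric] by (simp add: mass_nonneg)
qed

lemma nn_integral_mass: "(\<integral>\<^sup>+z. ennreal (mass z) \<partial>lborel) = emeasure lborel A"
proof -
  have "(\<integral>\<^sup>+z. ennreal (mass z) \<partial>lborel) =
      (\<integral>\<^sup>+w. \<integral>\<^sup>+z. indicator A w * ennreal ((cmod (V (tf_shift w g) z))\<^sup>2) \<partial>lborel \<partial>lborel)"
    unfolding mass_eq by (rule lborel_pair.Fubini') measurable
  also have "\<dots> = (\<integral>\<^sup>+w. indicator A w \<partial>lborel)"
  proof (rule nn_integral_cong)
    fix w
    have [measurable]: "V (tf_shift w g) \<in> borel_measurable borel" by measurable
    have "(\<integral>\<^sup>+z. ennreal ((cmod (V (tf_shift w g) z))\<^sup>2) \<partial>lborel) = 1"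
      using nn_integral_stft[OF g tf_shift_borel_L2(1)[OF g], of w] tf_shift_borel_L2(2)[OF g, of w] g1 by simp
    then show "(\<integral>\<^sup>+z. indicator A w * ennreal ((cmod (V (tf_shift w g) z))\<^sup>2) \<partial>lborel) = indicator A w"
      by (subst nn_integral_cmult) auto
  qed
  finally show ?thesis by simp
qed

lemma integrable_mass: "integrable lborel mass"
  using nn_integral_mass A_finite mass_nonneg by (simp add: integrable_iff_bounded)

lemma integral_mass: "(\<integral>z. mass z \<partial>lborel) = measure lborel A"
  using nn_integral_mass mass_nonneg by (subst integral_eq_nn_integral) (auto simp: measure_def)

text \<open>The bound 2 covers the weights that occur: 1, indicators, and 1 plus the indicator of
  the complement of A.\<close>

lemma integrable_weighted_mass:
  assumes [measurable]: "c \<in> borel_measurable borel" and c: "\<And>z. 0 \<le> c z" "\<And>z. c z \<le> 2"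
  shows "integrable lborel (\<lambda>z. c z * mass z)"
  by (rule Bochner_Integration.integrable_bound[OF integrable_mult_right[OF integrable_mass, of 2]])
    (use c mass_nonneg in \<open>auto simp: abs_mult intro!: mult_right_mono\<close>)

lemma leak_nonneg: "0 \<le> leak"
  unfolding leak_def by (intro integral_nonneg_AE AE_I2) (simp add: mass_nonneg)

lemma integral_mass_inside: "(\<integral>z. indicator A z * mass z \<partial>lborel) = measure lborel A - leak"
proof -
  have "(\<integral>z. mass z \<partial>lborel) = (\<integral>z. indicator A z * mass z + indicator (- A) z * mass z \<partial>lborel)"
    by (intro Bochner_Integration.integral_cong) (auto simp: indicator_def)
  also have "\<dots> = (\<integral>z. indicator A z * mass z \<partial>lborel) + leak"
    unfolding leak_def by (intro Bochner_Integration.integral_add integrable_weighted_mass) (auto simp: indicator_def)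
  finally show ?thesis by (simp add: integral_mass)
qed

lemma integrable_proj_sq:
  assumes F: "F \<in> borel_L2" and [measurable]: "c \<in> borel_measurable borel" and c: "\<And>z. 0 \<le> c z" "\<And>z. c z \<le> 2"
  shows "integrable lborel (\<lambda>z. c z * (cmod (proj F z))\<^sup>2)"
proof -
  have [measurable]: "proj F \<in> borel_measurable borel" using proj_mem[OF F] by measurable
  show ?thesis
    by (rule Bochner_Integration.integrable_bound[OF integrable_mult_right[OF borel_L2_integrable[OF proj_mem[OF F]], of 2]])
      (use c in \<open>auto simp: abs_mult intro!: mult_right_mono\<close>)
qed

text \<open>At each point z the values of P D e_i are, up to conjugation, the coefficients of
  \<open>ker z\<close> in the family, so Bessel bounds the sum of their squares by
  \<open>mass z\<close>.\<close>

lemma weighted_trace_le: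
  assumes I: "finite I" and e: "\<And>i. i \<in> I \<Longrightarrow> e i \<in> borel_L2"
    and on: "\<And>i j. i \<in> I \<Longrightarrow> j \<in> I \<Longrightarrow> bip (e i) (e j) = (if i = j then 1 else 0)"
    and cm[measurable]: "c \<in> borel_measurable borel" and c: "\<And>z. 0 \<le> c z" "\<And>z. c z \<le> 2"
  shows "(\<Sum>i\<in>I. \<integral>z. c z * (cmod (proj (e i) z))\<^sup>2 \<partial>lborel) \<le> (\<integral>z. c z * mass z \<partial>lborel)"
proof -
  have "(\<Sum>i\<in>I. \<integral>z. c z * (cmod (proj (e i) z))\<^sup>2 \<partial>lborel) = (\<integral>z. (\<Sum>i\<in>I. c z * (cmod (proj (e i) z))\<^sup>2) \<partial>lborel)"
    by (intro Bochner_Integration.integral_sum[symmetric] integrable_proj_sq e cm c)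
  also have "\<dots> \<le> (\<integral>z. c z * mass z \<partial>lborel)"
  proof (intro integral_mono Bochner_Integration.integrable_sum integrable_proj_sq integrable_weighted_mass e cm c)
    fix z
    have "(\<Sum>i\<in>I. (cmod (bip (ker z) (e i)))\<^sup>2) \<le> mass z"
      unfolding mass_def by (rule L2.Bessel[OF I e on ker_mem])
    moreover have "cmod (bip (ker z) (e i)) = cmod (proj (e i) z)" if "i \<in> I" for i
      unfolding proj_def by (subst L2.ip_cnj[OF e[OF that] ker_mem]) simp
    ultimately have "(\<Sum>i\<in>I. (cmod (proj (e i) z))\<^sup>2) \<le> mass z" by simp
    then show "(\<Sum>i\<in>I. c z * (cmod (proj (e i) z))\<^sup>2) \<le> c z * mass z"
      using c(1)[of z] by (simp add: sum_distrib_left[symmetric] mult_left_mono)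
  qed
  finally show ?thesis .
qed

definition loss :: "((real^'n) \<times> (real^'n) \<Rightarrow> complex) \<Rightarrow> real" where
  "loss F = (\<integral>z. indicator (- A) z * (cmod (proj F z))\<^sup>2 \<partial>lborel)"

lemma loss_nonneg: "0 \<le> loss F"
  unfolding loss_def by (intro integral_nonneg_AE AE_I2) simp

text \<open>The cross term <D P D F, F> is <P D F, D F> = ||P D F||^2, and ||D P D F||^2 is ||P D
  F||^2 without its part outside A.\<close>

lemma defect_eq:
  assumes F: "F \<in> borel_L2"
  shows "L2.qf (\<lambda>z. cut (proj F) z - F z) = L2.qf F - L2.qf (proj F) - loss F"
proof -
  have "L2.qf (\<lambda>z. cut (proj F) z - F z) = L2.qf (cut (proj F)) - 2 * Re (bip (cut (proj F)) F) + L2.qf F"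
    by (intro L2.qf_diff cut_mem proj_mem F)
  moreover have "Re (bip (cut (proj F)) F) = L2.qf (proj F)"
  proof -
    have "bip (cut (proj F)) F = bip (proj F) (cut F)" by (rule bip_cut)
    also have "\<dots> = cnj (bip (cut F) (proj F))" by (intro L2.ip_cnj cut_mem proj_mem F)
    finally show ?thesis by (simp add: bip_proj_proj[OF F F, symmetric])
  qed
  moreover have "L2.qf (proj F) = L2.qf (cut (proj F)) + loss F"
  proof -
    have "L2.qf (proj F) = (\<integral>z. (cmod (cut (proj F) z))\<^sup>2 + indicator (- A) z * (cmod (proj F z))\<^sup>2 \<partial>lborel)"
      unfolding qf_eq by (intro Bochner_Integration.integral_cong) (auto simp: indicator_def cut_def)
    also have "\<dots> = L2.qf (cut (proj F)) + loss F"
      unfolding qf_eq loss_def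
      by (intro Bochner_Integration.integral_add borel_L2_integrable cut_mem proj_mem integrable_proj_sq F) (auto simp: indicator_def)
    finally show ?thesis .
  qed
  ultimately show ?thesis by simp
qed

lemma trace_le:
  assumes "L2.orthonormal_family N e"
  shows "(\<Sum>i<N. L2.qf (proj (e i))) \<le> measure lborel A"
proof -
  have "(\<Sum>i<N. \<integral>z. 1 * (cmod (proj (e i) z))\<^sup>2 \<partial>lborel) \<le> (\<integral>z. 1 * mass z \<partial>lborel)"
    by (rule weighted_trace_le) (use assms in \<open>auto simp: L2.orthonormal_family_def\<close>)
  then show ?thesis by (simp add: qf_eq integral_mass)
qed

text \<open>The two terms of \<open>defect_eq\<close> merge into one integral with weight 1 plus the
  indicator of the complement. The leak is added to |A| because energy of P D F outside A also
  lowers the defect.\<close>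

lemma card_le_of_small_defect:
  assumes I: "finite I" and e: "\<And>i. i \<in> I \<Longrightarrow> e i \<in> borel_L2"
    and on: "\<And>i j. i \<in> I \<Longrightarrow> j \<in> I \<Longrightarrow> bip (e i) (e j) = (if i = j then 1 else 0)"
    and small: "\<And>i. i \<in> I \<Longrightarrow> L2.qf (\<lambda>z. cut (proj (e i)) z - e i z) \<le> \<epsilon>"
  shows "real (card I) * (1 - \<epsilon>) \<le> measure lborel A + leak"
proof -
  have "real (card I) * (1 - \<epsilon>) = (\<Sum>i\<in>I. 1 - \<epsilon>)" by simp
  also have "\<dots> \<le> (\<Sum>i\<in>I. L2.qf (proj (e i)) + loss (e i))"
    using small defect_eq[OF e] on by (intro sum_mono) fastforce
  also have "\<dots> = (\<Sum>i\<in>I. \<integral>z. (1 + indicator (- A) z) * (cmod (proj (e i) z))\<^sup>2 \<partial>lborel)"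
  proof (intro sum.cong refl)
    fix i assume i: "i \<in> I"
    have "(\<integral>z. (1 + indicator (- A) z) * (cmod (proj (e i) z))\<^sup>2 \<partial>lborel) =
       (\<integral>z. (cmod (proj (e i) z))\<^sup>2 + indicator (- A) z * (cmod (proj (e i) z))\<^sup>2 \<partial>lborel)"
      by (simp add: distrib_right)
    also have "\<dots> = L2.qf (proj (e i)) + loss (e i)"
      unfolding qf_eq loss_def
      by (intro Bochner_Integration.integral_add borel_L2_integrable proj_mem integrable_proj_sq e i) (auto simp: indicator_def)
    finally show "L2.qf (proj (e i)) + loss (e i) = (\<integral>z. (1 + indicator (- A) z) * (cmod (proj (e i) z))\<^sup>2 \<partial>lborel)" ..
  qed
  also have "\<dots> \<le> (\<integral>z. (1 + indicator (- A) z) * mass z \<partial>lborel)"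
    by (intro weighted_trace_le I e on) (auto simp: indicator_def)
  also have "\<dots> = (\<integral>z. mass z + indicator (- A) z * mass z \<partial>lborel)"
    by (simp add: distrib_right)
  also have "\<dots> = measure lborel A + leak"
    unfolding leak_def integral_mass[symmetric]
    by (intro Bochner_Integration.integral_add integrable_mass integrable_weighted_mass) (auto simp: indicator_def)
  finally show ?thesis .
qed

text \<open>Pairing P D (\<open>ker z\<close>) with the unit vector V (\<pi>_z g) removes the
  projection and leaves the mass itself. So where the mass is near 1, the form almost exhausts the
  norm of the kernel.\<close>

lemma mass_sq_le: "(mass z)\<^sup>2 \<le> L2.qf (proj (ker z))"
proof -
  define v where "v = V (tf_shift z g)"
  have v: "v \<in> borel_L2" unfolding v_def by (intro V_mem tf_shift_borel_L2 g)
  have qv: "L2.qf v = 1" unfolding v_def using tf_shift_borel_L2[OF g, of z] g1 by (simp add: qf_V)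
  have "bip (proj (ker z)) v = bip (cut (ker z)) v"
    unfolding v_def by (intro bip_proj_V ker_mem tf_shift_borel_L2 g)
  also have "\<dots> = bip (ker z) (ker z)" unfolding bip_cut by (simp add: ker_def v_def)
  also have "\<dots> = of_real (mass z)" unfolding mass_def by (rule L2.ip_self[OF ker_mem])
  finally have "(cmod (bip (proj (ker z)) v))\<^sup>2 = (mass z)\<^sup>2" by simp
  with L2.Cauchy_Schwarz[OF proj_mem[OF ker_mem] v, of z] show ?thesis by (simp add: qv)
qed

text \<open>\<open>near_eigenspace\<close> is applied to \<open>ker z\<close> and integrated over z
  in A. The left side becomes 1 - \<theta> times the trace that the family misses, and on the right
  the integral of 1 - mass over A is exactly the leak.\<close>

lemma large_trace_family:
  assumes N: "0 < N" and \<theta>: "measure lborel A / real N < \<theta>" "\<theta> < 1" and \<sigma>: "0 < \<sigma>"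
  shows "\<exists>e. L2.orthonormal_family N e \<and>
    (1 - \<theta>) * (measure lborel A - leak - (\<Sum>i<N. L2.qf (proj (e i)))) \<le> leak + \<sigma>"
proof -
  define \<alpha> where "\<alpha> = measure lborel A"
  have \<alpha>: "0 \<le> \<alpha>" by (simp add: \<alpha>_def)
  \<comment> \<open>Integrated over A, the error 4 N \<tau> contributes 4 N \<tau> \<alpha> \<le>
    \<sigma>; adding 1 covers \<alpha> = 0.\<close>
  define \<tau> where "\<tau> = \<sigma> / (4 * real N * (\<alpha> + 1))"
  have \<tau>: "0 < \<tau>" using \<sigma> N \<alpha> by (simp add: \<tau>_def)
  \<comment> \<open>The three bounds serve the hypothesis \<kappa> \<le> 1 of the near-maximality
    argument, the inequality mean + \<kappa> \<le> \<theta>, and sqrt \<kappa> \<le> \<tau>.\<close>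
  define \<kappa> where "\<kappa> = min 1 (min (\<theta> - \<alpha> / real N) (\<tau>\<^sup>2))"
  have \<kappa>: "0 < \<kappa>" "\<kappa> \<le> 1" "\<kappa> \<le> \<theta> - \<alpha> / real N" "\<kappa> \<le> \<tau>\<^sup>2"
    using \<theta> \<tau> by (auto simp: \<kappa>_def \<alpha>_def)
  have sqrt\<kappa>: "sqrt \<kappa> \<le> \<tau>" using \<kappa>(4) \<tau> by (intro real_le_lsqrt) auto
  define T where "T = (\<lambda>e. \<Sum>i<N. L2.qf (proj (e i))) ` {e. L2.orthonormal_family N e}"
  have "T \<noteq> {}" unfolding T_def using orthonormal_family_exists by auto
  moreover have bdd: "bdd_above T" unfolding T_def using trace_le by (intro bdd_aboveI2[where M=\<alpha>]) (simp add: \<alpha>_def)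
  ultimately obtain e where e: "L2.orthonormal_family N e" and sup: "Sup T - \<kappa> < (\<Sum>i<N. L2.qf (proj (e i)))"
    using less_cSup_iff[of T "Sup T - \<kappa>"] \<kappa>(1) by (auto simp: T_def)
  have near: "(\<Sum>i<N. L2.qf (proj (f i))) \<le> (\<Sum>i<N. L2.qf (proj (e i))) + \<kappa>" if "L2.orthonormal_family N f" for f
  proof -
    have "(\<Sum>i<N. L2.qf (proj (f i))) \<le> Sup T"
      using that by (intro cSup_upper bdd) (auto simp: T_def)
    with sup show ?thesis by simp
  qed
  have mem: "e i \<in> borel_L2" if "i < N" for i using e that by (simp add: L2.orthonormal_family_def)
  have le\<theta>: "(\<Sum>i<N. L2.qf (proj (e i))) + real N * \<kappa> \<le> real N * \<theta>"
  proof -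
    have "(\<Sum>i<N. L2.qf (proj (e i))) + real N * \<kappa> \<le> \<alpha> + real N * (\<theta> - \<alpha> / real N)"
      using trace_le[OF e] \<kappa>(3) by (intro add_mono mult_left_mono) (auto simp: \<alpha>_def)
    also have "\<dots> = real N * \<theta>" using N by (simp add: field_simps)
    finally show ?thesis .
  qed
  have pt: "(1 - \<theta>) * (mass z - (\<Sum>i<N. (cmod (proj (e i) z))\<^sup>2)) \<le> 1 - mass z + 4 * real N * \<tau>" for z
  proof -
    have "(1 - \<theta>) * (mass z - (\<Sum>i<N. (cmod (bip (ker z) (e i)))\<^sup>2)) \<le> mass z - L2.qf (proj (ker z)) + 4 * real N * sqrt \<kappa>"
      unfolding mass_def
      by (rule D.near_eigenspace[OF e \<kappa>(1,2) near ker_mem mass_le_1[unfolded mass_def] le\<theta> N])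
    moreover have "cmod (bip (ker z) (e i)) = cmod (proj (e i) z)" if "i < N" for i
      unfolding proj_def by (subst L2.ip_cnj[OF mem[OF that] ker_mem]) simp
    \<comment> \<open>m - m^2 \<le> 1 - m holds for every real m, by (1 - m)^2 \<ge> 0.\<close>
    moreover have "mass z - L2.qf (proj (ker z)) \<le> 1 - mass z"
      using mass_sq_le[of z] zero_le_power2[of "1 - mass z"] by (simp add: power2_diff)
    moreover have "4 * real N * sqrt \<kappa> \<le> 4 * real N * \<tau>" using sqrt\<kappa> by (simp add: mult_left_mono)
    ultimately show ?thesis by simp
  qed
  have intA: "integrable lborel (\<lambda>z. indicator A z * c)" for c :: real
    using A_finite by (intro integrable_mult_left integrable_real_indicator) auto
  have int1: "integrable lborel (\<lambda>z. indicator A z * mass z)"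
    by (intro integrable_weighted_mass) (auto simp: indicator_def)
  have int2: "integrable lborel (\<lambda>z. indicator A z * (cmod (proj (e i) z))\<^sup>2)" if "i < N" for i
    by (intro integrable_proj_sq mem that) (auto simp: indicator_def)
  \<comment> \<open>The integration is confined to A, as 1 - mass is not integrable over the whole
    space.\<close>
  have h1: "(\<integral>z. (1 - \<theta>) * (indicator A z * mass z - (\<Sum>i<N. indicator A z * (cmod (proj (e i) z))\<^sup>2)) \<partial>lborel)
     \<le> (\<integral>z. indicator A z * (1 + 4 * real N * \<tau>) - indicator A z * mass z \<partial>lborel)"
  proof (intro integral_mono)
    show "integrable lborel (\<lambda>z. (1 - \<theta>) * (indicator A z * mass z - (\<Sum>i<N. indicator A z * (cmod (proj (e i) z))\<^sup>2)))"
      using int1 int2 by (intro integrable_mult_right Bochner_Integration.integrable_diff Bochner_Integration.integrable_sum) auto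
    show "integrable lborel (\<lambda>z. indicator A z * (1 + 4 * real N * \<tau>) - indicator A z * mass z)"
      by (intro Bochner_Integration.integrable_diff intA int1)
    show "(1 - \<theta>) * (indicator A z * mass z - (\<Sum>i<N. indicator A z * (cmod (proj (e i) z))\<^sup>2))
       \<le> indicator A z * (1 + 4 * real N * \<tau>) - indicator A z * mass z" for z
      using pt[of z] by (cases "z \<in> A") (simp_all add: algebra_simps)
  qed
  have h2: "(\<integral>z. (1 - \<theta>) * (indicator A z * mass z - (\<Sum>i<N. indicator A z * (cmod (proj (e i) z))\<^sup>2)) \<partial>lborel)
     = (1 - \<theta>) * (\<alpha> - leak - (\<Sum>i<N. \<integral>z. indicator A z * (cmod (proj (e i) z))\<^sup>2 \<partial>lborel))"
  proof -
    have "(\<integral>z. indicator A z * mass z - (\<Sum>i<N. indicator A z * (cmod (proj (e i) z))\<^sup>2) \<partial>lborel) =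
      (\<integral>z. indicator A z * mass z \<partial>lborel) - (\<integral>z. (\<Sum>i<N. indicator A z * (cmod (proj (e i) z))\<^sup>2) \<partial>lborel)"
      using int1 int2 by (intro Bochner_Integration.integral_diff Bochner_Integration.integrable_sum) auto
    also have "(\<integral>z. (\<Sum>i<N. indicator A z * (cmod (proj (e i) z))\<^sup>2) \<partial>lborel) =
        (\<Sum>i<N. \<integral>z. indicator A z * (cmod (proj (e i) z))\<^sup>2 \<partial>lborel)"
      using int2 by (intro Bochner_Integration.integral_sum) auto
    finally show ?thesis unfolding integral_mass_inside \<alpha>_def by (subst integral_mult_right_zero) simp
  qed
  have h3: "(\<integral>z. indicator A z * (1 + 4 * real N * \<tau>) - indicator A z * mass z \<partial>lborel) = leak + 4 * real N * \<tau> * \<alpha>"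
  proof -
    have "(\<integral>z. indicator A z * (1 + 4 * real N * \<tau>) - indicator A z * mass z \<partial>lborel) =
      (\<integral>z. indicator A z * (1 + 4 * real N * \<tau>) \<partial>lborel) - (\<integral>z. indicator A z * mass z \<partial>lborel)"
      by (intro Bochner_Integration.integral_diff intA int1)
    also have "\<dots> = \<alpha> * (1 + 4 * real N * \<tau>) - (\<alpha> - leak)"
      unfolding integral_mass_inside \<alpha>_def by (subst integral_mult_left_zero) simp
    finally show ?thesis by (simp add: algebra_simps)
  qed
  have h4: "4 * real N * \<tau> * \<alpha> \<le> \<sigma>"
  proof -
    have "4 * real N * \<tau> * \<alpha> = \<sigma> * (\<alpha> / (\<alpha> + 1))" using N \<alpha> by (simp add: \<tau>_def)
    also have "\<dots> \<le> \<sigma> * 1" using \<sigma> \<alpha> by (intro mult_left_mono) (auto simp: divide_le_eq)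
    finally show ?thesis by simp
  qed
  have "(\<Sum>i<N. \<integral>z. indicator A z * (cmod (proj (e i) z))\<^sup>2 \<partial>lborel) \<le> (\<Sum>i<N. L2.qf (proj (e i)))"
    unfolding qf_eq using int2
    by (intro sum_mono integral_mono borel_L2_integrable proj_mem mem) (auto simp: indicator_def)
  then have h5: "(1 - \<theta>) * (\<alpha> - leak - (\<Sum>i<N. L2.qf (proj (e i)))) \<le>
     (1 - \<theta>) * (\<alpha> - leak - (\<Sum>i<N. \<integral>z. indicator A z * (cmod (proj (e i) z))\<^sup>2 \<partial>lborel))"
    using \<theta> by (intro mult_left_mono) auto
  have "(1 - \<theta>) * (\<alpha> - leak - (\<Sum>i<N. L2.qf (proj (e i)))) \<le> leak + \<sigma>"
    using h5 h1[unfolded h2 h3] h4 by linarith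
  with e show ?thesis by (auto simp: \<alpha>_def)
qed

text \<open>The inequality \<open>le\<close> keeps the trace of the family at N (1 - \<epsilon>) or
  more, so the diagonal can be levelled at height 1 - \<epsilon>. The loss outside A can only
  decrease the defect further.\<close>

lemma small_defect_family:
  assumes N: "0 < N" and \<theta>: "measure lborel A / real N < \<theta>" "\<theta> < 1"
    and le: "real N * (1 - \<epsilon>) + (leak + \<sigma>) / (1 - \<theta>) \<le> measure lborel A - leak" and \<sigma>: "0 < \<sigma>"
  shows "\<exists>f. L2.orthonormal_family N f \<and> (\<forall>i<N. L2.qf (\<lambda>z. cut (proj (f i)) z - f i z) \<le> \<epsilon>)"
proof -
  obtain e where e: "L2.orthonormal_family N e"
    and tr: "(1 - \<theta>) * (measure lborel A - leak - (\<Sum>i<N. L2.qf (proj (e i)))) \<le> leak + \<sigma>"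
    using large_trace_family[OF N \<theta> \<sigma>] by blast
  have "measure lborel A - leak - (\<Sum>i<N. L2.qf (proj (e i))) \<le> (leak + \<sigma>) / (1 - \<theta>)"
    using tr \<theta> by (simp add: field_simps)
  then have "real N * (1 - \<epsilon>) \<le> (\<Sum>i<N. L2.qf (proj (e i)))" using le by simp
  from D.equalize_diagonal[OF e this] obtain f where f: "L2.orthonormal_family N f"
    and f2: "\<And>i. i < N \<Longrightarrow> 1 - \<epsilon> \<le> L2.qf (proj (f i))" by blast
  have "L2.qf (\<lambda>z. cut (proj (f i)) z - f i z) \<le> \<epsilon>" if "i < N" for i
  proof -
    have m: "f i \<in> borel_L2" "L2.qf (f i) = 1" using f that by (auto simp: L2.orthonormal_family_def)
    show ?thesis unfolding defect_eq[OF m(1)] using f2[OF that] m(2) loss_nonneg[of "f i"] by simp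
  qed
  with f show ?thesis by blast
qed

end

section \<open>Passing from Lebesgue to Borel measurable functions\<close>

text \<open>Completeness of Lebesgue measure: the preimages differ from Borel sets by null
  sets.\<close>

lemma AE_eq_lebesgue_measurable:
  fixes f f' :: "'a::euclidean_space \<Rightarrow> 'b::topological_space"
  assumes f': "f' \<in> borel_measurable borel" and ae: "AE x in lborel. f x = f' x"
  shows "f \<in> borel_measurable lebesgue"
proof (rule measurableI)
  fix S :: "'b set" assume S: "S \<in> sets borel"
  have "f' -` S \<in> sets borel" using measurable_sets[OF f' S] by simp
  then have 1: "f' -` S \<in> sets lebesgue" by simp
  have "AE x in lebesgue. f x = f' x" using ae by (rule AE_completion)
  then have "AE x in lebesgue. x \<in> f' -` S \<longleftrightarrow> x \<in> f -` S" by eventually_elim simp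
  from completion.in_sets_AE[OF this 1] show "f -` S \<inter> space lebesgue \<in> sets lebesgue" by simp
qed simp

lemma lebesgue_integral_AE_borel:
  fixes f f' :: "'a::euclidean_space \<Rightarrow> 'b::{banach, second_countable_topology}"
  assumes f': "f' \<in> borel_measurable borel" and ae: "AE x in lborel. f x = f' x"
  shows "(\<integral>x. f x \<partial>lebesgue) = (\<integral>x. f' x \<partial>lborel)"
proof -
  have "(\<integral>x. f x \<partial>lebesgue) = (\<integral>x. f' x \<partial>lebesgue)"
    using f' by (intro integral_cong_AE AE_eq_lebesgue_measurable[OF f' ae] AE_completion[OF ae]) (simp add: measurable_completion)
  also have "\<dots> = (\<integral>x. f' x \<partial>lborel)" using f' by (intro integral_completion) simp
  finally show ?thesis .
qed

lemma L2_fun_borel_version: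
  assumes F: "F \<in> L2_fun"
  obtains F' where "F' \<in> borel_L2" "AE z in lborel. F z = F' z"
proof -
  have m: "F \<in> borel_measurable lebesgue" and int: "integrable lebesgue (\<lambda>z. (cmod (F z))\<^sup>2)"
    using F by (auto simp: L2_fun_def)
  obtain R where R: "R \<in> borel_measurable lborel" "AE z in lborel. Re (F z) = R z"
    using completion_ex_borel_measurable_real[of "\<lambda>z. Re (F z)" lborel] m by auto
  obtain I where I: "I \<in> borel_measurable lborel" "AE z in lborel. Im (F z) = I z"
    using completion_ex_borel_measurable_real[of "\<lambda>z. Im (F z)" lborel] m by auto
  define F' where "F' z = Complex (R z) (I z)" for z
  have [measurable]: "R \<in> borel_measurable borel" "I \<in> borel_measurable borel" using R I by simp_all
  have "F' = (\<lambda>z. of_real (R z) + \<i> * of_real (I z))" by (simp add: F'_def fun_eq_iff Complex_eq)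
  then have [measurable]: "F' \<in> borel_measurable borel" by simp
  have ae: "AE z in lborel. F z = F' z"
    using R(2) I(2) by eventually_elim (simp add: F'_def complex_eq_iff)
  have "integrable lebesgue (\<lambda>z. (cmod (F' z))\<^sup>2)"
  proof (rule integrable_cong_AE_imp[OF int])
    show "(\<lambda>z. (cmod (F' z))\<^sup>2) \<in> borel_measurable lebesgue" by (rule measurable_completion) measurable
    show "AE z in lebesgue. (cmod (F z))\<^sup>2 = (cmod (F' z))\<^sup>2"
      using AE_completion[OF ae] by eventually_elim simp
  qed
  then have "integrable lborel (\<lambda>z. (cmod (F' z))\<^sup>2)"
    by (subst (asm) integrable_completion) auto
  then have "F' \<in> borel_L2" by (simp add: borel_L2_def)
  with ae show ?thesis using that by blast
qed

lemma borel_L2_subset: "borel_L2 \<subseteq> L2_fun"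
  by (auto simp: borel_L2_def L2_fun_def integrable_completion intro: measurable_completion)

lemma L2_ip_eq_bip:
  assumes "F' \<in> borel_measurable borel" "AE z in lborel. F z = F' z"
    and "G' \<in> borel_measurable borel" "AE z in lborel. G z = G' z"
  shows "L2_ip F G = bip F' G'"
  unfolding L2_ip_def bip_def
proof (rule lebesgue_integral_AE_borel)
  show "(\<lambda>z. F' z * cnj (G' z)) \<in> borel_measurable borel" using assms by measurable
  show "AE z in lborel. F z * cnj (G z) = F' z * cnj (G' z)"
    using assms(2,4) by eventually_elim simp
qed

lemma L2_nrm_eq:
  assumes "F' \<in> borel_measurable borel" "AE z in lborel. F z = F' z"
  shows "(L2_nrm F)\<^sup>2 = L2.qf F'"
proof -
  have "(\<integral>z. (cmod (F z))\<^sup>2 \<partial>lebesgue) = L2.qf F'"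
    unfolding qf_eq
  proof (rule lebesgue_integral_AE_borel)
    show "(\<lambda>z. (cmod (F' z))\<^sup>2) \<in> borel_measurable borel" using assms by measurable
    show "AE z in lborel. (cmod (F z))\<^sup>2 = (cmod (F' z))\<^sup>2"
      using assms(2) by eventually_elim simp
  qed
  moreover have "0 \<le> L2.qf F'" unfolding qf_eq by simp
  ultimately show ?thesis by (simp add: L2_nrm_def)
qed

lemma AE_lborel_translate:
  fixes P :: "'a::euclidean_space \<Rightarrow> bool"
  assumes "AE t in lborel. P t"
  shows "AE t in lborel. P (t - x)"
proof -
  have "AE t in distr lborel borel ((+) (- x)). P t"
    unfolding lborel_distr_plus by (rule assms)
  then have "AE t in lborel. P (- x + t)" by (rule AE_distrD[rotated]) simp
  then show ?thesis by simp
qed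

text \<open>Each value is an integral and does not see null sets, so the transforms agree at every
  point and not only almost everywhere.\<close>

lemma gabor_transform_AE:
  fixes f f' g g' :: "real^'n \<Rightarrow> complex"
  assumes g': "g' \<in> borel_measurable borel" and g: "AE t in lborel. g t = g' t"
    and f': "f' \<in> borel_measurable borel" and f: "AE t in lborel. f t = f' t"
  shows "gabor_transform g f = stft g' f'"
proof -
  have "gabor_transform g f z = gabor_transform g' f' z" for z
  proof -
    define h where "h t = f' t * cnj (g' (t - fst z)) * exp (- 2 * of_real pi * \<i> * of_real (snd z \<bullet> t))" for t
    have h[measurable]: "h \<in> borel_measurable borel" unfolding h_def using g' f' by measurable
    have "gabor_transform g f z = (\<integral>t. h t \<partial>lborel)"
      unfolding gabor_transform_def case_prod_unfold
    proof (rule lebesgue_integral_AE_borel[OF h])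
      show "AE t in lborel. f t * cnj (g (t - fst z)) * exp (- 2 * complex_of_real pi * \<i> * complex_of_real (snd z \<bullet> t)) = h t"
        using f AE_lborel_translate[OF g, of "fst z"] by eventually_elim (simp add: h_def)
    qed
    also have "\<dots> = (\<integral>t. h t \<partial>lebesgue)" by (rule integral_completion[symmetric]) simp
    also have "\<dots> = gabor_transform g' f' z" by (simp add: gabor_transform_def case_prod_unfold h_def)
    finally show ?thesis .
  qed
  then show ?thesis using gabor_transform_eq_stft[OF g' f'] by auto
qed

section \<open>Identification of the Gabor projection and of the count\<close>

context gabor_region
begin

text \<open>Here \<open>g'\<close> is any representative of the window and \<open>g\<close> is a
  Borel one.\<close>

context
  fixes g' :: "real^'n \<Rightarrow> complex"
  assumes g': "AE t in lborel. g' t = g t"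
begin

text \<open>An equality of sets of functions and not of classes, as the definite description in
  \<open>gabor_proj\<close> requires.\<close>

lemma gabor_space_eq: "gabor_space g' = V ` borel_L2"
proof
  show "gabor_space g' \<subseteq> V ` borel_L2"
  proof
    fix H assume "H \<in> gabor_space g'"
    then obtain f where f: "f \<in> L2_fun" "H = gabor_transform g' f" by (auto simp: gabor_space_def)
    obtain f' where f': "f' \<in> borel_L2" "AE t in lborel. f t = f' t" using L2_fun_borel_version[OF f(1)] .
    have "H = V f'" unfolding f(2) using f' by (intro gabor_transform_AE g' g_measurable) (measurable, auto)
    then show "H \<in> V ` borel_L2" using f' by blast
  qed
  show "V ` borel_L2 \<subseteq> gabor_space g'"
  proof
    fix H assume "H \<in> V ` borel_L2"
    then obtain f where f: "f \<in> borel_L2" "H = V f" by auto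
    have "gabor_transform g' f = V f" using f by (intro gabor_transform_AE g' g_measurable) (measurable, auto)
    then show "H \<in> gabor_space g'" unfolding gabor_space_def using f borel_L2_subset by (intro image_eqI[of _ _ f]) auto
  qed
qed

text \<open>Existence is the orthogonality of D F - P D F to the range of V. For uniqueness let V f
  be another solution and V s the known one: by the isometry d = f - s has <d, d> = 0, so d is
  orthogonal to every shifted window, and V f = V s at every point.\<close>

lemma gabor_proj_eq:
  assumes F': "F' \<in> borel_L2" and ae: "AE z in lborel. F z = F' z"
  shows "gabor_proj g' (restr_op A F) = proj F'"
proof -
  have F'm[measurable]: "F' \<in> borel_measurable borel" using F' by measurable
  have ip: "L2_ip (\<lambda>z. restr_op A F z - H z) (V h) = bip (cut F') (V h) - bip H (V h)"
    if H: "H \<in> borel_L2" and h: "h \<in> borel_L2" for H h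
  proof -
    have [measurable]: "H \<in> borel_measurable borel" "h \<in> borel_measurable borel"
      using H h by measurable
    have "L2_ip (\<lambda>z. restr_op A F z - H z) (V h) = bip (\<lambda>z. cut F' z - H z) (V h)"
    proof (rule L2_ip_eq_bip)
      show "AE z in lborel. restr_op A F z - H z = cut F' z - H z"
        using ae by eventually_elim (simp add: restr_op_def cut_def)
    qed simp_all
    also have "\<dots> = bip (cut F') (V h) - bip H (V h)"
      by (intro L2.ip_diff cut_mem F' H V_mem h)
    finally show ?thesis .
  qed
  show ?thesis
    unfolding gabor_proj_def gabor_space_eq
  proof (rule the_equality)
    show "proj F' \<in> V ` borel_L2 \<and> (\<forall>G\<in>V ` borel_L2. L2_ip (\<lambda>z. restr_op A F z - proj F' z) G = 0)"
      using ip[OF proj_mem[OF F']] bip_proj_V[OF F'] synthesis_mem[OF F'] by (auto simp: proj_eq[OF F'])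
  next
    fix H assume H: "H \<in> V ` borel_L2 \<and> (\<forall>G\<in>V ` borel_L2. L2_ip (\<lambda>z. restr_op A F z - H z) G = 0)"
    then obtain f where f: "f \<in> borel_L2" "H = V f" by auto
    define s where "s = synthesis F'"
    have s: "s \<in> borel_L2" unfolding s_def by (rule synthesis_mem[OF F'])
    define d where "d = (\<lambda>t. f t - s t)"
    have d: "d \<in> borel_L2" unfolding d_def by (intro L2.diff_mem f s)
    have "bip (V f) (V d) = bip (cut F') (V d)"
      using H f ip[OF V_mem[OF f(1)] d] d by auto
    also have "\<dots> = bip (V s) (V d)"
      using bip_proj_V[OF F' d] by (simp add: proj_eq[OF F'] s_def)
    finally have "bip f d = bip s d" using f s d by (simp add: bip_V)
    then have "L2.qf d = 0"
      unfolding d_def by (simp add: L2.ip_diff[OF f(1) s d[unfolded d_def]])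
    then have "bip d h = 0" if "h \<in> borel_L2" for h
      using L2.Cauchy_Schwarz[OF d that] by simp
    then have "V f z = V s z" for z
      unfolding stft_def using L2.ip_diff[OF f(1) s tf_shift_borel_L2(1)[OF g], of z] tf_shift_borel_L2(1)[OF g]
      by (simp add: d_def[symmetric])
    then show "H = proj F'" using f by (simp add: proj_eq[OF F'] s_def fun_eq_iff)
  qed
qed

lemma gabor_defect_eq:
  assumes F': "F' \<in> borel_L2" and ae: "AE z in lborel. F z = F' z"
  shows "(L2_nrm (\<lambda>z. restr_op A (gabor_proj g' (restr_op A F)) z - F z))\<^sup>2 = L2.qf (\<lambda>z. cut (proj F') z - F' z)"
proof (rule L2_nrm_eq)
  have [measurable]: "F' \<in> borel_measurable borel" "proj F' \<in> borel_measurable borel"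
    using F' proj_mem[OF F'] by measurable
  show "(\<lambda>z. cut (proj F') z - F' z) \<in> borel_measurable borel" by measurable
  show "AE z in lborel. restr_op A (gabor_proj g' (restr_op A F)) z - F z = cut (proj F') z - F' z"
    unfolding gabor_proj_eq[OF F' ae] using ae by eventually_elim (simp add: restr_op_def cut_def)
qed

text \<open>The set B itself indexes the chosen Borel versions, so its cardinality is kept whatever
  the choice.\<close>

lemma gabor_card_le:
  assumes B: "finite B" "L2_orthonormal B"
    and small: "\<And>F. F \<in> B \<Longrightarrow> (L2_nrm (\<lambda>z. restr_op A (gabor_proj g' (restr_op A F)) z - F z))\<^sup>2 \<le> \<epsilon>"
  shows "real (card B) * (1 - \<epsilon>) \<le> measure lborel A + leak"
proof -
  have "\<forall>F\<in>B. \<exists>F'. F' \<in> borel_L2 \<and> (AE z in lborel. F z = F' z)"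
    using B(2) unfolding L2_orthonormal_def by (metis L2_fun_borel_version subsetD)
  then obtain b where b: "\<And>F. F \<in> B \<Longrightarrow> b F \<in> borel_L2" "\<And>F. F \<in> B \<Longrightarrow> AE z in lborel. F z = b F z"
    by metis
  show ?thesis
  proof (rule card_le_of_small_defect[OF B(1), of b])
    fix F G assume FG: "F \<in> B" "G \<in> B"
    have "L2_ip F G = bip (b F) (b G)"
      using b FG by (intro L2_ip_eq_bip) (auto intro: borel_L2_measurable)
    then show "bip (b F) (b G) = (if F = G then 1 else 0)"
      using B(2) FG unfolding L2_orthonormal_def by simp
  next
    fix F assume F: "F \<in> B"
    show "L2.qf (\<lambda>z. cut (proj (b F)) z - b F z) \<le> \<epsilon>"
      using small[OF F] unfolding gabor_defect_eq[OF b(1)[OF F] b(2)[OF F]] .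
  qed (rule b(1))
qed

text \<open>Orthonormal members are distinct, so the family has an image of exactly N
  elements.\<close>

lemma gabor_eta_ge:
  assumes f: "L2.orthonormal_family N f" and small: "\<And>i. i < N \<Longrightarrow> L2.qf (\<lambda>z. cut (proj (f i)) z - f i z) \<le> \<epsilon>"
  shows "enat N \<le> gabor_eta g' \<epsilon> A"
proof -
  have mem: "f i \<in> borel_L2" if "i < N" for i using f that by (simp add: L2.orthonormal_family_def)
  have on: "bip (f i) (f j) = (if i = j then 1 else 0)" if "i < N" "j < N" for i j
    using f that by (simp add: L2.orthonormal_family_def)
  have inj: "inj_on f {..<N}"
  proof (rule inj_onI)
    fix i j assume "i \<in> {..<N}" "j \<in> {..<N}" "f i = f j"
    then show "i = j" using on[of i j] on[of i i] by (auto split: if_splits)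
  qed
  have "L2_orthonormal (f ` {..<N})"
    unfolding L2_orthonormal_def
  proof (intro conjI ballI)
    show "f ` {..<N} \<subseteq> L2_fun" using mem borel_L2_subset by auto
    fix F G assume "F \<in> f ` {..<N}" "G \<in> f ` {..<N}"
    then obtain i j where ij: "i < N" "j < N" "F = f i" "G = f j" by auto
    have "L2_ip F G = bip F G"
      using ij mem by (intro L2_ip_eq_bip) (auto intro: borel_L2_measurable)
    also have "\<dots> = (if F = G then 1 else 0)"
      using on[of i j] ij inj by (auto simp: inj_on_def)
    finally show "L2_ip F G = (if F = G then 1 else 0)" .
  qed
  moreover have "(L2_nrm (\<lambda>z. restr_op A (gabor_proj g' (restr_op A F)) z - F z))\<^sup>2 \<le> \<epsilon>" if F: "F \<in> f ` {..<N}" for F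
  proof -
    from F obtain i where i: "i < N" "F = f i" by auto
    show ?thesis using small[OF i(1)] unfolding i(2) by (subst gabor_defect_eq[OF mem[OF i(1)]]) auto
  qed
  ultimately have "enat (card (f ` {..<N})) \<le> gabor_eta g' \<epsilon> A"
    unfolding gabor_eta_def by (intro SUP_upper) auto
  then show ?thesis using inj by (simp add: card_image)
qed

text \<open>Every admissible cardinality is an integer not above u, hence at most its floor; in
  particular the supremum is finite.\<close>

lemma gabor_eta_le:
  assumes \<epsilon>: "\<epsilon> < 1"
  shows "ereal_of_enat (gabor_eta g' \<epsilon> A) \<le> ereal ((measure lborel A + leak) / (1 - \<epsilon>))"
proof -
  define u where "u = (measure lborel A + leak) / (1 - \<epsilon>)"
  have u: "0 \<le> u" using leak_nonneg \<epsilon> by (simp add: u_def)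
  have "gabor_eta g' \<epsilon> A \<le> enat (nat \<lfloor>u\<rfloor>)"
    unfolding gabor_eta_def
  proof (rule SUP_least)
    fix B assume "B \<in> {B. finite B \<and> L2_orthonormal B \<and>
        (\<forall>F\<in>B. (L2_nrm (\<lambda>z. restr_op A (gabor_proj g' (restr_op A F)) z - F z))\<^sup>2 \<le> \<epsilon>)}"
    then have "real (card B) * (1 - \<epsilon>) \<le> measure lborel A + leak"
      by (intro gabor_card_le) auto
    then have "real (card B) \<le> u" using \<epsilon> by (simp add: u_def field_simps)
    then show "enat (card B) \<le> enat (nat \<lfloor>u\<rfloor>)" by (simp add: le_nat_iff le_floor_iff)
  qed
  then have "ereal_of_enat (gabor_eta g' \<epsilon> A) \<le> ereal_of_enat (enat (nat \<lfloor>u\<rfloor>))"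
    by (simp only: ereal_of_enat_le_iff)
  also have "\<dots> \<le> ereal u" using u by simp
  finally show ?thesis by (simp add: u_def)
qed

end
end

section \<open>The limit of large dilations\<close>

text \<open>Covariance: substituting t + fst w merges the two shifts into one, up to a constant
  phase c of modulus 1.\<close>

lemma stft_shift_norm:
  assumes [measurable]: "g \<in> borel_measurable borel"
  shows "cmod (stft g (tf_shift w g) z) = cmod (stft g g (z - w))"
proof -
  define c where "c = chr (snd w \<bullet> fst w) * chr (- (snd z \<bullet> fst w))"
  have "stft g (tf_shift w g) z = (\<integral>t. tf_shift w g (t + fst w) * cnj (tf_shift z g (t + fst w)) \<partial>lborel)"
    unfolding stft_def bip_def
    by (rule lborel_integral_translate[symmetric]) measurable
  also have "\<dots> = (\<integral>t. c * (g t * cnj (tf_shift (z - w) g t)) \<partial>lborel)"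
  proof (intro Bochner_Integration.integral_cong refl)
    fix t
    have "chr (snd w \<bullet> (t + fst w)) * cnj (chr (snd z \<bullet> (t + fst w))) = c * cnj (chr ((snd z - snd w) \<bullet> t))"
      unfolding c_def cnj_chr chr_add[symmetric] by (rule arg_cong[of _ _ chr]) (simp add: algebra_simps inner_simps)
    then show "tf_shift w g (t + fst w) * cnj (tf_shift z g (t + fst w)) = c * (g t * cnj (tf_shift (z - w) g t))"
      unfolding tf_shift_def by (simp add: algebra_simps)
  qed
  also have "\<dots> = c * stft g g (z - w)" by (simp add: stft_def bip_def)
  finally show ?thesis by (simp add: norm_mult c_def)
qed

text \<open>For S of finite measure this is |S| minus the covariogram of S at u.\<close>

definition exit_measure :: "'a::euclidean_space set \<Rightarrow> 'a \<Rightarrow> real" where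
  "exit_measure S u = measure lborel {w \<in> S. w + u \<notin> S}"

lemma exit_measure_nonneg: "0 \<le> exit_measure S u"
  by (simp add: exit_measure_def)

lemma exit_set_measurable [measurable]:
  fixes S :: "'a::euclidean_space set"
  assumes [measurable]: "S \<in> sets borel"
  shows "{w \<in> S. w + u \<notin> S} \<in> sets borel"
  by measurable

lemma exit_measure_le:
  assumes S: "S \<in> sets borel" "emeasure lborel S < \<infinity>"
  shows "exit_measure S u \<le> measure lborel S"
  unfolding exit_measure_def using S by (intro measure_mono_fmeasurable) (auto simp: fmeasurable_def)

lemma emeasure_exit:
  assumes S: "S \<in> sets borel" "emeasure lborel S < \<infinity>"
  shows "emeasure lborel {w \<in> S. w + u \<notin> S} = ennreal (exit_measure S u)"
  unfolding exit_measure_def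
proof (rule emeasure_eq_ennreal_measure)
  have "emeasure lborel {w \<in> S. w + u \<notin> S} \<le> emeasure lborel S" using S by (intro emeasure_mono) auto
  with S show "emeasure lborel {w \<in> S. w + u \<notin> S} \<noteq> top" by (auto simp: top_unique)
qed

lemma exit_measure_measurable [measurable]:
  assumes S[measurable]: "S \<in> sets borel"
  shows "exit_measure S \<in> borel_measurable borel"
proof -
  have "(\<integral>\<^sup>+w. indicator S w * (1 - indicator S (w + u)) \<partial>lborel) = emeasure lborel {w \<in> S. w + u \<notin> S}" for u
    by (subst nn_integral_indicator[symmetric], simp)
      (intro nn_integral_cong, auto simp: indicator_def)
  then have "exit_measure S = (\<lambda>u. enn2real (\<integral>\<^sup>+w. indicator S w * (1 - indicator S (w + u)) \<partial>lborel))"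
    by (simp add: exit_measure_def measure_def fun_eq_iff)
  then show ?thesis by simp
qed

text \<open>A point leaves S only where the indicator changes under the shift, so the L^1 continuity
  of translations applies.\<close>

lemma exit_measure_tendsto:
  assumes S: "S \<in> sets borel" "emeasure lborel S < \<infinity>"
  shows "(exit_measure S \<longlongrightarrow> 0) (nhds 0)"
proof (rule tendsto_sandwich[of "\<lambda>_. 0"])
  have [measurable]: "S \<in> sets borel" by fact
  have int: "integrable lborel (indicator S :: _ \<Rightarrow> real)" using S by (intro integrable_real_indicator) auto
  show "((\<lambda>u. \<integral>x. \<bar>indicator S (x + u) - indicator S x\<bar> \<partial>lborel) \<longlongrightarrow> (0 :: real)) (nhds 0)"
    by (rule tendsto_L1_translation[OF int])
  show "\<forall>\<^sub>F u in nhds 0. exit_measure S u \<le> (\<integral>x. \<bar>indicator S (x + u) - indicator S x\<bar> \<partial>lborel)"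
  proof (intro always_eventually allI)
    fix u
    have "exit_measure S u = (\<integral>x. indicator {w \<in> S. w + u \<notin> S} x \<partial>lborel)"
      by (simp add: exit_measure_def)
    also have "\<dots> \<le> (\<integral>x. \<bar>indicator S (x + u) - indicator S x\<bar> \<partial>lborel)"
      by (intro integral_mono' integrable_abs Bochner_Integration.integrable_diff lborel_integrable_translate int)
        (auto simp: indicator_def)
    finally show "exit_measure S u \<le> (\<integral>x. \<bar>indicator S (x + u) - indicator S x\<bar> \<partial>lborel)" .
  qed
qed (auto simp: exit_measure_nonneg intro!: always_eventually)

lemma measure_scale:
  fixes S :: "'a::euclidean_space set"
  assumes S[measurable]: "S \<in> sets borel" and r: "0 < r"
  shows "(\<lambda>z. r *\<^sub>R z) ` S \<in> sets borel"
    and "emeasure lborel ((\<lambda>z. r *\<^sub>R z) ` S) = ennreal (r ^ DIM('a)) * emeasure lborel S"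
proof -
  have eq: "(\<lambda>z. r *\<^sub>R z) ` S = (\<lambda>z. z /\<^sub>R r) -` S"
    using r by (auto simp: image_iff intro!: bexI[of _ "_ /\<^sub>R r"])
  have "(\<lambda>z::'a. z /\<^sub>R r) -` S \<inter> space borel \<in> sets borel" by (rule measurable_sets[OF _ S]) measurable
  then show m[measurable]: "(\<lambda>z. r *\<^sub>R z) ` S \<in> sets borel" unfolding eq by simp
  have "emeasure lborel ((\<lambda>z. r *\<^sub>R z) ` S) = (\<integral>\<^sup>+x. indicator ((\<lambda>z. r *\<^sub>R z) ` S) x \<partial>lborel)" by simp
  also have "\<dots> = ennreal (\<bar>r\<bar> ^ DIM('a)) * (\<integral>\<^sup>+x. indicator ((\<lambda>z. r *\<^sub>R z) ` S) (0 + r *\<^sub>R x) \<partial>lborel)"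
    by (rule lborel_nn_integral_affine) (use r in auto)
  also have "(\<integral>\<^sup>+x. indicator ((\<lambda>z. r *\<^sub>R z) ` S) (0 + r *\<^sub>R x) \<partial>lborel) = (\<integral>\<^sup>+x. indicator S x \<partial>lborel)"
    using r by (intro nn_integral_cong) (auto simp: indicator_def)
  finally show "emeasure lborel ((\<lambda>z. r *\<^sub>R z) ` S) = ennreal (r ^ DIM('a)) * emeasure lborel S"
    using r by simp
qed

text \<open>Relative to the dilated set a fixed shift shrinks by the factor r; this is what makes
  boundary effects negligible.\<close>

lemma exit_measure_scale:
  fixes S :: "'a::euclidean_space set"
  assumes S[measurable]: "S \<in> sets borel" and r: "0 < r"
  shows "exit_measure ((\<lambda>z. r *\<^sub>R z) ` S) u = r ^ DIM('a) * exit_measure S (u /\<^sub>R r)"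
proof -
  have eq: "{w \<in> (\<lambda>z. r *\<^sub>R z) ` S. w + u \<notin> (\<lambda>z. r *\<^sub>R z) ` S} = (\<lambda>z. r *\<^sub>R z) ` {w \<in> S. w + u /\<^sub>R r \<notin> S}"
  proof -
    have "r *\<^sub>R x + u \<in> (\<lambda>z. r *\<^sub>R z) ` S \<longleftrightarrow> x + u /\<^sub>R r \<in> S" for x
    proof
      assume "r *\<^sub>R x + u \<in> (\<lambda>z. r *\<^sub>R z) ` S"
      then obtain y where y: "y \<in> S" "r *\<^sub>R x + u = r *\<^sub>R y" by auto
      then have "y = (r *\<^sub>R x + u) /\<^sub>R r" using r by simp
      also have "\<dots> = x + u /\<^sub>R r" using r by (simp add: scaleR_right_distrib)
      finally show "x + u /\<^sub>R r \<in> S" using y by simp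
    next
      assume "x + u /\<^sub>R r \<in> S"
      then show "r *\<^sub>R x + u \<in> (\<lambda>z. r *\<^sub>R z) ` S"
        using r by (intro image_eqI[of _ _ "x + u /\<^sub>R r"]) (simp_all add: scaleR_right_distrib)
    qed
    then show ?thesis by auto
  qed
  show ?thesis
    unfolding exit_measure_def eq measure_def using r
    by (subst measure_scale(2)) (auto simp: enn2real_mult)
qed

context gabor_region
begin

text \<open>The modulus of the kernel depends only on u = z - w, so after this substitution Tonelli
  leaves the exit measure as the inner integral over w.\<close>

lemma leak_eq: "leak = (\<integral>u. (cmod (V g u))\<^sup>2 * exit_measure A u \<partial>lborel)"
proof -
  have Vm[measurable]: "V g \<in> borel_measurable borel" by measurable
  have mass: "ennreal (mass z) = (\<integral>\<^sup>+w. indicator A w * ennreal ((cmod (V g (z - w)))\<^sup>2) \<partial>lborel)" for z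
    unfolding mass_eq stft_shift_norm[OF g_measurable] ..
  have int: "integrable lborel (\<lambda>z. indicator (- A) z * mass z)"
    by (intro integrable_weighted_mass) (auto simp: indicator_def)
  have int2: "integrable lborel (\<lambda>u. (cmod (V g u))\<^sup>2 * exit_measure A u)"
  proof (rule Bochner_Integration.integrable_bound)
    show "integrable lborel (\<lambda>u. (cmod (V g u))\<^sup>2 * measure lborel A)"
      by (intro integrable_mult_left borel_L2_integrable V_mem g)
    show "AE u in lborel. norm ((cmod (V g u))\<^sup>2 * exit_measure A u) \<le> norm ((cmod (V g u))\<^sup>2 * measure lborel A)"
      using exit_measure_le[OF A A_finite] by (intro AE_I2) (simp add: abs_mult exit_measure_nonneg mult_left_mono)
  qed measurable
  have "ennreal leak = (\<integral>\<^sup>+z. ennreal (indicator (- A) z * mass z) \<partial>lborel)"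
    unfolding leak_def by (rule nn_integral_eq_integral[symmetric, OF int]) (simp add: mass_nonneg)
  also have "\<dots> = (\<integral>\<^sup>+z. indicator (- A) z * (\<integral>\<^sup>+w. indicator A w * ennreal ((cmod (V g (z - w)))\<^sup>2) \<partial>lborel) \<partial>lborel)"
    unfolding mass[symmetric] by (intro nn_integral_cong) (simp add: indicator_def)
  also have "\<dots> = (\<integral>\<^sup>+z. \<integral>\<^sup>+w. indicator (- A) z * (indicator A w * ennreal ((cmod (V g (z - w)))\<^sup>2)) \<partial>lborel \<partial>lborel)"
    by (intro nn_integral_cong nn_integral_cmult[symmetric]) measurable
  also have "\<dots> = (\<integral>\<^sup>+w. \<integral>\<^sup>+z. indicator (- A) z * (indicator A w * ennreal ((cmod (V g (z - w)))\<^sup>2)) \<partial>lborel \<partial>lborel)"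
    by (rule lborel_pair.Fubini') measurable
  also have "\<dots> = (\<integral>\<^sup>+w. \<integral>\<^sup>+u. indicator (- A) (u + w) * (indicator A w * ennreal ((cmod (V g u))\<^sup>2)) \<partial>lborel \<partial>lborel)"
  proof (rule nn_integral_cong)
    fix w
    show "(\<integral>\<^sup>+z. indicator (- A) z * (indicator A w * ennreal ((cmod (V g (z - w)))\<^sup>2)) \<partial>lborel) =
      (\<integral>\<^sup>+u. indicator (- A) (u + w) * (indicator A w * ennreal ((cmod (V g u))\<^sup>2)) \<partial>lborel)"
      by (subst lborel_nn_integral_translate[symmetric, of _ w]) simp_all
  qed
  also have "\<dots> = (\<integral>\<^sup>+u. \<integral>\<^sup>+w. indicator (- A) (u + w) * (indicator A w * ennreal ((cmod (V g u))\<^sup>2)) \<partial>lborel \<partial>lborel)"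
    by (rule lborel_pair.Fubini') measurable
  also have "\<dots> = (\<integral>\<^sup>+u. ennreal ((cmod (V g u))\<^sup>2 * exit_measure A u) \<partial>lborel)"
  proof (rule nn_integral_cong)
    fix u
    have "(\<integral>\<^sup>+w. indicator (- A) (u + w) * (indicator A w * ennreal ((cmod (V g u))\<^sup>2)) \<partial>lborel) =
       (\<integral>\<^sup>+w. ennreal ((cmod (V g u))\<^sup>2) * indicator {w \<in> A. w + u \<notin> A} w \<partial>lborel)"
      by (intro nn_integral_cong) (auto simp: indicator_def add.commute)
    also have "\<dots> = ennreal ((cmod (V g u))\<^sup>2) * emeasure lborel {w \<in> A. w + u \<notin> A}"
      by (rule nn_integral_cmult_indicator) measurable
    also have "\<dots> = ennreal ((cmod (V g u))\<^sup>2 * exit_measure A u)"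
      by (simp add: emeasure_exit[OF A A_finite] ennreal_mult exit_measure_nonneg)
    finally show "(\<integral>\<^sup>+w. indicator (- A) (u + w) * (indicator A w * ennreal ((cmod (V g u))\<^sup>2)) \<partial>lborel) =
       ennreal ((cmod (V g u))\<^sup>2 * exit_measure A u)" .
  qed
  also have "\<dots> = ennreal (\<integral>u. (cmod (V g u))\<^sup>2 * exit_measure A u \<partial>lborel)"
    by (rule nn_integral_eq_integral[OF int2]) (simp add: exit_measure_nonneg)
  finally show ?thesis
    using leak_nonneg exit_measure_nonneg[of A] by (simp add: integral_nonneg_AE)
qed

end

text \<open>By scaling, the quotient is the integral of |V g(u)|^2 against
  \<open>exit_measure S\<close> at u / r. The integrand tends to 0 pointwise and is dominated by |S|
  |V g|^2.\<close>

lemma leak_scale_tendsto: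
  fixes g :: "real^'n \<Rightarrow> complex" and S :: "((real^'n) \<times> (real^'n)) set"
  assumes win: "gabor_window g" and S: "S \<in> sets borel" "emeasure lborel S < \<infinity>"
  shows "((\<lambda>r. gabor_region.leak g ((\<lambda>z. r *\<^sub>R z) ` S) / r ^ (2 * CARD('n))) \<longlongrightarrow> 0) at_top"
proof -
  interpret gabor_window g by (rule win)
  have [measurable]: "S \<in> sets borel" by fact
  have Vm[measurable]: "V g \<in> borel_measurable borel" by measurable
  have dim: "DIM((real^'n) \<times> (real^'n)) = 2 * CARD('n)" by simp
  have "((\<lambda>r. \<integral>u. (cmod (V g u))\<^sup>2 * exit_measure S (u /\<^sub>R r) \<partial>lborel) \<longlongrightarrow> (\<integral>u. 0 \<partial>(lborel :: ((real^'n) \<times> (real^'n)) measure))) at_top"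
  proof (rule integral_dominated_convergence_at_top)
    show "integrable lborel (\<lambda>u. (cmod (V g u))\<^sup>2 * measure lborel S)"
      using V_mem[OF g] by (intro integrable_mult_left borel_L2_integrable)
    show "\<forall>\<^sub>F r in at_top. AE u in lborel. norm ((cmod (V g u))\<^sup>2 * exit_measure S (u /\<^sub>R r)) \<le> (cmod (V g u))\<^sup>2 * measure lborel S"
      using exit_measure_le[OF S] by (intro always_eventually allI AE_I2) (simp add: abs_mult exit_measure_nonneg mult_left_mono)
    show "AE u in lborel. ((\<lambda>r. (cmod (V g u))\<^sup>2 * exit_measure S (u /\<^sub>R r)) \<longlongrightarrow> 0) at_top"
    proof (rule AE_I2)
      fix u :: "(real^'n) \<times> (real^'n)"
      have "((\<lambda>r. inverse r *\<^sub>R u) \<longlongrightarrow> 0 *\<^sub>R u) at_top"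
        by (rule tendsto_scaleR[OF tendsto_inverse_0_at_top[OF filterlim_ident] tendsto_const])
      then have "filterlim (\<lambda>r. u /\<^sub>R r) (nhds 0) at_top" by simp
      from tendsto_mult_right_zero[OF filterlim_compose[OF exit_measure_tendsto[OF S] this]]
      show "((\<lambda>r. (cmod (V g u))\<^sup>2 * exit_measure S (u /\<^sub>R r)) \<longlongrightarrow> 0) at_top" .
    qed
  qed measurable
  then have lim: "((\<lambda>r. \<integral>u. (cmod (V g u))\<^sup>2 * exit_measure S (u /\<^sub>R r) \<partial>lborel) \<longlongrightarrow> 0) at_top" by simp
  have "\<forall>\<^sub>F r in at_top. gabor_region.leak g ((\<lambda>z. r *\<^sub>R z) ` S) / r ^ (2 * CARD('n)) =
      (\<integral>u. (cmod (V g u))\<^sup>2 * exit_measure S (u /\<^sub>R r) \<partial>lborel)"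
    using eventually_gt_at_top[of 0]
  proof eventually_elim
    case (elim r)
    interpret gabor_region g "(\<lambda>z. r *\<^sub>R z) ` S"
    proof
      show "(\<lambda>z. r *\<^sub>R z) ` S \<in> sets borel" by (rule measure_scale(1)[OF S(1) elim])
      show "emeasure lborel ((\<lambda>z. r *\<^sub>R z) ` S) < \<infinity>"
        unfolding measure_scale(2)[OF S(1) elim] using S(2) by (simp add: ennreal_mult_less_top)
    qed
    have "leak = r ^ (2 * CARD('n)) * (\<integral>u. (cmod (V g u))\<^sup>2 * exit_measure S (u /\<^sub>R r) \<partial>lborel)"
      unfolding leak_eq exit_measure_scale[OF S(1) elim] dim
      by (subst integral_mult_right_zero[symmetric]) (simp add: mult.left_commute)
    then show ?case using elim by simp
  qed
  with lim show ?thesis by (simp add: tendsto_cong)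
qed

section \<open>Bounds for the count at one scale, and the limit\<close>

lemma gabor_eta_scaled_le:
  fixes g g' :: "real^'n \<Rightarrow> complex" and S :: "((real^'n) \<times> (real^'n)) set"
  assumes g: "gabor_window g" and g': "AE t in lborel. g' t = g t"
    and S: "S \<in> sets borel" "emeasure lborel S < \<infinity>" and r: "0 < r"
    and \<epsilon>: "\<epsilon> < 1"
  defines "A \<equiv> (\<lambda>z. r *\<^sub>R z) ` S" and "R \<equiv> r ^ (2 * CARD('n))"
  defines "q \<equiv> gabor_region.leak g A / R"
  shows "ereal_of_enat (gabor_eta g' \<epsilon> A) / ereal R \<le> ereal ((measure lborel S + q) / (1 - \<epsilon>))"
proof -
  have R: "0 < R" using r by (simp add: R_def)
  have dim: "DIM((real^'n) \<times> (real^'n)) = 2 * CARD('n)" by simp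
  interpret gabor_region g A
  proof (intro gabor_region.intro gabor_region_axioms.intro g)
    show "A \<in> sets borel" unfolding A_def by (rule measure_scale(1)[OF S(1) r])
    show "emeasure lborel A < \<infinity>"
      unfolding A_def measure_scale(2)[OF S(1) r] using S(2) by (simp add: ennreal_mult_less_top)
  qed
  define \<alpha> where "\<alpha> = measure lborel S"
  have mA: "measure lborel A = \<alpha> * R"
    unfolding A_def \<alpha>_def R_def measure_def measure_scale(2)[OF S(1) r] dim using r by (simp add: enn2real_mult mult.commute)
  have leak: "leak = q * R" using R by (simp add: q_def)
  have "ereal_of_enat (gabor_eta g' \<epsilon> A) / ereal R \<le> ereal ((measure lborel A + leak) / (1 - \<epsilon>)) / ereal R"
    by (rule ereal_divide_right_mono[OF gabor_eta_le[OF g' \<epsilon>]]) (use R in simp)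
  also have "\<dots> = ereal ((\<alpha> + q) / (1 - \<epsilon>))"
    using R by (simp add: mA leak distrib_right[symmetric])
  finally show ?thesis
    by (simp add: \<alpha>_def)
qed

text \<open>N is the integer part of |A| (1 - \<delta>) / (1 - \<epsilon>), so N (1 - \<epsilon>)
  leaves a slack of at least \<alpha> \<delta> R below |A|. Of this, (leak + \<sigma>) / (1 -
  \<theta>) uses at most a half and the further leak at most a quarter.\<close>

lemma gabor_eta_scaled_ge:
  fixes g g' :: "real^'n \<Rightarrow> complex" and S :: "((real^'n) \<times> (real^'n)) set"
  assumes g: "gabor_window g" and g': "AE t in lborel. g' t = g t"
    and S: "S \<in> sets borel" "emeasure lborel S < \<infinity>" and r: "0 < r"
    and \<epsilon>: "\<epsilon> < 1"
  defines "A \<equiv> (\<lambda>z. r *\<^sub>R z) ` S" and "R \<equiv> r ^ (2 * CARD('n))"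
  defines "q \<equiv> gabor_region.leak g A / R" and "\<alpha> \<equiv> measure lborel S"
  assumes \<alpha>0: "0 < \<alpha>" and \<delta>: "0 < \<delta>" "\<delta> \<le> 1" and \<theta>: "\<theta> < 1" "0 < \<theta>"
    and big: "1 < \<alpha> * ((1 - \<delta>) / (1 - \<epsilon>)) * R"
      "\<alpha> * R < \<theta> * (\<alpha> * ((1 - \<delta>) / (1 - \<epsilon>)) * R - 1)"
    and q: "q < \<alpha> * \<delta> * (1 - \<theta>) / 4"
  shows "ereal (\<alpha> * ((1 - \<delta>) / (1 - \<epsilon>)) - 1 / R) \<le> ereal_of_enat (gabor_eta g' \<epsilon> A) / ereal R"
proof -
  have R: "0 < R" using r by (simp add: R_def)
  have dim: "DIM((real^'n) \<times> (real^'n)) = 2 * CARD('n)" by simp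
  interpret gabor_region g A
  proof (intro gabor_region.intro gabor_region_axioms.intro g)
    show "A \<in> sets borel" unfolding A_def by (rule measure_scale(1)[OF S(1) r])
    show "emeasure lborel A < \<infinity>"
      unfolding A_def measure_scale(2)[OF S(1) r] using S(2) by (simp add: ennreal_mult_less_top)
  qed
  have mA: "measure lborel A = \<alpha> * R"
    unfolding A_def \<alpha>_def R_def measure_def measure_scale(2)[OF S(1) r] dim using r by (simp add: enn2real_mult mult.commute)
  have leak: "leak = q * R" using R by (simp add: q_def)
  define x where "x = (\<alpha> * ((1 - \<delta>) / (1 - \<epsilon>))) * R"
  define N where "N = nat \<lfloor>x\<rfloor>"
  have x1: "1 < x" using big(1) by (simp add: x_def)
  have N: "real N \<le> x" "x - 1 < real N" "0 < N" using x1 unfolding N_def by linarith+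
  \<comment> \<open>The second part of \<open>big\<close> is stated with x - 1, a lower bound for N
    after rounding.\<close>
  have \<theta>N: "measure lborel A / real N < \<theta>"
  proof -
    have "\<alpha> * R < \<theta> * (x - 1)" using big(2) by (simp add: x_def)
    also have "\<dots> < \<theta> * real N" using N \<theta> by simp
    finally show ?thesis unfolding mA using N by (simp add: divide_less_eq)
  qed
  \<comment> \<open>A quarter of the slack, times 1 - \<theta> to make up for the later division by
    1 - \<theta>.\<close>
  define \<sigma> where "\<sigma> = \<alpha> * \<delta> * (1 - \<theta>) / 4 * R"
  have \<sigma>: "0 < \<sigma>" using \<alpha>0 \<delta> \<theta> R by (simp add: \<sigma>_def)
  have leak\<sigma>: "leak \<le> \<sigma>" using q R unfolding leak \<sigma>_def by (intro mult_right_mono) auto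
  have "real N * (1 - \<epsilon>) + (leak + \<sigma>) / (1 - \<theta>) \<le> measure lborel A - leak"
  proof -
    have "real N * (1 - \<epsilon>) \<le> x * (1 - \<epsilon>)" using N \<epsilon> by (intro mult_right_mono) auto
    also have "\<dots> = \<alpha> * (1 - \<delta>) * R" using \<epsilon> by (simp add: x_def)
    finally have 1: "real N * (1 - \<epsilon>) \<le> \<alpha> * R - \<alpha> * \<delta> * R" by (simp add: algebra_simps)
    have "(leak + \<sigma>) / (1 - \<theta>) \<le> (2 * \<sigma>) / (1 - \<theta>)"
      using leak\<sigma> \<theta> by (intro divide_right_mono) auto
    also have "2 * \<sigma> = (\<alpha> * \<delta> * R / 2) * (1 - \<theta>)" by (simp add: \<sigma>_def)
    also have "\<dots> / (1 - \<theta>) = \<alpha> * \<delta> * R / 2" using \<theta>(1) by (intro nonzero_mult_div_cancel_right) simp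
    finally have 2: "(leak + \<sigma>) / (1 - \<theta>) \<le> \<alpha> * \<delta> * R / 2" .
    have "\<sigma> = (\<alpha> * \<delta> * R) * (1 - \<theta>) / 4" by (simp add: \<sigma>_def)
    also have "\<dots> \<le> (\<alpha> * \<delta> * R) * 1 / 4"
      using \<alpha>0 \<delta> \<theta> R by (intro divide_right_mono mult_left_mono) auto
    finally have 3: "\<sigma> \<le> \<alpha> * \<delta> * R / 4" by simp
    have "0 \<le> \<alpha> * \<delta> * R" using \<alpha>0 \<delta> R by simp
    with 1 2 3 leak\<sigma> show ?thesis unfolding mA by linarith
  qed
  from small_defect_family[OF N(3) \<theta>N \<theta>(1) this \<sigma>]
  obtain f where "L2.orthonormal_family N f" "\<And>i. i < N \<Longrightarrow> L2.qf (\<lambda>z. cut (proj (f i)) z - f i z) \<le> \<epsilon>"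
    by blast
  then have "enat N \<le> gabor_eta g' \<epsilon> A" by (rule gabor_eta_ge[OF g'])
  then have "ereal_of_enat (enat N) \<le> ereal_of_enat (gabor_eta g' \<epsilon> A)"
    by (simp only: ereal_of_enat_le_iff)
  then have le: "ereal (real N) / ereal R \<le> ereal_of_enat (gabor_eta g' \<epsilon> A) / ereal R"
    using R by (intro ereal_divide_right_mono) auto
  \<comment> \<open>Rounding down costs less than 1, hence the term 1 / R.\<close>
  have "\<alpha> * ((1 - \<delta>) / (1 - \<epsilon>)) - 1 / R \<le> real N / R"
  proof -
    have "\<alpha> * ((1 - \<delta>) / (1 - \<epsilon>)) - 1 / R = (x - 1) / R" using R by (simp add: x_def diff_divide_distrib)
    also have "\<dots> \<le> real N / R" using N R by (intro divide_right_mono) auto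
    finally show ?thesis .
  qed
  then have "ereal (\<alpha> * ((1 - \<delta>) / (1 - \<epsilon>)) - 1 / R) \<le> ereal (real N) / ereal R" using R by simp
  then show ?thesis using le by (rule order_trans)
qed

text \<open>Above, only the leak separates the count from the limit. Below, \<delta> and \<theta>
  are fixed depending on the target a, and r is taken large afterwards.\<close>

lemma gabor_eta_tendsto:
  fixes g g' :: "real^'n \<Rightarrow> complex" and S :: "((real^'n) \<times> (real^'n)) set"
  assumes g: "gabor_window g" and g': "AE t in lborel. g' t = g t"
    and S: "S \<in> sets borel" "emeasure lborel S < \<infinity>"
    and \<epsilon>: "0 < \<epsilon>" "\<epsilon> < 1"
  shows "((\<lambda>r. ereal_of_enat (gabor_eta g' \<epsilon> ((\<lambda>z. r *\<^sub>R z) ` S)) / ereal (r ^ (2 * CARD('n))))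
    \<longlongrightarrow> ereal (measure lborel S / (1 - \<epsilon>))) at_top"
proof -
  define \<alpha> where "\<alpha> = measure lborel S"
  have \<alpha>: "0 \<le> \<alpha>" by (simp add: \<alpha>_def)
  define q where "q r = gabor_region.leak g ((\<lambda>z. r *\<^sub>R z) ` S) / r ^ (2 * CARD('n))" for r
  have q0: "(q \<longlongrightarrow> 0) at_top" unfolding q_def by (rule leak_scale_tendsto[OF g S])
  define E where "E r = ereal_of_enat (gabor_eta g' \<epsilon> ((\<lambda>z. r *\<^sub>R z) ` S)) / ereal (r ^ (2 * CARD('n)))" for r
  have Rlim: "filterlim (\<lambda>r::real. r ^ (2 * CARD('n))) at_top at_top"
    by (rule filterlim_pow_at_top) (auto simp: filterlim_ident)
  have "(E \<longlongrightarrow> ereal (\<alpha> / (1 - \<epsilon>))) at_top"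
  proof (rule order_tendstoI)
    fix a assume a: "ereal (\<alpha> / (1 - \<epsilon>)) < a"
    have "((\<lambda>r. ereal ((\<alpha> + q r) / (1 - \<epsilon>))) \<longlongrightarrow> ereal ((\<alpha> + 0) / (1 - \<epsilon>))) at_top"
      by (intro tendsto_intros q0) (use \<epsilon> in simp)
    then have "\<forall>\<^sub>F r in at_top. ereal ((\<alpha> + q r) / (1 - \<epsilon>)) < a"
      using a by (intro order_tendstoD(2)[where y="ereal (\<alpha> / (1 - \<epsilon>))"]) simp_all
    then show "\<forall>\<^sub>F r in at_top. E r < a"
      using eventually_gt_at_top[of 0]
    proof eventually_elim
      case (elim r)
      have "E r \<le> ereal ((\<alpha> + q r) / (1 - \<epsilon>))"
        unfolding E_def q_def \<alpha>_def by (rule gabor_eta_scaled_le[OF g g' S elim(2) \<epsilon>(2)])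
      with elim show ?case by simp
    qed
  next
    fix a assume a: "a < ereal (\<alpha> / (1 - \<epsilon>))"
    show "\<forall>\<^sub>F r in at_top. a < E r"
    proof (cases "\<alpha> = 0")
      \<comment> \<open>For a null set the limit is 0 and nonnegativity of the count is enough; the
        construction of families is reserved for \<alpha> > 0.\<close>
      case True
      show ?thesis
        using eventually_gt_at_top[of 0]
      proof eventually_elim
        case (elim r)
        have "0 \<le> E r" unfolding E_def using elim by (simp add: zero_le_divide_ereal)
        with a True show ?case by (simp add: order_less_le_trans zero_ereal_def)
      qed
    next
      case False
      with \<alpha> have \<alpha>0: "0 < \<alpha>" by simp
      have "((\<lambda>\<delta>. ereal (\<alpha> * ((1 - \<delta>) / (1 - \<epsilon>)))) \<longlongrightarrow> ereal (\<alpha> * ((1 - 0) / (1 - \<epsilon>)))) (at_right 0)"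
        by (intro tendsto_intros) (use \<epsilon> in auto)
      then have "\<forall>\<^sub>F \<delta> in at_right 0. a < ereal (\<alpha> * ((1 - \<delta>) / (1 - \<epsilon>)))"
        using a by (intro order_tendstoD(1)[where y="ereal (\<alpha> / (1 - \<epsilon>))"]) simp_all
      \<comment> \<open>\<delta> < \<epsilon> makes \<rho> > 1, so that N eventually exceeds
        |A|.\<close>
      moreover have "\<forall>\<^sub>F \<delta> in at_right 0. \<delta> \<in> {0<..<\<epsilon>}"
        using \<epsilon> by (intro eventually_at_right_real)
      ultimately have "\<forall>\<^sub>F \<delta> in at_right 0. a < ereal (\<alpha> * ((1 - \<delta>) / (1 - \<epsilon>))) \<and> 0 < \<delta> \<and> \<delta> < \<epsilon>"
        by eventually_elim auto
      then obtain \<delta> where \<delta>: "a < ereal (\<alpha> * ((1 - \<delta>) / (1 - \<epsilon>)))" "0 < \<delta>" "\<delta> < \<epsilon>"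
        using eventually_happens[of _ "at_right (0::real)"] by (auto simp: trivial_limit_at_right_real)
      define \<rho> where "\<rho> = (1 - \<delta>) / (1 - \<epsilon>)"
      have \<rho>: "1 < \<rho>" using \<delta> \<epsilon> by (simp add: \<rho>_def)
      \<comment> \<open>The midpoint of 1 / \<rho> and 1: the quotient |A| / N tends to 1 / \<rho>
        and is eventually below \<theta>.\<close>
      define \<theta> where "\<theta> = (1 / \<rho> + 1) / 2"
      have \<theta>: "\<theta> < 1" "0 < \<theta>" "1 < \<theta> * \<rho>" using \<rho> by (auto simp: \<theta>_def field_simps)
      have 1: "\<forall>\<^sub>F r in at_top. 1 / (\<alpha> * \<rho>) < r ^ (2 * CARD('n))"
        using Rlim by (simp add: filterlim_at_top_dense)
      \<comment> \<open>The threshold is \<alpha> R < \<theta> (\<alpha> \<rho> R - 1) solved for R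
        = r^(2d).\<close>
      have 2: "\<forall>\<^sub>F r in at_top. \<theta> / (\<alpha> * (\<theta> * \<rho> - 1)) < r ^ (2 * CARD('n))"
        using Rlim by (simp add: filterlim_at_top_dense)
      have 3: "\<forall>\<^sub>F r in at_top. q r < \<alpha> * \<delta> * (1 - \<theta>) / 4"
        using \<alpha>0 \<delta> \<theta> by (intro order_tendstoD(2)[OF q0]) simp
      have "((\<lambda>r::real. ereal (\<alpha> * \<rho> - 1 / r ^ (2 * CARD('n)))) \<longlongrightarrow> ereal (\<alpha> * \<rho> - 0)) at_top"
        by (intro tendsto_intros tendsto_divide_0[OF tendsto_const] filterlim_at_top_imp_at_infinity Rlim)
      then have 4: "\<forall>\<^sub>F r in at_top. a < ereal (\<alpha> * \<rho> - 1 / r ^ (2 * CARD('n)))"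
        using \<delta>(1) by (intro order_tendstoD(1)[where y="ereal (\<alpha> * \<rho>)"]) (simp_all add: \<rho>_def)
      show ?thesis
        using 1 2 3 4 eventually_gt_at_top[of 0]
      proof eventually_elim
        case (elim r)
        have b1: "1 < \<alpha> * \<rho> * r ^ (2 * CARD('n))"
          using elim(1) \<alpha>0 \<rho> by (simp add: field_simps)
        have "\<theta> < \<alpha> * (\<theta> * \<rho> - 1) * r ^ (2 * CARD('n))"
          using elim(2) \<alpha>0 \<theta> by (simp add: divide_less_eq mult.commute)
        then have b2: "\<alpha> * r ^ (2 * CARD('n)) < \<theta> * (\<alpha> * \<rho> * r ^ (2 * CARD('n)) - 1)"
          by (simp add: algebra_simps)
        have "ereal (\<alpha> * \<rho> - 1 / r ^ (2 * CARD('n))) \<le> E r"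
          unfolding E_def \<alpha>_def \<rho>_def
          by (rule gabor_eta_scaled_ge[OF g g' S elim(5) \<epsilon>(2), where \<theta>=\<theta>])
            (use \<alpha>0 b1 b2 \<theta> \<delta> \<epsilon> elim(3) in \<open>simp_all add: \<alpha>_def \<rho>_def q_def\<close>)
        with elim(4) show ?case by simp
      qed
    qed
  qed
  then show ?thesis unfolding E_def[abs_def] \<alpha>_def .
qed

theorem theorem2:
  fixes g :: "real^'n \<Rightarrow> complex"
    and S :: "((real^'n) \<times> (real^'n)) set"
    and \<epsilon> :: real
  assumes "g \<in> L2_fun" and "L2_nrm g = 1"
    and "compact S"
    and "0 < \<epsilon>" and "\<epsilon> < 1/2"
  shows "\<exists>L::real.
    ((\<lambda>r::real. ereal_of_enat (gabor_eta g \<epsilon> ((\<lambda>z. r *\<^sub>R z) ` S)) / ereal (r ^ (2 * CARD('n))))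
       \<longlongrightarrow> ereal L) at_top
    \<and> measure lebesgue S * (1 + \<epsilon>) \<le> L
    \<and> L \<le> measure lebesgue S / (1 - 2 * \<epsilon>)"
proof -
  obtain h where h: "h \<in> borel_L2" "AE t in lborel. g t = h t"
    using L2_fun_borel_version[OF assms(1)] .
  have "(L2_nrm g)\<^sup>2 = L2.qf h" using h by (intro L2_nrm_eq borel_L2_measurable)
  then have window: "gabor_window h" using h(1) assms(2) by (simp add: gabor_window_def)
  have S: "S \<in> sets borel" "emeasure lborel S < \<infinity>"
    using emeasure_compact_finite[OF assms(3)] assms(3) by (simp_all add: borel_compact)
  define \<alpha> where "\<alpha> = measure lborel S"
  have \<alpha>: "0 \<le> \<alpha>" by (simp add: \<alpha>_def)
  have meas: "measure lebesgue S = \<alpha>" using S(1) by (simp add: \<alpha>_def)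
  \<comment> \<open>(1 + \<epsilon>) (1 - \<epsilon>) = 1 - \<epsilon>^2 \<le> 1, which puts 1 +
    \<epsilon> below 1 / (1 - \<epsilon>).\<close>
  have "\<alpha> * (1 + \<epsilon>) * (1 - \<epsilon>) \<le> \<alpha>"
    using mult_left_mono[of "(1 + \<epsilon>) * (1 - \<epsilon>)" 1 \<alpha>] \<alpha> zero_le_power2[of \<epsilon>]
    by (simp add: algebra_simps power2_eq_square)
  then have "\<alpha> * (1 + \<epsilon>) \<le> \<alpha> / (1 - \<epsilon>)" using assms(5) by (simp add: le_divide_eq)
  moreover have "\<alpha> / (1 - \<epsilon>) \<le> \<alpha> / (1 - 2 * \<epsilon>)"
    using \<alpha> assms(4,5) by (intro divide_left_mono) auto
  moreover have "((\<lambda>r::real. ereal_of_enat (gabor_eta g \<epsilon> ((\<lambda>z. r *\<^sub>R z) ` S)) / ereal (r ^ (2 * CARD('n))))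
       \<longlongrightarrow> ereal (\<alpha> / (1 - \<epsilon>))) at_top"
    unfolding \<alpha>_def using assms(4,5) by (intro gabor_eta_tendsto[OF window h(2) S]) auto
  ultimately show ?thesis unfolding meas by blast
qed

end
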